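(* Let $f(s)$ be an almost periodic function in an open vertical strip $U=\{s=\sigma+it:\alpha<\sigma<\beta\}$, where $-\infty\le\alpha<\beta\le\infty$, whose set of Fourier exponents $\{\lambda_1,\lambda_2,\ldots\}$ is linearly independent over $\mathbb{Q}$ and has at least three elements. Then the set $\{\operatorname{Re}s: f(s)=0,\ s\in U\}$ of the real projections of the zeros of $f$ in $U$ has no isolated point in $(\alpha,\beta)$.
   Context: Write $s=\sigma+it$ with $\sigma,t\in\mathbb{R}$. A function $f$, analytic in the vertical strip $U=\{\sigma+it:\alpha<\sigma<\beta\}$, is called almost periodic in $U$ if for every reduced strip $\{\alpha_1\le\sigma\le\beta_1\}$ with $\alpha<\alpha_1<\beta_1<\beta$ and every $\varepsilon>0$ there is $l>0$ such that each interval of length $l$ on the real line contains a number $\tau$ with $|f(s+i\tau)-f(s)|\le\varepsilon$ for all $s$ in the reduced strip. Equivalently, $f$ is a uniform limit, on every reduced strip of $U$, of exponential polynomials $a_1e^{\lambda_1s}+\cdots+a_ne^{\lambda_ns}$ with $a_j\in\mathbb{C}$, $\lambda_j\in\mathbb{R}$. Fourier exponents: for $\lambda\in\mathbb{R}$ the number $a(\lambda)=\lim_{T\to\infty}\frac1{2T}\int_{-T}^{T}f(\sigma+it)e^{-\lambda(\sigma+it)}\,dt$ exists and does not depend on $\sigma\in(\alpha,\beta)$. It is nonzero for at most countably many $\lambda$, called the Fourier exponents of $f$ and enumerated as $\lambda_1,\lambda_2,\ldots$ (distinct; finitely or infinitely many). It is a known fact that if the Fourier exponents are linearly independent over $\mathbb{Q}$,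 the Dirichlet series $\sum_{n\ge1}a(\lambda_n)e^{\lambda_ns}$ converges absolutely to $f$ in $U$. *)

theory Defs
  imports "HOL-Complex_Analysis.Complex_Analysis"
begin

definition vertical_strip :: "ereal \<Rightarrow> ereal \<Rightarrow> complex set" where
  "vertical_strip \<alpha> \<beta> = {s. \<alpha> < ereal (Re s) \<and> ereal (Re s) < \<beta>}"

definition almost_periodic_on_strip :: "(complex \<Rightarrow> complex) \<Rightarrow> ereal \<Rightarrow> ereal \<Rightarrow> bool" where
  "almost_periodic_on_strip f \<alpha> \<beta> \<longleftrightarrow>
     f analytic_on vertical_strip \<alpha> \<beta> \<and>
     (\<forall>\<alpha>1 \<beta>1 :: real. \<alpha> < ereal \<alpha>1 \<and> \<alpha>1 < \<beta>1 \<and> ereal \<beta>1 < \<beta> \<longrightarrow>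
       (\<forall>\<epsilon>>0. \<exists>l>0. \<forall>a::real. \<exists>\<tau>\<in>{a..a + l}.
          \<forall>s. \<alpha>1 \<le> Re s \<and> Re s \<le> \<beta>1 \<longrightarrow>
            cmod (f (s + \<i> * complex_of_real \<tau>) - f s) \<le> \<epsilon>))"

text \<open>
  The Fourier coefficient is given as a relation rather than through a choice operator, so that a
  limit that fails to exist or that depends on \<open>\<sigma>\<close> yields no coefficient instead of an arbitrary
  one. On a nonempty strip the value \<open>c\<close> is unique, and for almost periodic \<open>f\<close> it exists for
  every \<open>\<mu>\<close>.
\<close>
definition has_fourier_coeff ::
    "(complex \<Rightarrow> complex) \<Rightarrow> ereal \<Rightarrow> ereal \<Rightarrow> real \<Rightarrow> complex \<Rightarrow> bool" where
  "has_fourier_coeff f \<alpha> \<beta> \<mu> c \<longleftrightarrow>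
     (\<forall>\<sigma>::real. \<alpha> < ereal \<sigma> \<and> ereal \<sigma> < \<beta> \<longrightarrow>
       ((\<lambda>T. 1 / complex_of_real (2 * T) *
             integral {-T..T} (\<lambda>t. f (Complex \<sigma> t) * exp (- (complex_of_real \<mu> * Complex \<sigma> t))))
         \<longlongrightarrow> c) at_top)"

definition fourier_exponents :: "(complex \<Rightarrow> complex) \<Rightarrow> ereal \<Rightarrow> ereal \<Rightarrow> real set" where
  "fourier_exponents f \<alpha> \<beta> = {\<mu>. \<exists>c. has_fourier_coeff f \<alpha> \<beta> \<mu> c \<and> c \<noteq> 0}"

definition rat_lin_independent :: "real set \<Rightarrow> bool" where
  "rat_lin_independent S \<longleftrightarrow> module.independent (\<lambda>(q::rat) (x::real). of_rat q * x) S"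

end

theory Submission
  imports Defs
begin

text \<open>
  On a vertical line \<open>f\<close> is a Bohr almost periodic function of \<open>t\<close>. When its exponents are independent,
  Riesz products bound the sum of the absolute values of its coefficients, and the uniqueness theorem
  identifies \<open>f\<close> with its absolutely convergent series \<open>\<Sum>\<nu>. c \<nu> * exp (\<nu> * s)\<close>. By Kronecker's theorem
  the phases of the terms can be prescribed, so by Hurwitz's theorem there are zeros with abscissa
  arbitrarily close to \<open>\<sigma>\<close> whenever the lengths \<open>\<bar>c \<nu>\<bar> * exp (\<nu> * \<sigma>)\<close> are the sides of a closed polygon,
  that is, unless one of them exceeds the sum of the others. If \<open>x\<close> were an isolated abscissa of zeros,
  one term would dominate on the left of \<open>x\<close> and one on the right, and both would equal the sum of the
  others at \<open>x\<close>. The same term on both sides contradicts convexity; two different terms leave no room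
  for a third one.
\<close>

section \<open>Bohr almost periodic functions and their means\<close>

text \<open>The obstacle in the uniqueness theorem is that \<open>F t * cis (- (\<mu> * t))\<close>
  is not visibly almost periodic as long as common almost periods of two functions are out of reach,
  so even the existence of its mean is in doubt. The way out is a dichotomy. Either all long windows
  correlate little with \<mu>, and the mean is 0; or a fixed fraction of correlation persists on
  arbitrarily long windows, and then every fine almost period \<tau> of \<open>F\<close> must nearly
  satisfy \<open>cis (\<mu> * \<tau>) = 1\<close>, so that \<open>F\<close> dominates the
  oscillation. The same resonance makes \<open>F\<close> minus its series almost periodic and pins
  down a frequency of any nonzero almost periodic function; there a finite Fourier transform of
  samples replaces a Parseval identity on the line. Means are uniform in the position of the window
  because the windows found this way can lie anywhere. Hurwitz's theorem is applied on one side of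
  the suspected isolated abscissa at a time, so that the zero it produces lies on that very
  side.\<close>

definition almost_period :: "(real \<Rightarrow> complex) \<Rightarrow> real \<Rightarrow> real \<Rightarrow> bool" where
  "almost_period u \<epsilon> \<tau> \<longleftrightarrow> (\<forall>t. norm (u (t + \<tau>) - u t) \<le> \<epsilon>)"

definition bohr_ap :: "(real \<Rightarrow> complex) \<Rightarrow> bool" where
  "bohr_ap u \<longleftrightarrow> continuous_on UNIV u \<and> (\<forall>\<epsilon>>0. \<exists>l>0. \<forall>a. \<exists>\<tau>\<in>{a..a + l}. almost_period u \<epsilon> \<tau>)"

text \<open>Comparing almost periodic functions with a single one that dominates them avoids the search for common almost periods of two functions.\<close>
definition dominated :: "(real \<Rightarrow> complex) \<Rightarrow> (real \<Rightarrow> complex) \<Rightarrow> bool" where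
  "dominated F u \<longleftrightarrow> (\<forall>\<epsilon>>0. \<exists>\<delta>>0. \<forall>\<tau>. almost_period F \<delta> \<tau> \<longrightarrow> almost_period u \<epsilon> \<tau>)"

text \<open>Uniformity in the left end \<open>a\<close> is essential: the windows that witness a
  correlation are found at uncontrolled places, and a vanishing mean has to exclude all of them. The
  error \<open>\<epsilon> * T\<close> stands in for dividing by the window length.\<close>

definition has_umean :: "(real \<Rightarrow> complex) \<Rightarrow> complex \<Rightarrow> bool" where
  "has_umean u c \<longleftrightarrow>
     (\<forall>\<epsilon>>0. \<exists>T0>0. \<forall>T\<ge>T0. \<forall>a. norm (integral {a..a + T} u - of_real T * c) \<le> \<epsilon> * T)"

lemma bohr_ap_continuous: "bohr_ap u \<Longrightarrow> continuous_on A u"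
  unfolding bohr_ap_def using continuous_on_subset by blast

lemma bohr_apE:
  assumes "bohr_ap u" "\<epsilon> > 0"
  obtains l where "l > 0" "\<And>a. \<exists>\<tau>\<in>{a..a + l}. almost_period u \<epsilon> \<tau>"
  using assms unfolding bohr_ap_def by blast

lemma almost_periodD: "almost_period u \<epsilon> \<tau> \<Longrightarrow> norm (u (t + \<tau>) - u t) \<le> \<epsilon>"
  unfolding almost_period_def by blast

text \<open>An almost period carries any \<open>t\<close> into the compact interval
  \<open>{0..l}\<close> at cost 1.\<close>

lemma bohr_ap_bounded:
  assumes "bohr_ap u"
  obtains M where "M > 0" "\<And>t. norm (u t) \<le> M"
proof -
  obtain l where l: "l > 0" "\<And>a. \<exists>\<tau>\<in>{a..a + l}. almost_period u 1 \<tau>"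
    using bohr_apE[OF assms, of 1] by auto
  have "bounded (u ` {0..l})"
    by (intro compact_imp_bounded compact_continuous_image bohr_ap_continuous assms compact_Icc)
  then obtain B where B: "\<And>t. t \<in> {0..l} \<Longrightarrow> norm (u t) \<le> B" and "B > 0"
    by (metis bounded_pos image_eqI)
  have "norm (u t) \<le> B + 1" for t
  proof -
    obtain \<tau> where \<tau>: "\<tau> \<in> {-t..-t + l}" "almost_period u 1 \<tau>" using l by blast
    have "norm (u (t + \<tau>)) \<le> B" using \<tau> by (intro B) auto
    moreover have "norm (u (t + \<tau>) - u t) \<le> 1" by (rule almost_periodD[OF \<tau>(2)])
    ultimately show ?thesis
      using norm_triangle_ineq3[of "u (t + \<tau>)" "u t"] by linarith
  qed
  with \<open>B > 0\<close> show ?thesis using that[of "B + 1"] by simp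
qed

lemma bohr_ap_uniformly_continuous:
  assumes "bohr_ap u" "\<epsilon> > 0"
  obtains d where "d > 0" "\<And>x y. \<bar>x - y\<bar> \<le> d \<Longrightarrow> norm (u x - u y) \<le> \<epsilon>"
proof -
  have e3: "\<epsilon> / 3 > 0" using assms by simp
  obtain l where l: "l > 0" "\<And>a. \<exists>\<tau>\<in>{a..a + l}. almost_period u (\<epsilon>/3) \<tau>"
    using bohr_apE[OF assms(1) e3] by blast
  \<comment> \<open>The almost period brings \<open>x\<close> into \<open>{0..l}\<close>; the margin
    of 1 on either side keeps \<open>y\<close> inside as well, whence the cap
    \<open>min 1 (d / 2)\<close>.\<close>
  have "uniformly_continuous_on {-1..l + 1} u"
    by (intro compact_uniformly_continuous bohr_ap_continuous assms compact_Icc)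
  then obtain d where d: "d > 0"
    "\<And>x y. x \<in> {-1..l+1} \<Longrightarrow> y \<in> {-1..l+1} \<Longrightarrow> dist y x < d \<Longrightarrow> dist (u y) (u x) < \<epsilon> / 3"
    using e3 unfolding uniformly_continuous_on_def by metis
  have "norm (u x - u y) \<le> \<epsilon>" if xy: "\<bar>x - y\<bar> \<le> min 1 (d / 2)" for x y
  proof -
    obtain \<tau> where \<tau>: "\<tau> \<in> {-x..-x + l}" "almost_period u (\<epsilon>/3) \<tau>" using l by blast
    have "dist (u (x + \<tau>)) (u (y + \<tau>)) < \<epsilon> / 3"
      using \<tau> xy \<open>d > 0\<close> by (intro d) (auto simp: dist_real_def)
    moreover have "norm (u (x + \<tau>) - u x) \<le> \<epsilon> / 3" "norm (u (y + \<tau>) - u y) \<le> \<epsilon> / 3"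
      by (rule almost_periodD[OF \<tau>(2)])+
    ultimately show ?thesis
      using norm_triangle_ineq[of "u (x + \<tau>) - u (y + \<tau>)" "(u x - u (x + \<tau>)) + (u (y + \<tau>) - u y)"]
        norm_triangle_ineq[of "u x - u (x + \<tau>)" "u (y + \<tau>) - u y"]
      by (simp add: dist_norm norm_minus_commute)
  qed
  with d(1) show ?thesis using that[of "min 1 (d/2)"] by simp
qed

section \<open>Closure properties of domination\<close>

lemma bohr_ap_dominated:
  assumes "bohr_ap F" "dominated F u" "continuous_on UNIV u"
  shows "bohr_ap u"
  unfolding bohr_ap_def
proof (intro conjI allI impI assms)
  fix \<epsilon> :: real assume "\<epsilon> > 0"
  then obtain \<delta> where \<delta>: "\<delta> > 0" "\<And>\<tau>. almost_period F \<delta> \<tau> \<Longrightarrow> almost_period u \<epsilon> \<tau>"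
    using assms(2) unfolding dominated_def by blast
  obtain l where "l > 0" "\<And>a. \<exists>\<tau>\<in>{a..a + l}. almost_period F \<delta> \<tau>"
    using bohr_apE[OF assms(1) \<delta>(1)] by blast
  then show "\<exists>l>0. \<forall>a. \<exists>\<tau>\<in>{a..a + l}. almost_period u \<epsilon> \<tau>" using \<delta>(2) by blast
qed

lemma dominated_refl: "dominated F F"
  unfolding dominated_def by blast

lemma almost_period_mono: "almost_period u \<epsilon> \<tau> \<Longrightarrow> \<epsilon> \<le> \<epsilon>' \<Longrightarrow> almost_period u \<epsilon>' \<tau>"
  unfolding almost_period_def using order_trans by blast

lemma dominated_add:
  assumes "dominated F u" "dominated F v"
  shows "dominated F (\<lambda>t. u t + v t)"
  unfolding dominated_def
proof (intro allI impI)
  fix \<epsilon> :: real assume "\<epsilon> > 0"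
  then have e: "\<epsilon>/2 > 0" by simp
  obtain d1 where d1: "d1 > 0" "\<And>\<tau>. almost_period F d1 \<tau> \<Longrightarrow> almost_period u (\<epsilon>/2) \<tau>"
    using assms(1) e unfolding dominated_def by blast
  obtain d2 where d2: "d2 > 0" "\<And>\<tau>. almost_period F d2 \<tau> \<Longrightarrow> almost_period v (\<epsilon>/2) \<tau>"
    using assms(2) e unfolding dominated_def by blast
  have "almost_period (\<lambda>t. u t + v t) \<epsilon> \<tau>" if "almost_period F (min d1 d2) \<tau>" for \<tau>
  proof -
    have uv: "almost_period u (\<epsilon>/2) \<tau>" "almost_period v (\<epsilon>/2) \<tau>"
      using d1(2) d2(2) almost_period_mono[OF that] by auto
    show ?thesis unfolding almost_period_def
    proof
      fix t
      show "norm (u (t + \<tau>) + v (t + \<tau>) - (u t + v t)) \<le> \<epsilon>"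
        using norm_triangle_ineq[of "u (t+\<tau>) - u t" "v (t+\<tau>) - v t"]
          almost_periodD[OF uv(1), of t] almost_periodD[OF uv(2), of t]
        by (simp add: algebra_simps)
    qed
  qed
  then show "\<exists>\<delta>>0. \<forall>\<tau>. almost_period F \<delta> \<tau> \<longrightarrow> almost_period (\<lambda>t. u t + v t) \<epsilon> \<tau>"
    using d1(1) d2(1) by (intro exI[of _ "min d1 d2"]) auto
qed

lemma dominated_cmult:
  assumes "dominated F u"
  shows "dominated F (\<lambda>t. c * u t)"
  unfolding dominated_def
proof (intro allI impI)
  fix \<epsilon> :: real assume "\<epsilon> > 0"
  then have "\<epsilon> / (norm c + 1) > 0" by (simp add: add_nonneg_pos)
  then obtain \<delta> where \<delta>: "\<delta> > 0" "\<And>\<tau>. almost_period F \<delta> \<tau> \<Longrightarrow> almost_period u (\<epsilon> / (norm c + 1)) \<tau>"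
    using assms unfolding dominated_def by blast
  have "almost_period (\<lambda>t. c * u t) \<epsilon> \<tau>" if "almost_period F \<delta> \<tau>" for \<tau>
    unfolding almost_period_def
  proof
    fix t
    have "norm (c * u (t + \<tau>) - c * u t) = norm c * norm (u (t + \<tau>) - u t)"
      by (simp add: norm_mult flip: right_diff_distrib)
    also have "\<dots> \<le> (norm c + 1) * (\<epsilon> / (norm c + 1))"
      using almost_periodD[OF \<delta>(2)[OF that], of t] by (intro mult_mono) auto
    also have "\<dots> = \<epsilon>" by (simp add: add_nonneg_eq_0_iff)
    finally show "norm (c * u (t + \<tau>) - c * u t) \<le> \<epsilon>" .
  qed
  then show "\<exists>\<delta>>0. \<forall>\<tau>. almost_period F \<delta> \<tau> \<longrightarrow> almost_period (\<lambda>t. c * u t) \<epsilon> \<tau>"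
    using \<delta>(1) by blast
qed

lemma dominated_sum:
  assumes "\<And>j. j \<in> J \<Longrightarrow> dominated F (u j)"
  shows "dominated F (\<lambda>t. \<Sum>j\<in>J. u j t)"
proof (cases "finite J")
  case True
  then show ?thesis using assms
  proof (induction J)
    case empty
    show ?case by (auto simp: dominated_def almost_period_def intro: exI[of _ 1])
  next
    case (insert j J)
    then show ?case by (simp add: dominated_add)
  qed
qed (auto simp: dominated_def almost_period_def intro: exI[of _ 1])

lemma dominated_uniform_limit:
  assumes "\<And>\<epsilon>. \<epsilon> > 0 \<Longrightarrow> \<exists>v. dominated F v \<and> (\<forall>t. norm (u t - v t) \<le> \<epsilon>)"
  shows "dominated F u"
  unfolding dominated_def
proof (intro allI impI)
  fix \<epsilon> :: real assume "\<epsilon> > 0"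
  then have e3: "\<epsilon>/3 > 0" by simp
  obtain v where v: "dominated F v" "\<And>t. norm (u t - v t) \<le> \<epsilon>/3" using assms[OF e3] by blast
  obtain \<delta> where \<delta>: "\<delta> > 0" "\<And>\<tau>. almost_period F \<delta> \<tau> \<Longrightarrow> almost_period v (\<epsilon>/3) \<tau>"
    using v(1) e3 unfolding dominated_def by blast
  have "almost_period u \<epsilon> \<tau>" if "almost_period F \<delta> \<tau>" for \<tau>
    unfolding almost_period_def
  proof
    fix t
    show "norm (u (t + \<tau>) - u t) \<le> \<epsilon>"
      using almost_periodD[OF \<delta>(2)[OF that], of t] v(2)[of t] v(2)[of "t + \<tau>"]
        norm_triangle_ineq[of "u (t + \<tau>) - v (t + \<tau>)" "(v t - u t) + (v (t + \<tau>) - v t)"]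
        norm_triangle_ineq[of "v t - u t" "v (t + \<tau>) - v t"]
      by (simp add: norm_minus_commute)
  qed
  then show "\<exists>\<delta>>0. \<forall>\<tau>. almost_period F \<delta> \<tau> \<longrightarrow> almost_period u \<epsilon> \<tau>" using \<delta>(1) by blast
qed

lemma dominated_mult:
  assumes "dominated F u" "dominated F v" and "\<And>t. norm (u t) \<le> M" "\<And>t. norm (v t) \<le> M"
  shows "dominated F (\<lambda>t. u t * v t)"
  unfolding dominated_def
proof (intro allI impI)
  fix \<epsilon> :: real assume "\<epsilon> > 0"
  have M0: "M \<ge> 0" using assms(3)[of 0] norm_ge_zero order_trans by blast
  define e where "e = \<epsilon> / (2 * (M + 1))"
  have e: "e > 0" using \<open>\<epsilon> > 0\<close> M0 by (simp add: e_def)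
  obtain d1 where d1: "d1 > 0" "\<And>\<tau>. almost_period F d1 \<tau> \<Longrightarrow> almost_period u e \<tau>"
    using assms(1) e unfolding dominated_def by blast
  obtain d2 where d2: "d2 > 0" "\<And>\<tau>. almost_period F d2 \<tau> \<Longrightarrow> almost_period v e \<tau>"
    using assms(2) e unfolding dominated_def by blast
  have "almost_period (\<lambda>t. u t * v t) \<epsilon> \<tau>" if "almost_period F (min d1 d2) \<tau>" for \<tau>
  proof -
    have uv: "almost_period u e \<tau>" "almost_period v e \<tau>"
      using d1(2) d2(2) almost_period_mono[OF that] by auto
    show ?thesis unfolding almost_period_def
    proof
      fix t
      have "u (t + \<tau>) * v (t + \<tau>) - u t * v t =
          (u (t + \<tau>) - u t) * v (t + \<tau>) + u t * (v (t + \<tau>) - v t)" by (simp add: algebra_simps)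
      also have "norm \<dots> \<le> norm (u (t + \<tau>) - u t) * norm (v (t + \<tau>)) + norm (u t) * norm (v (t + \<tau>) - v t)"
        by (metis norm_triangle_ineq norm_mult)
      also have "\<dots> \<le> e * M + M * e"
        using almost_periodD[OF uv(1), of t] almost_periodD[OF uv(2), of t] assms(3,4) M0 e
        by (intro add_mono mult_mono) auto
      also have "\<dots> \<le> e * (2 * (M + 1))" using e by (simp add: algebra_simps)
      also have "\<dots> = \<epsilon>" using M0 unfolding e_def by simp
      finally show "norm (u (t + \<tau>) * v (t + \<tau>) - u t * v t) \<le> \<epsilon>" .
    qed
  qed
  then show "\<exists>\<delta>>0. \<forall>\<tau>. almost_period F \<delta> \<tau> \<longrightarrow> almost_period (\<lambda>t. u t * v t) \<epsilon> \<tau>"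
    using d1(1) d2(1) by (intro exI[of _ "min d1 d2"]) auto
qed

section \<open>Integrals over long windows and existence of the mean\<close>

lemma norm_integral_le:
  fixes u :: "real \<Rightarrow> complex"
  assumes "continuous_on UNIV u" "\<And>t. norm (u t) \<le> M" "T \<ge> 0"
  shows "norm (integral {a..a + T} u) \<le> M * T"
  using integral_bound[of a "a + T" u M] assms continuous_on_subset[OF assms(1)] by auto

lemma integrable_on_Icc_continuous: "continuous_on UNIV (u :: real \<Rightarrow> complex) \<Longrightarrow> u integrable_on {a..b}"
  by (meson continuous_on_subset integrable_continuous_real subset_UNIV)

lemma integral_translate:
  fixes u :: "real \<Rightarrow> complex"
  shows "integral {a + c..a + c + T} u = integral {a..a + T} (\<lambda>t. u (t + c))"
  using integral_shift_real_ivl[of "a + c" c "a + c + T" u] by simp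

text \<open>Only two end pieces of length \<open>\<bar>a' - a\<bar>\<close> survive. Splitting the
  integral over the hull of both windows in two ways treats disjoint windows along with overlapping
  ones.\<close>

lemma integral_window_move:
  fixes u :: "real \<Rightarrow> complex"
  assumes c: "continuous_on UNIV u" "\<And>t. norm (u t) \<le> M" "T \<ge> 0"
  shows "norm (integral {a'..a' + T} u - integral {a..a + T} u) \<le> 2 * M * \<bar>a' - a\<bar>"
proof -
  have *: "norm (integral {b..b + T} u - integral {a..a + T} u) \<le> 2 * M * (b - a)" if "a \<le> b" for a b
  proof -
    have "integral {a..b} u + integral {b..b + T} u = integral {a..b + T} u"
      by (rule Henstock_Kurzweil_Integration.integral_combine) (use that c in \<open>auto intro: integrable_on_Icc_continuous\<close>)
    moreover have "integral {a..a + T} u + integral {a + T..b + T} u = integral {a..b + T} u"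
      by (rule Henstock_Kurzweil_Integration.integral_combine) (use that c in \<open>auto intro: integrable_on_Icc_continuous\<close>)
    ultimately have "integral {b..b + T} u - integral {a..a + T} u =
        integral {a + T..(a + T) + (b - a)} u - integral {a..a + (b - a)} u"
      by (simp add: algebra_simps)
    also have "norm \<dots> \<le> M * (b - a) + M * (b - a)"
      using that by (intro order_trans[OF norm_triangle_ineq4] add_mono norm_integral_le[OF c(1,2)]) auto
    finally show ?thesis by simp
  qed
  show ?thesis
  proof (cases "a \<le> a'")
    case True then show ?thesis using *[of a a'] by simp
  next
    case False then show ?thesis using *[of a' a] by (simp add: norm_minus_commute)
  qed
qed

lemma norm_integral_diff_le:
  fixes u v :: "real \<Rightarrow> complex"
  assumes "continuous_on UNIV u" "continuous_on UNIV v" "\<And>t. t \<in> {a..a + T} \<Longrightarrow> norm (u t - v t) \<le> M" "T \<ge> 0"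
  shows "norm (integral {a..a + T} u - integral {a..a + T} v) \<le> M * T"
proof -
  have "integral {a..a + T} u - integral {a..a + T} v = integral {a..a + T} (\<lambda>t. u t - v t)"
    by (intro Henstock_Kurzweil_Integration.integral_diff[symmetric] integrable_on_Icc_continuous assms)
  also have "norm \<dots> \<le> M * (a + T - a)"
    using assms by (intro integral_bound continuous_intros) (auto intro: continuous_on_subset)
  finally show ?thesis by simp
qed

text \<open>Go from 0 to an almost period within \<open>l\<close> of \<open>a\<close>, which costs
  \<open>\<epsilon> * T\<close>; the short remaining way costs at most \<open>2 * M * l\<close>,
  whatever \<open>a\<close> and \<open>T\<close> are.\<close>

lemma bohr_ap_window:
  assumes "bohr_ap u" "\<epsilon> > 0"
  obtains C where "C > 0"
    "\<And>a T. T \<ge> 0 \<Longrightarrow> norm (integral {a..a + T} u - integral {0..T} u) \<le> \<epsilon> * T + C"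
proof -
  obtain M where M: "M > 0" "\<And>t. norm (u t) \<le> M" using bohr_ap_bounded[OF assms(1)] by blast
  obtain l where l: "l > 0" "\<And>a. \<exists>\<tau>\<in>{a..a + l}. almost_period u \<epsilon> \<tau>"
    using bohr_apE[OF assms] by blast
  have cu: "continuous_on UNIV u" using assms(1) by (rule bohr_ap_continuous)
  have "norm (integral {a..a + T} u - integral {0..T} u) \<le> \<epsilon> * T + 2 * M * l" if T: "T \<ge> 0" for a T
  proof -
    obtain \<tau> where \<tau>: "\<tau> \<in> {a..a + l}" "almost_period u \<epsilon> \<tau>" using l by blast
    have "integral {\<tau>..\<tau> + T} u = integral {0..0 + T} (\<lambda>t. u (t + \<tau>))"
      using integral_translate[of 0 \<tau> T u] by simp
    then have 1: "norm (integral {\<tau>..\<tau> + T} u - integral {0..0 + T} u) \<le> \<epsilon> * T"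
      using almost_periodD[OF \<tau>(2)] T
      by (simp only:) (intro norm_integral_diff_le cu continuous_on_compose2[OF cu] continuous_intros; simp)
    have "norm (integral {a..a + T} u - integral {\<tau>..\<tau> + T} u) \<le> 2 * M * \<bar>a - \<tau>\<bar>"
      by (rule integral_window_move[OF cu M(2) T])
    also have "\<dots> \<le> 2 * M * l" using \<tau> M by (intro mult_left_mono) auto
    finally show ?thesis using 1 norm_triangle_ineq[of "integral {a..a + T} u - integral {\<tau>..\<tau> + T} u" "integral {\<tau>..\<tau> + T} u - integral {0..T} u"]
      by simp
  qed
  then show ?thesis using that[of "2 * M * l"] M l by simp
qed

lemma bohr_ap_has_umean:
  assumes "bohr_ap u"
  shows "\<exists>c. has_umean u c"
proof -
  have cu: "continuous_on UNIV u" using assms(1) by (rule bohr_ap_continuous)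
  define I where "I = (\<lambda>a T. integral {a..a + T} u)"
  define m where "m = (\<lambda>T. I 0 T / of_real T)"
  \<comment> \<open>Integrate the window estimate over all starting points in \<open>[0, S]\<close> and exchange the integrals.\<close>
  have cauchy: "norm (m T - m S) \<le> 2 * \<epsilon> + C / T + C / S"
    if C: "\<And>a T. T \<ge> 0 \<Longrightarrow> norm (I a T - I 0 T) \<le> \<epsilon> * T + C" and "T > 0" "S > 0" for \<epsilon> C T S
  proof -
    have D: "norm (integral {0..0 + S} (\<lambda>a. I a T) - of_real S * I 0 T) \<le> (\<epsilon> * T + C) * S"
      if "T > 0" "S > 0" for S T
    proof -
      have M: "continuous_on UNIV (\<lambda>a. I a T)"
      proof -
        obtain M where M: "M > 0" "\<And>t. norm (u t) \<le> M" using bohr_ap_bounded[OF assms(1)] by blast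
        have "dist (I a' T) (I a T) \<le> 2 * M * dist a' a" for a a'
          using integral_window_move[OF cu M(2), of T a' a] that by (simp add: I_def dist_norm)
        then have "(2*M)-lipschitz_on UNIV (\<lambda>a. I a T)" using M by (intro lipschitz_onI) auto
        then show ?thesis by (rule lipschitz_on_continuous_on)
      qed
      have "norm (integral {0..0 + S} (\<lambda>a. I a T) - integral {0..0 + S} (\<lambda>a. I 0 T)) \<le> (\<epsilon> * T + C) * S"
        using C that by (intro norm_integral_diff_le M continuous_intros) auto
      then show ?thesis using that by (simp add: scaleR_conv_of_real)
    qed
    have I': "I a T = integral {0..0 + T} (\<lambda>b. u (a + b))" for a T
      using integral_translate[of 0 a T u] by (simp add: I_def add.commute)
    have "integral (cbox 0 S) (\<lambda>a. integral (cbox 0 T) (\<lambda>b. u (a + b))) =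
          integral (cbox 0 T) (\<lambda>b. integral (cbox 0 S) (\<lambda>a. u (a + b)))"
      unfolding case_prod_beta
      by (intro integral_swap_continuous) (auto simp: case_prod_beta intro!: continuous_on_compose2[OF cu] continuous_intros)
    then have sw: "integral {0..0 + S} (\<lambda>a. I a T) = integral {0..0 + T} (\<lambda>b. I b S)"
      by (simp add: I' add.commute)
    \<comment> \<open>The double integral is close to \<open>S * I 0 T\<close> and, by symmetry, to
      \<open>T * I 0 S\<close>; dividing by \<open>S * T\<close> then compares the two
      means.\<close>
    have "norm (of_real S * I 0 T - of_real T * I 0 S) \<le> (\<epsilon> * T + C) * S + (\<epsilon> * S + C) * T"
      using D[of T S] D[of S T] that sw
        norm_triangle_ineq[of "integral {0..0 + T} (\<lambda>a. I a S) - of_real T * I 0 S" "- (integral {0..0 + S} (\<lambda>a. I a T) - of_real S * I 0 T)"]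
      by (simp add: norm_minus_commute)
    then have "norm (of_real S * I 0 T - of_real T * I 0 S) / (S * T) \<le> ((\<epsilon> * T + C) * S + (\<epsilon> * S + C) * T) / (S * T)"
      using that by (intro divide_right_mono) auto
    moreover have "norm (of_real S * I 0 T - of_real T * I 0 S) / (S * T) = norm (m T - m S)"
    proof -
      have "m T - m S = (of_real S * I 0 T - of_real T * I 0 S) / of_real (S * T)"
        using that by (simp add: m_def field_simps)
      then show ?thesis using that by (simp only: norm_divide norm_of_real) simp
    qed
    moreover have "((\<epsilon> * T + C) * S + (\<epsilon> * S + C) * T) / (S * T) = 2 * \<epsilon> + C / T + C / S"
      using that by (simp add: field_simps)
    ultimately show ?thesis by simp
  qed
  have win: "\<exists>C>0. \<forall>a T. T \<ge> 0 \<longrightarrow> norm (I a T - I 0 T) \<le> \<epsilon> * T + C" if "\<epsilon> > 0" for \<epsilon>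
    using bohr_ap_window[OF assms that] unfolding I_def by (metis add_0)
  have "Cauchy (\<lambda>n. m (real (Suc n)))"
  proof (rule CauchyI)
    fix e :: real assume "e > 0"
    then have e8: "e / 8 > 0" by simp
    obtain C where C: "C > 0" "\<And>a T. T \<ge> 0 \<Longrightarrow> norm (I a T - I 0 T) \<le> e / 8 * T + C"
      using win[OF e8] by blast
    obtain N :: nat where N: "real N > 8 * C / e" using reals_Archimedean2 by blast
    have b: "C / real (Suc n) < e / 8" if "n \<ge> N" for n
    proof -
      have "8 * C / e < real (Suc n)" using N that by linarith
      then show ?thesis using \<open>e > 0\<close> by (simp add: field_simps)
    qed
    show "\<exists>M. \<forall>k\<ge>M. \<forall>n\<ge>M. norm (m (real (Suc k)) - m (real (Suc n))) < e"
    proof (intro exI allI impI)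
      fix k n assume "N \<le> k" "N \<le> n"
      have "norm (m (real (Suc k)) - m (real (Suc n))) \<le> 2 * (e/8) + C / real (Suc k) + C / real (Suc n)"
        by (rule cauchy) (use C in auto)
      then show "norm (m (real (Suc k)) - m (real (Suc n))) < e"
        using b[OF \<open>N \<le> k\<close>] b[OF \<open>N \<le> n\<close>] \<open>e > 0\<close> by linarith
    qed
  qed
  then obtain c where c: "(\<lambda>n. m (real (Suc n))) \<longlonglongrightarrow> c"
    using Cauchy_convergent convergent_def by blast
  have "has_umean u c" unfolding has_umean_def
  proof (intro allI impI)
    fix \<epsilon> :: real assume "\<epsilon> > 0"
    then have e: "\<epsilon> / 8 > 0" by simp
    obtain C where C: "C > 0" "\<And>a T. T \<ge> 0 \<Longrightarrow> norm (I a T - I 0 T) \<le> \<epsilon> / 8 * T + C"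
      using win[OF e] by blast
    \<comment> \<open>Sending the second length to infinity through the integers turns the Cauchy
      estimate into a rate for every real \<open>T\<close>.\<close>
    have lim: "norm (m T - c) \<le> 2 * (\<epsilon> / 8) + C / T + 0" if "T > 0" for T
    proof (rule LIMSEQ_le)
      show "(\<lambda>n. norm (m T - m (real (Suc n)))) \<longlonglongrightarrow> norm (m T - c)"
        by (intro tendsto_intros c)
      have "(\<lambda>n. C / real (Suc n)) \<longlonglongrightarrow> 0"
        by (intro LIMSEQ_Suc lim_const_over_n)
      then show "(\<lambda>n. 2 * (\<epsilon> / 8) + C / T + C / real (Suc n)) \<longlonglongrightarrow> 2 * (\<epsilon> / 8) + C / T + 0"
        by (intro tendsto_intros)
      show "\<exists>N. \<forall>n\<ge>N. norm (m T - m (real (Suc n))) \<le> 2 * (\<epsilon> / 8) + C / T + C / real (Suc n)"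
        using cauchy[OF C(2), of T] that by simp
    qed
    show "\<exists>T0>0. \<forall>T\<ge>T0. \<forall>a. norm (integral {a..a + T} u - of_real T * c) \<le> \<epsilon> * T"
    proof (intro exI conjI allI impI)
      show "8 * C / \<epsilon> > 0" using C \<open>\<epsilon> > 0\<close> by simp
      fix T a assume T: "8 * C / \<epsilon> \<le> T"
      have "T > 0" using T \<open>8 * C / \<epsilon> > 0\<close> by linarith
      have "C \<le> \<epsilon> / 8 * T" using T \<open>\<epsilon> > 0\<close> by (simp add: field_simps)
      have "norm (I 0 T - of_real T * c) = T * norm (m T - c)"
      proof -
        have "I 0 T - of_real T * c = of_real T * (m T - c)" using \<open>T > 0\<close> by (simp add: m_def algebra_simps)
        then show ?thesis using \<open>T > 0\<close> by (simp add: norm_mult)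
      qed
      also have "\<dots> \<le> T * (2 * (\<epsilon> / 8) + C / T + 0)"
        using lim \<open>T > 0\<close> by (intro mult_left_mono) auto
      also have "\<dots> = 2 * (\<epsilon> / 8) * T + C" using \<open>T > 0\<close> by (simp add: field_simps)
      finally have "norm (I 0 T - of_real T * c) \<le> 2 * (\<epsilon> / 8) * T + C" .
      moreover have "norm (I a T - I 0 T) \<le> \<epsilon> / 8 * T + C" using C(2) \<open>T > 0\<close> by simp
      ultimately have "norm (I a T - of_real T * c) \<le> 3 * (\<epsilon> / 8) * T + 2 * C"
        using norm_triangle_ineq[of "I a T - I 0 T" "I 0 T - of_real T * c"] by simp
      also have "\<dots> \<le> 3 * (\<epsilon> / 8) * T + 2 * (\<epsilon> / 8 * T)" using \<open>C \<le> \<epsilon> / 8 * T\<close>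
        by (intro add_left_mono mult_left_mono) auto
      also have "\<dots> \<le> \<epsilon> * T" using \<open>T > 0\<close> \<open>\<epsilon> > 0\<close> by (simp add: field_simps)
      finally show "norm (integral {a..a + T} u - of_real T * c) \<le> \<epsilon> * T" by (simp add: I_def)
    qed
  qed
  then show ?thesis by blast
qed

section \<open>The uniqueness theorem\<close>

lemma dft_orthogonality:
  fixes w :: complex
  assumes w: "norm w = 1" "w ^ N = 1" "\<And>j. 0 < j \<Longrightarrow> j < N \<Longrightarrow> w ^ j \<noteq> 1"
    and "n < N" "n' < N"
  shows "(\<Sum>k<N. w ^ (k * n) * cnj (w ^ (k * n'))) = (if n = n' then of_nat N else 0)"
proof -
  have wc: "w * cnj w = 1" using w(1) by (simp add: complex_norm_square[symmetric])
  \<comment> \<open>The geometric ratio \<open>w ^ (n - n')\<close> uses natural subtraction, so the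
    order is fixed here; the opposite order follows by conjugating the sum.\<close>
  have *: "(\<Sum>k<N. w ^ (k * n) * cnj (w ^ (k * n'))) = (if n = n' then of_nat N else 0)"
    if "n' \<le> n" "n < N" "n' < N" for n n'
  proof -
    have "w ^ (k * n) * cnj (w ^ (k * n')) = (w ^ (n - n')) ^ k" for k
    proof -
      have "w ^ (k * n) = w ^ (k * (n - n')) * w ^ (k * n')"
        using that by (simp flip: power_add distrib_left)
      then have "w ^ (k * n) * cnj (w ^ (k * n')) = w ^ (k * (n - n')) * (w * cnj w) ^ (k * n')"
        by (simp add: power_mult_distrib)
      then show ?thesis by (simp add: wc mult.commute flip: power_mult)
    qed
    then have S: "(\<Sum>k<N. w ^ (k * n) * cnj (w ^ (k * n'))) = (\<Sum>k<N. (w ^ (n - n')) ^ k)" by simp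
    show ?thesis
    proof (cases "n = n'")
      case False
      then have "w ^ (n - n') \<noteq> 1" using that by (intro w(3)) auto
      moreover have "(w ^ (n - n')) ^ N = 1" by (metis power_mult mult.commute w(2) power_one)
      ultimately show ?thesis using False unfolding S by (simp add: sum_gp_strict)
    next
      case True
      show ?thesis unfolding S using True by simp
    qed
  qed
  show ?thesis
  proof (cases "n' \<le> n")
    case True then show ?thesis using * assms by blast
  next
    case False
    have "(\<Sum>k<N. w ^ (k * n) * cnj (w ^ (k * n'))) = cnj (\<Sum>k<N. w ^ (k * n') * cnj (w ^ (k * n)))"
      by (simp add: mult.commute)
    also have "\<dots> = 0" using False assms by (subst *) auto
    finally show ?thesis using False by simp
  qed
qed

lemma dft_parseval:
  fixes w :: complex and x :: "nat \<Rightarrow> complex"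
  assumes w: "norm w = 1" "w ^ N = 1" "\<And>j. 0 < j \<Longrightarrow> j < N \<Longrightarrow> w ^ j \<noteq> 1"
  shows "(\<Sum>k<N. (norm (\<Sum>n<N. x n * w ^ (k * n)))\<^sup>2) = real N * (\<Sum>n<N. (norm (x n))\<^sup>2)"
proof -
  have "complex_of_real (\<Sum>k<N. (norm (\<Sum>n<N. x n * w ^ (k * n)))\<^sup>2)
      = (\<Sum>k<N. (\<Sum>n<N. x n * w ^ (k * n)) * cnj (\<Sum>n'<N. x n' * w ^ (k * n')))"
    by (simp only: of_real_sum complex_norm_square)
  also have "\<dots> = (\<Sum>k<N. \<Sum>n<N. \<Sum>n'<N. x n * cnj (x n') * (w ^ (k * n) * cnj (w ^ (k * n'))))"
    by (simp add: sum_product mult_ac)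
  also have "\<dots> = (\<Sum>n<N. \<Sum>k<N. \<Sum>n'<N. x n * cnj (x n') * (w ^ (k * n) * cnj (w ^ (k * n'))))"
    by (rule sum.swap)
  also have "\<dots> = (\<Sum>n<N. \<Sum>n'<N. x n * cnj (x n') * (\<Sum>k<N. w ^ (k * n) * cnj (w ^ (k * n'))))"
    by (intro sum.cong refl trans[OF sum.swap]) (simp add: sum_distrib_left)
  also have "\<dots> = (\<Sum>n<N. \<Sum>n'<N. x n * cnj (x n') * (if n = n' then of_nat N else 0))"
    using dft_orthogonality[OF w] by (intro sum.cong refl) simp
  also have "\<dots> = (\<Sum>n<N. of_nat N * (x n * cnj (x n)))"
    by (intro sum.cong refl) (simp add: if_distrib sum.delta mult.commute cong: if_cong)
  also have "\<dots> = complex_of_real (real N * (\<Sum>n<N. (norm (x n))\<^sup>2))"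
    by (simp only: complex_norm_square[symmetric] of_real_sum of_real_mult sum_distrib_left of_real_of_nat_eq)
  finally show ?thesis by (simp only: of_real_eq_iff)
qed

lemma bij_betw_add_mod:
  fixes m N :: nat
  shows "bij_betw (\<lambda>n. (n + m) mod N) {..<N} {..<N}"
proof -
  have "inj_on (\<lambda>n. (n + m) mod N) {..<N}"
  proof (rule inj_onI)
    fix a b assume ab: "a \<in> {..<N}" "b \<in> {..<N}" "(a + m) mod N = (b + m) mod N"
    then have "(int a + int m) mod int N = (int b + int m) mod int N" by (metis of_nat_add of_nat_mod)
    then have "int N dvd (int a + int m) - (int b + int m)" by (rule mod_eq_dvd_iff[THEN iffD1])
    then have "int N dvd int a - int b" by simp
    then have "int a mod int N = int b mod int N" by (rule mod_eq_dvd_iff[THEN iffD2])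
    then show "a = b" using ab by simp
  qed
  moreover have "(\<lambda>n. (n + m) mod N) ` {..<N} \<subseteq> {..<N}" by auto
  ultimately show ?thesis by (simp add: bij_betw_def endo_inj_surj)
qed

text \<open>Averaging \<open>x\<close> over its almost periods \<open>A\<close> almost reproduces \<open>x\<close>; by Parseval the averaged sequence
  has energy at most \<open>B\<^sup>2 * N * card A\<close>, where \<open>B\<close> is the largest Fourier coefficient of \<open>x\<close>.\<close>
lemma large_dft_coefficient:
  fixes x :: "nat \<Rightarrow> complex"
  assumes A: "A \<subseteq> {..<M}" "A \<noteq> {}" and M: "2 * M \<le> N" and e: "e > 0"
    and ap: "\<And>m n. m \<in> A \<Longrightarrow> norm (x (n + m) - x n) \<le> e" and x0: "norm (x 0) \<ge> 3 * e"
    and w: "norm w = 1" "w ^ N = 1" "\<And>j. 0 < j \<Longrightarrow> j < N \<Longrightarrow> w ^ j \<noteq> 1"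
  shows "\<exists>k<N. norm (\<Sum>n<N. x n * w ^ (k * n)) \<ge> e * real (card A)"
proof -
  have finA: "finite A" using A(1) finite_subset by blast
  have cA: "card A > 0" using finA A(2) by (simp add: card_gt_0_iff)
  have N: "N > 0" using A M by (cases M) auto
  define X where "X = (\<lambda>k. \<Sum>n<N. x n * w ^ (k * n))"
  define y where "y = (\<lambda>n. \<Sum>m\<in>A. x ((n + m) mod N))"
  define K where "K = (\<lambda>k. \<Sum>n<N. (if n \<in> A then 1 else 0 :: complex) * w ^ (k * n))"
  have wmod: "w ^ (k * (n mod N)) = w ^ (k * n)" for k n
  proof -
    have "w ^ n = w ^ (n mod N + N * (n div N))" by simp
    also have "\<dots> = w ^ (n mod N)" unfolding power_add power_mult by (simp add: w(2))
    finally show ?thesis by (metis power_mult mult.commute)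
  qed
  have wc: "w * cnj w = 1" using w(1) by (simp add: complex_norm_square[symmetric])
  have wck: "w ^ j * cnj (w ^ j) = 1" for j
    by (simp flip: power_mult_distrib add: wc)
  have KA: "K k = (\<Sum>m\<in>A. w ^ (k * m))" for k
  proof -
    have "A \<subseteq> {..<N}" using A(1) M by auto
    then show ?thesis unfolding K_def
      by (intro sum.mono_neutral_cong_right) auto
  qed
  \<comment> \<open>Summing over the shifts in \<open>A\<close> is a cyclic correlation, so the
    transform of \<open>y\<close> is that of \<open>x\<close> times the conjugated transform of the
    indicator of \<open>A\<close>.\<close>
  have Y: "(\<Sum>n<N. y n * w ^ (k * n)) = cnj (K k) * X k" for k
  proof -
    have one: "(\<Sum>n<N. x ((n + m) mod N) * w ^ (k * n)) = cnj (w ^ (k * m)) * X k" for m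
    proof -
      have "x ((n + m) mod N) * w ^ (k * n) = cnj (w ^ (k * m)) * (x ((n + m) mod N) * w ^ (k * ((n + m) mod N)))" for n
      proof -
        have "w ^ (k * n) = w ^ (k * n) * (w ^ (k * m) * cnj (w ^ (k * m)))" by (simp only: wck mult_1_right)
        also have "\<dots> = w ^ (k * (n + m)) * cnj (w ^ (k * m))" by (simp add: power_add distrib_left)
        finally have "w ^ (k * n) = w ^ (k * ((n + m) mod N)) * cnj (w ^ (k * m))" by (simp only: wmod)
        then show ?thesis by (simp only: mult_ac)
      qed
      then have "(\<Sum>n<N. x ((n + m) mod N) * w ^ (k * n)) =
          cnj (w ^ (k * m)) * (\<Sum>n<N. x ((n + m) mod N) * w ^ (k * ((n + m) mod N)))"
        by (simp only: sum_distrib_left)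
      also have "(\<Sum>n<N. x ((n + m) mod N) * w ^ (k * ((n + m) mod N))) = X k"
        unfolding X_def by (rule sum.reindex_bij_betw[OF bij_betw_add_mod])
      finally show ?thesis .
    qed
    have "(\<Sum>n<N. y n * w ^ (k * n)) = (\<Sum>m\<in>A. \<Sum>n<N. x ((n + m) mod N) * w ^ (k * n))"
      unfolding y_def sum_distrib_right by (rule sum.swap)
    then show ?thesis by (simp add: one KA sum_distrib_right)
  qed
  define B where "B = Max ((\<lambda>k. norm (X k)) ` {..<N})"
  have B: "norm (X k) \<le> B" if "k < N" for k unfolding B_def using that by (intro Max_ge) auto
  have "B \<in> (\<lambda>k. norm (X k)) ` {..<N}" unfolding B_def using N by (intro Max_in) auto
  then obtain k0 where k0: "k0 < N" "norm (X k0) = B" by auto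
  \<comment> \<open>For \<open>n\<close> and \<open>m\<close> in \<open>A\<close> the bound
    \<open>2 * M \<le> N\<close> prevents wrap-around. Since \<open>n\<close> is itself an almost
    period, \<open>x n\<close> keeps norm at least \<open>2 * e\<close>, and summing over the shifts
    loses at most \<open>e\<close> for each of them.\<close>
  have ylow: "e * real (card A) \<le> norm (y n)" if "n \<in> A" for n
  proof -
    have "norm (x n) \<ge> 2 * e"
      using ap[OF that, of 0] x0 norm_triangle_ineq3[of "x n" "x 0"] by simp
    have eq: "of_nat (card A) * x n = y n - (\<Sum>m\<in>A. x ((n + m) mod N) - x n)"
      by (simp add: y_def sum_subtractf)
    have sm: "norm (\<Sum>m\<in>A. x ((n + m) mod N) - x n) \<le> (\<Sum>m\<in>A. e)"
    proof (rule sum_norm_le)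
      fix m assume "m \<in> A"
      then have "m < M" "n < M" using A(1) that by auto
      then have "n + m < N" using M by simp
      then show "norm (x ((n + m) mod N) - x n) \<le> e" using ap[OF \<open>m \<in> A\<close>, of n] by simp
    qed
    have "real (card A) * norm (x n) = norm (y n - (\<Sum>m\<in>A. x ((n + m) mod N) - x n))"
      unfolding eq[symmetric] by (simp add: norm_mult)
    also have "\<dots> \<le> norm (y n) + real (card A) * e"
      using sm by (intro order_trans[OF norm_triangle_ineq4] add_left_mono) simp
    finally have "real (card A) * norm (x n) \<le> norm (y n) + real (card A) * e" .
    moreover have "real (card A) * (2 * e) \<le> real (card A) * norm (x n)"
      using \<open>norm (x n) \<ge> 2 * e\<close> by (intro mult_left_mono) auto
    ultimately show ?thesis by (simp add: algebra_simps)
  qed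
  have AN: "A \<subseteq> {..<N}" using A(1) M by auto
  have P: "(\<Sum>k<N. (norm (K k))\<^sup>2) = real N * (\<Sum>n<N. (norm (if n \<in> A then 1 else 0 :: complex))\<^sup>2)"
    unfolding K_def by (rule dft_parseval[OF w])
  \<comment> \<open>The energy of \<open>y\<close> from two sides: from below by its values on
    \<open>A\<close> alone, from above by Parseval with every \<open>X k\<close> replaced by
    \<open>B\<close>. The energy of \<open>K\<close> is \<open>N * card A\<close>, so the common
    factors cancel.\<close>
  have "real N * (real (card A) * (e * real (card A))\<^sup>2) = real N * (\<Sum>n\<in>A. (e * real (card A))\<^sup>2)" by simp
  also have "\<dots> \<le> real N * (\<Sum>n\<in>A. (norm (y n))\<^sup>2)"
    using ylow e by (intro mult_left_mono sum_mono power_mono) auto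
  also have "\<dots> \<le> real N * (\<Sum>n<N. (norm (y n))\<^sup>2)"
    using AN by (intro mult_left_mono sum_mono2) auto
  also have "\<dots> = (\<Sum>k<N. (norm (\<Sum>n<N. y n * w ^ (k * n)))\<^sup>2)"
    by (rule dft_parseval[OF w, symmetric])
  also have "\<dots> = (\<Sum>k<N. (norm (X k))\<^sup>2 * (norm (K k))\<^sup>2)"
    by (simp add: Y norm_mult power_mult_distrib mult.commute)
  also have "\<dots> \<le> (\<Sum>k<N. B\<^sup>2 * (norm (K k))\<^sup>2)"
    using B by (intro sum_mono mult_right_mono power_mono) auto
  also have "\<dots> = B\<^sup>2 * (real N * (\<Sum>n<N. (norm (if n \<in> A then 1 else 0 :: complex))\<^sup>2))"
    by (simp only: P sum_distrib_left[symmetric])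
  also have "(\<Sum>n<N. (norm (if n \<in> A then 1 else 0 :: complex))\<^sup>2) = (\<Sum>n\<in>A. 1)"
    by (intro sum.mono_neutral_cong_right) (use AN in auto)
  finally have "real N * (real (card A) * (e * real (card A))\<^sup>2) \<le> real N * (real (card A) * B\<^sup>2)"
    by (simp add: mult_ac)
  then have "(e * real (card A))\<^sup>2 \<le> B\<^sup>2" using N cA by (simp add: mult_le_cancel_left)
  moreover have "B \<ge> 0" using k0 norm_ge_zero by metis
  ultimately have "e * real (card A) \<le> B" by (rule power2_le_imp_le)
  then show ?thesis using k0 unfolding X_def by blast
qed

section \<open>From large discrete coefficients to large exponential integrals\<close>

lemma integral_blocks:
  fixes u :: "real \<Rightarrow> complex"
  assumes "continuous_on UNIV u" "\<eta> \<ge> 0"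
  shows "integral {a..a + real N * \<eta>} u = (\<Sum>n<N. integral {a + real n * \<eta>..a + real n * \<eta> + \<eta>} u)"
proof (induction N)
  case (Suc N)
  have "integral {a..a + real N * \<eta>} u + integral {a + real N * \<eta>..a + real (Suc N) * \<eta>} u
      = integral {a..a + real (Suc N) * \<eta>} u"
    by (rule Henstock_Kurzweil_Integration.integral_combine)
      (use assms in \<open>auto intro: integrable_on_Icc_continuous simp: algebra_simps\<close>)
  moreover have "a + real (Suc N) * \<eta> = a + real N * \<eta> + \<eta>" by (simp add: algebra_simps)
  ultimately show ?case using Suc.IH unfolding sum.lessThan_Suc by metis
qed simp

lemma continuous_cis [continuous_intros]:
  "continuous_on S f \<Longrightarrow> continuous_on S (\<lambda>t. cis (f t))"
  unfolding cis_conv_exp by (intro continuous_intros)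

lemma integral_cis:
  assumes "\<nu> \<noteq> 0" "T \<ge> 0"
  shows "integral {a..a + T} (\<lambda>t. cis (\<nu> * t)) = (cis (\<nu> * (a + T)) - cis (\<nu> * a)) / (\<i> * of_real \<nu>)"
proof -
  have "((\<lambda>t. cis (\<nu> * t) / (\<i> * of_real \<nu>)) has_vector_derivative cis (\<nu> * x)) (at x within {a..a + T})" for x
  proof -
    have "((\<lambda>z. exp (\<i> * (of_real \<nu> * z)) / (\<i> * of_real \<nu>)) has_field_derivative exp (\<i> * (of_real \<nu> * of_real x)))
        (at (of_real x))"
      using assms by (auto intro!: derivative_eq_intros simp: mult_ac)
    from has_vector_derivative_real_field[OF this] show ?thesis
      by (simp add: cis_conv_exp)
  qed
  then have "((\<lambda>t. cis (\<nu> * t)) has_integral cis (\<nu> * (a + T)) / (\<i> * of_real \<nu>) - cis (\<nu> * a) / (\<i> * of_real \<nu>)) {a..a + T}"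
    using assms by (intro fundamental_theorem_of_calculus) auto
  then show ?thesis by (simp add: integral_unique diff_divide_distrib)
qed

lemma norm_cis_minus_1: "norm (cis x - 1) = 2 * \<bar>sin (x / 2)\<bar>"
proof -
  have "(norm (cis x - 1))\<^sup>2 = (cos x - 1)\<^sup>2 + (sin x)\<^sup>2" by (simp add: cmod_def)
  also have "\<dots> = 2 - 2 * cos x" using sin_cos_squared_add[of x] by (simp add: power2_eq_square algebra_simps)
  also have "cos x = 1 - 2 * (sin (x / 2))\<^sup>2" using cos_double_sin[of "x/2"] by simp
  finally have "(norm (cis x - 1))\<^sup>2 = (2 * \<bar>sin (x / 2)\<bar>)\<^sup>2" by (simp add: power_mult_distrib)
  then show ?thesis by (rule power2_eq_imp_eq) auto
qed

text \<open>The Taylor error is at most \<open>\<bar>x\<bar> ^ 3 / 6\<close>, and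
  \<open>\<bar>x\<bar> \<le> 2\<close> leaves a third of \<open>\<bar>x\<bar>\<close>.\<close>

lemma abs_sin_ge_third:
  assumes "\<bar>x\<bar> \<le> pi / 2"
  shows "\<bar>sin x\<bar> \<ge> \<bar>x\<bar> / 3"
proof -
  have "\<bar>sin x - (\<Sum>m<3. sin_coeff m * x ^ m)\<bar> \<le> inverse (fact 3) * \<bar>x\<bar> ^ 3"
    by (rule Maclaurin_sin_bound)
  moreover have "(\<Sum>m<3. sin_coeff m * x ^ m) = x"
    by (simp add: numeral_3_eq_3 sin_coeff_def)
  ultimately have "\<bar>sin x - x\<bar> \<le> \<bar>x\<bar> ^ 3 / 6" by (simp add: fact_numeral field_simps)
  also have "\<bar>x\<bar> ^ 3 = \<bar>x\<bar> * \<bar>x\<bar>\<^sup>2" by (simp add: power3_eq_cube power2_eq_square)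
  also have "\<dots> \<le> \<bar>x\<bar> * 2\<^sup>2"
    using assms pi_less_4 by (intro mult_left_mono power_mono) auto
  finally have "\<bar>sin x - x\<bar> \<le> \<bar>x\<bar> * 2 / 3" by simp
  then show ?thesis by linarith
qed

text \<open>Over one sampling cell the phase turns by at most half a circle, so there is no full
  cancellation. This factor links a sum over samples to an integral.\<close>

lemma norm_integral_cis_ge:
  assumes "\<eta> > 0" "\<bar>\<nu> * \<eta>\<bar> \<le> pi"
  shows "norm (integral {0..0 + \<eta>} (\<lambda>t. cis (- \<nu> * t))) \<ge> \<eta> / 3"
proof (cases "\<nu> = 0")
  case False
  have "norm (integral {0..0 + \<eta>} (\<lambda>t. cis (- \<nu> * t))) = norm (cis (- \<nu> * \<eta>) - 1) / \<bar>\<nu>\<bar>"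
    by (subst integral_cis) (use False assms in \<open>auto simp: norm_divide norm_mult\<close>)
  also have "\<dots> = 2 * \<bar>sin (- \<nu> * \<eta> / 2)\<bar> / \<bar>\<nu>\<bar>" by (simp only: norm_cis_minus_1)
  also have "\<dots> \<ge> 2 * (\<bar>- \<nu> * \<eta> / 2\<bar> / 3) / \<bar>\<nu>\<bar>"
    using assms by (intro divide_right_mono mult_left_mono abs_sin_ge_third) auto
  also have "2 * (\<bar>- \<nu> * \<eta> / 2\<bar> / 3) / \<bar>\<nu>\<bar> = \<eta> / 3" using False assms by (simp add: abs_mult)
  finally show ?thesis .
qed (use assms in simp)

text \<open>Uniform continuity surrounds each \<open>e / 2\<close>-almost period by an interval of
  length \<open>d\<close> of \<open>e\<close>-almost periods, which holds \<open>q\<close>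
  consecutive points of the grid with step \<open>d / q\<close>. A block of \<open>p * q\<close>
  steps has length \<open>p * d\<close>, enough for such an interval. The point is that
  \<open>p\<close> does not depend on \<open>q\<close>: refining the grid does not thin out the
  almost periods.\<close>

lemma almost_period_blocks:
  assumes "bohr_ap h" "e > 0"
  obtains d p where "d > 0" "(p::nat) > 0"
    "\<And>q j. q > 0 \<Longrightarrow> \<exists>n\<ge>j * (p * q). n + q \<le> Suc j * (p * q) \<and>
        (\<forall>i<q. almost_period h e (real (n + i) * (d / real q)))"
proof -
  have e2: "e / 2 > 0" using assms by simp
  obtain d where d: "d > 0" "\<And>x y. \<bar>x - y\<bar> \<le> d \<Longrightarrow> norm (h x - h y) \<le> e / 2"
    using bohr_ap_uniformly_continuous[OF assms(1) e2] by blast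
  obtain l where l: "l > 0" "\<And>a. \<exists>\<tau>\<in>{a..a + l}. almost_period h (e/2) \<tau>"
    using bohr_apE[OF assms(1) e2] by blast
  obtain p :: nat where p: "real p > l / d + 1" using reals_Archimedean2 by blast
  have "p > 0" using p l d by (cases p) (auto simp: field_simps)
  have "\<exists>n\<ge>j * (p * q). n + q \<le> Suc j * (p * q) \<and>
        (\<forall>i<q. almost_period h e (real (n + i) * (d / real q)))" if q: "q > 0" for q j :: nat
  proof -
    define \<eta> where "\<eta> = d / real q"
    have \<eta>: "\<eta> > 0" using d q by (simp add: \<eta>_def)
    have dq: "d = real q * \<eta>" using q by (simp add: \<eta>_def)
    obtain \<tau> where \<tau>: "\<tau> \<in> {real (j * p) * d..real (j * p) * d + l}" "almost_period h (e/2) \<tau>"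
      using l by blast
    have lo: "real (j * (p * q)) \<le> \<tau> / \<eta>" using \<tau>(1) \<eta> by (simp add: dq field_simps)
    have "l < (real p - 1) * d" using p d by (simp add: field_simps)
    then have "\<tau> < real (j * p) * d + (real p - 1) * d" using \<tau>(1) by simp
    then have hi: "\<tau> / \<eta> < real (j * (p * q)) + real (p * q) - real q"
      using \<eta> by (simp add: dq field_simps)
    \<comment> \<open>Rounding up puts the first grid point at most one step after \<tau>, and
      \<open>q - 1\<close> further steps stay within distance \<open>d\<close>.\<close>
    define n where "n = nat \<lceil>\<tau> / \<eta>\<rceil>"
    have "\<tau> / \<eta> \<ge> 0" using lo of_nat_0_le_iff order_trans by blast
    then have n: "real n \<ge> \<tau> / \<eta>" "real n < \<tau> / \<eta> + 1" unfolding n_def by linarith+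
    have "real (j * (p * q)) \<le> real n" using n lo by linarith
    then have 1: "j * (p * q) \<le> n" by (simp only: of_nat_le_iff)
    have "real (n + q) < real (j * (p * q) + p * q) + 1" using n hi by simp
    then have 2: "n + q \<le> Suc j * (p * q)" by (simp del: of_nat_add of_nat_mult add: algebra_simps)
    have 3: "almost_period h e (real (n + i) * \<eta>)" if "i < q" for i
      unfolding almost_period_def
    proof
      fix t
      have "\<tau> \<le> real n * \<eta>" "real n * \<eta> \<le> \<tau> + \<eta>" using n \<eta> by (simp_all add: field_simps)
      moreover have "real i * \<eta> \<le> (real q - 1) * \<eta>" using that \<eta> by (intro mult_right_mono) auto
      moreover have "(real q - 1) * \<eta> = real q * \<eta> - \<eta>" "real (n + i) * \<eta> = real n * \<eta> + real i * \<eta>"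
        by (simp_all add: algebra_simps)
      moreover have "real i * \<eta> \<ge> 0" using \<eta> by simp
      ultimately have "\<bar>(t + real (n + i) * \<eta>) - (t + \<tau>)\<bar> \<le> d"
        unfolding dq abs_le_iff by linarith
      from d(2)[OF this] almost_periodD[OF \<tau>(2), of t]
      show "norm (h (t + real (n + i) * \<eta>) - h t) \<le> e"
        using norm_triangle_ineq[of "h (t + real (n + i) * \<eta>) - h (t + \<tau>)" "h (t + \<tau>) - h t"] by simp
    qed
    show ?thesis using 1 2 3 unfolding \<eta>_def by blast
  qed
  then show ?thesis using that d(1) \<open>p > 0\<close> by blast
qed

lemma card_almost_periods_ge:
  assumes "\<And>j. \<exists>n\<ge>j * b. n + q \<le> Suc j * b \<and> (\<forall>i<q. P (n + i))"
  shows "card {m. m < J * b \<and> P m} \<ge> J * q"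
proof (induction J)
  case (Suc J)
  obtain n where n: "n \<ge> J * b" "n + q \<le> Suc J * b" "\<And>i. i < q \<Longrightarrow> P (n + i)" using assms by blast
  have "P m" if "m \<in> {n..<n + q}" for m using n(3)[of "m - n"] that by auto
  then have "{m. m < J * b \<and> P m} \<union> {n..<n + q} \<subseteq> {m. m < Suc J * b \<and> P m}"
    using n(1,2) by auto
  then have "card ({m. m < J * b \<and> P m} \<union> {n..<n + q}) \<le> card {m. m < Suc J * b \<and> P m}"
    by (intro card_mono) auto
  moreover have "card ({m. m < J * b \<and> P m} \<union> {n..<n + q}) = card {m. m < J * b \<and> P m} + q"
    using n(1) by (subst card_Un_disjoint) auto
  ultimately show ?case using Suc.IH by simp
qed simp

text \<open>The samples have almost periods of density at least \<open>1 / p\<close> in the first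
  half of the grid, so one discrete frequency is large, and it survives the passage to the integral.
  The grid step is fixed before \<open>T\<close>, which bounds the frequency by a constant.\<close>

lemma large_exponential_integral_at_0:
  assumes h: "bohr_ap h" "h 0 \<noteq> 0"
  obtains c \<Omega> where "c > 0"
    "\<And>T0. \<exists>T\<ge>T0. \<exists>\<nu>. \<bar>\<nu>\<bar> \<le> \<Omega> \<and> c * T \<le> norm (integral {0..0 + T} (\<lambda>t. h t * cis (- (\<nu> * t))))"
proof -
  have ch: "continuous_on UNIV h" using h(1) by (rule bohr_ap_continuous)
  define e where "e = norm (h 0) / 3"
  have e: "e > 0" using h(2) by (simp add: e_def)
  obtain d and p :: nat where d: "d > 0" and p: "p > 0" and blk:
    "\<And>q j. q > 0 \<Longrightarrow> \<exists>n\<ge>j * (p * q). n + q \<le> Suc j * (p * q) \<and>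
        (\<forall>i<q. almost_period h e (real (n + i) * (d / real q)))"
    using almost_period_blocks[OF h(1) e] by blast
  \<comment> \<open>With \<open>T = N * \<eta>\<close> the main term is at least
    \<open>e * (J * q) * \<eta> / 3 = 2 * c * T\<close>, and sampling costs at most
    \<open>c * T\<close>. Apart from \<open>e\<close> only \<open>p\<close> enters \<open>c\<close>,
    so the grid may still be refined to suit \<open>c\<close>.\<close>
  define c where "c = e / (12 * real p)"
  have c: "c > 0" using e p by (simp add: c_def)
  obtain d' where d': "d' > 0" "\<And>x y. \<bar>x - y\<bar> \<le> d' \<Longrightarrow> norm (h x - h y) \<le> c"
    using bohr_ap_uniformly_continuous[OF h(1) c] by blast
  obtain q :: nat where q: "real q > d / d'" using reals_Archimedean2 by blast
  have "q > 0" using q d d' by (cases q) (auto simp: field_simps)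
  define \<eta> where "\<eta> = d / real q"
  have \<eta>: "\<eta> > 0" "\<eta> \<le> d'" using d d' q \<open>q > 0\<close> by (auto simp: \<eta>_def field_simps)
  have "\<exists>T\<ge>T0. \<exists>\<nu>. \<bar>\<nu>\<bar> \<le> pi / \<eta> \<and> c * T \<le> norm (integral {0..0 + T} (\<lambda>t. h t * cis (- (\<nu> * t))))" for T0
  proof -
    obtain J :: nat where J: "real J > max T0 1 / \<eta>" using reals_Archimedean2 by blast
    have "0 < max T0 1 / \<eta>" using \<eta> by (intro divide_pos_pos) auto
    then have "J > 0" using J by linarith
    \<comment> \<open>The factor 2 leaves room for shifts by members of \<open>A\<close>, as
      \<open>large_dft_coefficient\<close> requires.\<close>
    define N where "N = 2 * (J * (p * q))"
    have N: "N > 0" using \<open>J > 0\<close> p \<open>q > 0\<close> by (simp add: N_def)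
    define A where "A = {m. m < J * (p * q) \<and> almost_period h e (real m * \<eta>)}"
    have cA: "J * q \<le> card A" unfolding A_def
      using blk[OF \<open>q > 0\<close>] by (intro card_almost_periods_ge) (simp add: \<eta>_def)
    define w where "w = cis (- (2 * pi / real N))"
    have wj: "w ^ j = cis (- (2 * pi * real j / real N))" for j
      unfolding w_def Complex.DeMoivre by (rule arg_cong[of _ _ cis]) simp
    have w: "norm w = 1" "w ^ N = 1" using N wj[of N] by (simp_all add: w_def complex_eq_iff)
    have w': "w ^ j \<noteq> 1" if "0 < j" "j < N" for j
    proof
      assume "w ^ j = 1"
      then have "norm (cis (- (2 * pi * real j / real N)) - 1) = 0" by (simp add: wj)
      then have "sin (pi * real j / real N) = 0" by (simp add: norm_cis_minus_1)
      moreover have "0 < pi * real j / real N" "pi * real j / real N < pi" using that N by (auto simp: field_simps)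
      ultimately show False using sin_gt_zero by (metis less_irrefl)
    qed
    have "\<exists>k<N. norm (\<Sum>n<N. h (real n * \<eta>) * w ^ (k * n)) \<ge> e * real (card A)"
    proof (rule large_dft_coefficient[where M = "J * (p * q)"])
      show "A \<noteq> {}" using cA \<open>J > 0\<close> \<open>q > 0\<close> by auto
      show "norm (h (real (n + m) * \<eta>) - h (real n * \<eta>)) \<le> e" if "m \<in> A" for m n
        using almost_periodD[of h e "real m * \<eta>" "real n * \<eta>"] that by (simp add: A_def algebra_simps)
      show "3 * e \<le> norm (h (real 0 * \<eta>))" by (simp add: e_def)
    qed (use w w' e in \<open>auto simp: A_def N_def\<close>)
    then obtain k where k: "k < N" "norm (\<Sum>n<N. h (real n * \<eta>) * w ^ (k * n)) \<ge> e * real (card A)" by blast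
    \<comment> \<open>Discrete frequencies above \<open>N / 2\<close> are read as negative ones.
      This gives \<open>\<bar>\<theta>\<bar> \<le> pi\<close>, the bound behind
      \<open>\<Omega>\<close> and behind the estimate on a single cell.\<close>
    define \<theta> where "\<theta> = (if 2 * k \<le> N then 2 * pi * real k / real N else 2 * pi * real k / real N - 2 * pi)"
    define \<nu> where "\<nu> = \<theta> / \<eta>"
    have \<theta>: "\<bar>\<theta>\<bar> \<le> pi"
    proof (cases "2 * k \<le> N")
      case True
      then have "real k * 2 \<le> real N" by (metis mult.commute of_nat_le_iff of_nat_mult of_nat_numeral)
      then show ?thesis using True N by (simp add: \<theta>_def field_simps)
    next
      case False
      then have "real k * 2 \<ge> real N" by linarith
      then show ?thesis using False N k(1) by (simp add: \<theta>_def field_simps abs_le_iff)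
    qed
    have cth: "cis (- \<theta>) = w ^ k"
      by (auto simp: \<theta>_def wj) (simp add: cis_mult[symmetric] diff_conv_add_uminus del: add_uminus_conv_diff)
    have \<nu>: "cis (- (\<nu> * (real n * \<eta>))) = w ^ (k * n)" for n
    proof -
      have "cis (- (\<nu> * (real n * \<eta>))) = cis (- \<theta>) ^ n" using \<eta> by (simp add: \<nu>_def Complex.DeMoivre mult_ac)
      then show ?thesis by (simp add: cth power_mult)
    qed
    define T where "T = real N * \<eta>"
    have T: "T \<ge> T0"
    proof -
      have "T0 \<le> real J * \<eta>" using J \<eta> by (simp add: field_simps)
      moreover have "1 * real J \<le> real (2 * (p * q)) * real J"
        using p \<open>q > 0\<close> by (intro mult_right_mono) (auto simp del: of_nat_mult simp: Suc_le_eq)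
      then have "real J * \<eta> \<le> T" unfolding T_def N_def using \<eta> by (intro mult_right_mono) (auto simp: mult_ac)
      ultimately show ?thesis by simp
    qed
    define E where "E = integral {0..0 + \<eta>} (\<lambda>t. cis (- \<nu> * t))"
    have E: "norm E \<ge> \<eta> / 3" unfolding E_def
      using \<theta> \<eta> by (intro norm_integral_cis_ge) (auto simp: \<nu>_def)
    define g where "g = (\<lambda>t. h t * cis (- (\<nu> * t)))"
    have cg: "continuous_on UNIV g" unfolding g_def by (intro continuous_intros ch)
    \<comment> \<open>On one cell \<open>h\<close> is frozen at its left end; the cell integral of
      the oscillation is \<open>E\<close> up to the phase \<open>w ^ (k * n)\<close>.\<close>
    have blk: "norm (integral {0 + real n * \<eta>..0 + real n * \<eta> + \<eta>} g - h (real n * \<eta>) * w ^ (k * n) * E) \<le> c * \<eta>" for n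
    proof -
      have "integral {0 + real n * \<eta>..0 + real n * \<eta> + \<eta>} (\<lambda>t. cis (- \<nu> * t))
          = integral {0..0 + \<eta>} (\<lambda>t. w ^ (k * n) * cis (- \<nu> * t))"
      proof -
        have "cis (- \<nu> * (t + real n * \<eta>)) = cis (- (\<nu> * (real n * \<eta>))) * cis (- \<nu> * t)" for t
          by (simp add: cis_mult algebra_simps)
        then show ?thesis unfolding integral_translate by (simp only: \<nu>)
      qed
      also have "\<dots> = w ^ (k * n) * E" unfolding E_def by simp
      finally have "h (real n * \<eta>) * w ^ (k * n) * E =
          integral {0 + real n * \<eta>..0 + real n * \<eta> + \<eta>} (\<lambda>t. h (real n * \<eta>) * cis (- \<nu> * t))"
        by simp
      moreover have "norm (integral {0 + real n * \<eta>..0 + real n * \<eta> + \<eta>} g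
          - integral {0 + real n * \<eta>..0 + real n * \<eta> + \<eta>} (\<lambda>t. h (real n * \<eta>) * cis (- \<nu> * t))) \<le> c * \<eta>"
      proof (rule norm_integral_diff_le[OF cg])
        show "continuous_on UNIV (\<lambda>t. h (real n * \<eta>) * cis (- \<nu> * t))" by (intro continuous_intros)
        fix t assume t: "t \<in> {0 + real n * \<eta>..0 + real n * \<eta> + \<eta>}"
        have "g t - h (real n * \<eta>) * cis (- \<nu> * t) = (h t - h (real n * \<eta>)) * cis (- (\<nu> * t))"
          by (simp add: g_def algebra_simps)
        then have "norm (g t - h (real n * \<eta>) * cis (- \<nu> * t)) = norm (h t - h (real n * \<eta>))"
          by (simp add: norm_mult)
        also have "\<dots> \<le> c" using t \<eta> by (intro d'(2)) auto
        finally show "norm (g t - h (real n * \<eta>) * cis (- \<nu> * t)) \<le> c" .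
      qed (use \<eta> in simp)
      ultimately show ?thesis by (simp only:)
    qed
    define S where "S = (\<Sum>n<N. h (real n * \<eta>) * w ^ (k * n))"
    have "integral {0..0 + T} g - S * E
        = (\<Sum>n<N. integral {0 + real n * \<eta>..0 + real n * \<eta> + \<eta>} g - h (real n * \<eta>) * w ^ (k * n) * E)"
      unfolding T_def S_def sum_subtractf sum_distrib_right
      using integral_blocks[OF cg, of \<eta> 0 N] \<eta> by simp
    also have "norm \<dots> \<le> (\<Sum>n<N. c * \<eta>)" by (intro sum_norm_le blk)
    also have "\<dots> = c * T" by (simp add: T_def)
    finally have diff: "norm (integral {0..0 + T} g - S * E) \<le> c * T" .
    have "2 * c * T = (e * real (J * q)) * (\<eta> / 3)"
      using p by (simp add: c_def T_def N_def field_simps)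
    also have "\<dots> \<le> norm S * norm E"
      using k(2) cA e E \<eta> unfolding S_def
      by (intro mult_mono order_trans[OF _ k(2)] mult_left_mono) (auto simp del: of_nat_mult)
    finally have "2 * c * T \<le> norm (S * E)" by (simp add: norm_mult)
    then have "c * T \<le> norm (integral {0..0 + T} g)"
      using diff norm_triangle_ineq3[of "integral {0..0 + T} g" "S * E"] by linarith
    moreover have "\<bar>\<nu>\<bar> \<le> pi / \<eta>" using \<theta> \<eta> by (simp add: \<nu>_def divide_right_mono)
    ultimately show ?thesis using T unfolding g_def by blast
  qed
  then show ?thesis using that c by blast
qed

lemma bohr_ap_translate:
  assumes "bohr_ap h"
  shows "bohr_ap (\<lambda>t. h (t + b))"
proof (rule bohr_ap_dominated[OF assms])
  show "dominated h (\<lambda>t. h (t + b))" unfolding dominated_def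
  proof (intro allI impI)
    fix \<epsilon> :: real assume "\<epsilon> > 0"
    have "almost_period (\<lambda>t. h (t + b)) \<epsilon> \<tau>" if "almost_period h \<epsilon> \<tau>" for \<tau>
      using almost_periodD[OF that, of "_ + b"] by (simp add: almost_period_def add_ac)
    with \<open>\<epsilon> > 0\<close> show "\<exists>\<delta>>0. \<forall>\<tau>. almost_period h \<delta> \<tau> \<longrightarrow> almost_period (\<lambda>t. h (t + b)) \<epsilon> \<tau>"
      by blast
  qed
  show "continuous_on UNIV (\<lambda>t. h (t + b))"
    using bohr_ap_continuous[OF assms, of UNIV] by (rule continuous_on_compose2) (auto intro: continuous_intros)
qed

lemma large_exponential_integral:
  assumes h: "bohr_ap h" "h t0 \<noteq> 0"
  obtains c \<Omega> where "c > 0"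
    "\<And>T0. \<exists>T\<ge>T0. \<exists>a \<nu>. \<bar>\<nu>\<bar> \<le> \<Omega> \<and> c * T \<le> norm (integral {a..a + T} (\<lambda>t. h t * cis (- (\<nu> * t))))"
proof -
  have tr: "bohr_ap (\<lambda>t. h (t + t0))" by (rule bohr_ap_translate[OF h(1)])
  have "h (0 + t0) \<noteq> 0" using h(2) by simp
  from large_exponential_integral_at_0[OF tr this] obtain c \<Omega> where c: "c > 0"
    "\<And>T0. \<exists>T\<ge>T0. \<exists>\<nu>. \<bar>\<nu>\<bar> \<le> \<Omega> \<and> c * T \<le> norm (integral {0..0 + T} (\<lambda>t. h (t + t0) * cis (- (\<nu> * t))))"
    by blast
  have "norm (integral {0..0 + T} (\<lambda>t. h (t + t0) * cis (- (\<nu> * t)))) =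
      norm (integral {0 + t0..0 + t0 + T} (\<lambda>t. h t * cis (- (\<nu> * t))))" for T \<nu>
  proof -
    have "cis (- (\<nu> * (t + t0))) = cis (- (\<nu> * t0)) * cis (- (\<nu> * t))" for t
      by (simp add: cis_mult algebra_simps)
    then have "h (t + t0) * cis (- (\<nu> * (t + t0))) = cis (- (\<nu> * t0)) * (h (t + t0) * cis (- (\<nu> * t)))" for t
      by simp
    then show ?thesis unfolding integral_translate by (simp only: integral_mult_right norm_mult) simp
  qed
  then show ?thesis using that[OF c(1)] c(2) by metis
qed

section \<open>Resonance between frequencies and almost periods\<close>

lemma norm_cis_diff: "norm (cis x - cis y) = 2 * \<bar>sin ((x - y) / 2)\<bar>"
proof -
  have "cis x - cis y = cis y * (cis (x - y) - 1)" by (simp add: algebra_simps cis_mult)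
  then show ?thesis by (simp add: norm_mult norm_cis_minus_1)
qed

lemma norm_cis_diff_le: "norm (cis x - cis y) \<le> \<bar>x - y\<bar>"
  using abs_sin_x_le_abs_x[of "(x - y) / 2"] by (simp add: norm_cis_diff)

text \<open>Moving a window by an almost period \<open>\<tau>\<close> multiplies its exponential integral almost exactly
  by \<open>cis (- \<nu> \<tau>)\<close>, but also changes it little when \<open>\<tau>\<close> is short compared with the window.\<close>
lemma almost_period_phase:
  assumes F: "continuous_on UNIV F" "\<And>t. norm (F t) \<le> M" and ap: "almost_period F \<epsilon> \<tau>" and T: "T \<ge> 0"
  shows "norm (cis (- (\<nu> * \<tau>)) - 1) * norm (integral {a..a + T} (\<lambda>t. F t * cis (- (\<nu> * t))))
    \<le> \<epsilon> * T + 2 * M * \<bar>\<tau>\<bar>"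
proof -
  define g where "g = (\<lambda>t. F t * cis (- (\<nu> * t)))"
  have cg: "continuous_on UNIV g" unfolding g_def by (intro continuous_intros F)
  have Mg: "norm (g t) \<le> M" for t using F(2) by (simp add: g_def norm_mult)
  have "integral {a + \<tau>..a + \<tau> + T} g = integral {a..a + T} (\<lambda>t. g (t + \<tau>))" by (rule integral_translate)
  moreover have "norm (integral {a..a + T} (\<lambda>t. g (t + \<tau>)) - integral {a..a + T} (\<lambda>t. cis (- (\<nu> * \<tau>)) * g t)) \<le> \<epsilon> * T"
  proof (rule norm_integral_diff_le)
    fix t
    have "cis (- (\<nu> * (t + \<tau>))) = cis (- (\<nu> * \<tau>)) * cis (- (\<nu> * t))" by (simp add: cis_mult algebra_simps)
    then have "g (t + \<tau>) - cis (- (\<nu> * \<tau>)) * g t = (F (t + \<tau>) - F t) * cis (- (\<nu> * (t + \<tau>)))"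
      by (simp add: g_def left_diff_distrib)
    then show "norm (g (t + \<tau>) - cis (- (\<nu> * \<tau>)) * g t) \<le> \<epsilon>"
      using almost_periodD[OF ap, of t] by (simp add: norm_mult)
  qed (use T in \<open>auto intro!: continuous_intros cg continuous_on_compose2[OF cg]\<close>)
  moreover have "norm (integral {a + \<tau>..a + \<tau> + T} g - integral {a..a + T} g) \<le> 2 * M * \<bar>\<tau>\<bar>"
    using integral_window_move[OF cg Mg T, of "a + \<tau>" a] by simp
  ultimately have "norm (cis (- (\<nu> * \<tau>)) * integral {a..a + T} g - integral {a..a + T} g) \<le> \<epsilon> * T + 2 * M * \<bar>\<tau>\<bar>"
    using norm_triangle_ineq[of "cis (- (\<nu> * \<tau>)) * integral {a..a + T} g - integral {a + \<tau>..a + \<tau> + T} g"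
      "integral {a + \<tau>..a + \<tau> + T} g - integral {a..a + T} g"]
    by (simp add: norm_minus_commute)
  moreover have "cis (- (\<nu> * \<tau>)) * integral {a..a + T} g - integral {a..a + T} g
      = (cis (- (\<nu> * \<tau>)) - 1) * integral {a..a + T} g" by (simp add: algebra_simps)
  ultimately show ?thesis unfolding g_def by (simp only: norm_mult)
qed

text \<open>After division by \<open>c * T n\<close> the shift error
  \<open>2 * M * \<bar>\<tau>\<bar>\<close> disappears as the windows grow, since \<tau> stays
  fixed. A limit of persistent frequencies therefore nearly returns to its phase after every almost
  period of \<open>F\<close>.\<close>

lemma almost_period_phase_limit:
  assumes F: "bohr_ap F" and c: "c > 0" and lim: "\<nu> \<longlonglongrightarrow> \<mu>"
    and T: "\<And>n::nat. T n \<ge> real n"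
    and I: "\<And>n. c * T n \<le> norm (integral {a n..a n + T n} (\<lambda>t. F t * cis (- (\<nu> n * t))))"
    and ap: "almost_period F \<epsilon> \<tau>"
  shows "norm (cis (- (\<mu> * \<tau>)) - 1) \<le> \<epsilon> / c"
proof -
  obtain M where M: "M > 0" "\<And>t. norm (F t) \<le> M" using bohr_ap_bounded[OF F] by blast
  have cF: "continuous_on UNIV F" using F by (rule bohr_ap_continuous)
  define R where "R = (\<lambda>n. \<epsilon> / c + 2 * M * \<bar>\<tau>\<bar> / c * inverse (T n))"
  have Tinf: "filterlim T at_top sequentially"
    by (rule filterlim_at_top_mono[OF filterlim_real_sequentially]) (use T in auto)
  have "R \<longlonglongrightarrow> \<epsilon> / c + 2 * M * \<bar>\<tau>\<bar> / c * 0" unfolding R_def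
    by (intro tendsto_intros tendsto_inverse_0_at_top Tinf)
  moreover have "(\<lambda>n. norm (cis (- (\<nu> n * \<tau>)) - 1)) \<longlonglongrightarrow> norm (cis (- (\<mu> * \<tau>)) - 1)"
    unfolding cis_conv_exp by (intro tendsto_intros lim)
  moreover have "norm (cis (- (\<nu> n * \<tau>)) - 1) \<le> R n" if "n \<ge> 1" for n
  proof -
    have Tp: "T n > 0" using T[of n] that by linarith
    have "norm (cis (- (\<nu> n * \<tau>)) - 1) * (c * T n) \<le> \<epsilon> * T n + 2 * M * \<bar>\<tau>\<bar>"
      using almost_period_phase[OF cF M(2) ap, of "T n" "\<nu> n" "a n"] Tp I[of n]
        mult_left_mono[OF I[of n], of "norm (cis (- (\<nu> n * \<tau>)) - 1)"] by simp
    then show ?thesis using Tp c by (simp add: R_def field_simps)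
  qed
  ultimately show ?thesis
    using LIMSEQ_le[of "\<lambda>n. norm (cis (- (\<nu> n * \<tau>)) - 1)" _ R] by auto
qed

text \<open>A frequency that correlates with \<open>F\<close> on arbitrarily long windows inherits
  the almost periods of \<open>F\<close>: the limit estimate for the constant sequence \<mu> gives
  \<open>\<delta> = \<epsilon> * c\<close>.\<close>

lemma dominated_cis:
  assumes F: "bohr_ap F" and c: "c > 0"
    and I: "\<And>T0. \<exists>T\<ge>T0. \<exists>a. c * T \<le> norm (integral {a..a + T} (\<lambda>t. F t * cis (- (\<mu> * t))))"
  shows "dominated F (\<lambda>t. cis (\<mu> * t))"
  unfolding dominated_def
proof (intro allI impI)
  fix \<epsilon> :: real assume e: "\<epsilon> > 0"
  have "\<exists>T a. real n \<le> T \<and> c * T \<le> norm (integral {a..a + T} (\<lambda>t. F t * cis (- (\<mu> * t))))" for n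
    using I by blast
  then obtain T a where Ta: "\<And>n. T n \<ge> real n"
    "\<And>n. c * T n \<le> norm (integral {a n..a n + T n} (\<lambda>t. F t * cis (- (\<mu> * t))))" by metis
  have "almost_period (\<lambda>t. cis (\<mu> * t)) \<epsilon> \<tau>" if "almost_period F (\<epsilon> * c) \<tau>" for \<tau>
    unfolding almost_period_def
  proof
    fix t
    have "norm (cis (- (\<mu> * \<tau>)) - 1) \<le> \<epsilon> * c / c"
      by (rule almost_period_phase_limit[OF F c _ Ta that]) simp
    then show "norm (cis (\<mu> * (t + \<tau>)) - cis (\<mu> * t)) \<le> \<epsilon>"
      using c by (simp add: norm_cis_diff norm_cis_minus_1 algebra_simps)
  qed
  then show "\<exists>\<delta>>0. \<forall>\<tau>. almost_period F \<delta> \<tau> \<longrightarrow> almost_period (\<lambda>t. cis (\<mu> * t)) \<epsilon> \<tau>"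
    using e c by (intro exI[of _ "\<epsilon> * c"]) auto
qed

lemma dominated_cis_minus: "dominated F (\<lambda>t. cis (\<mu> * t)) \<Longrightarrow> dominated F (\<lambda>t. cis (- (\<mu> * t)))"
  unfolding dominated_def almost_period_def
  by (simp add: norm_cis_diff flip: minus_mult_right) (simp add: algebra_simps abs_minus_commute)

text \<open>If some fixed correlation recurs on arbitrarily long windows, both factors of the
  product are dominated by \<open>F\<close>, and the product is almost periodic; otherwise the
  window integrals are \<open>o(T)\<close> uniformly in their position. In both cases the mean
  exists.\<close>

lemma umean_cis_dichotomy:
  assumes "bohr_ap F"
  shows "has_umean (\<lambda>t. F t * cis (- (\<mu> * t))) 0 \<or>
    dominated F (\<lambda>t. cis (\<mu> * t)) \<and> (\<exists>m. has_umean (\<lambda>t. F t * cis (- (\<mu> * t))) m)"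
proof (cases "\<exists>c>0. \<forall>T0. \<exists>T\<ge>T0. \<exists>a. c * T \<le> norm (integral {a..a + T} (\<lambda>t. F t * cis (- (\<mu> * t))))")
  case True
  then have d: "dominated F (\<lambda>t. cis (\<mu> * t))" using dominated_cis[OF assms] by blast
  obtain M where M: "M > 0" "\<And>t. norm (F t) \<le> M" using bohr_ap_bounded[OF assms] by blast
  have "dominated F (\<lambda>t. F t * cis (- (\<mu> * t)))"
    by (rule dominated_mult[OF dominated_refl dominated_cis_minus[OF d], of "max M 1"])
      (use M in \<open>auto simp: le_max_iff_disj\<close>)
  moreover have "continuous_on UNIV (\<lambda>t. F t * cis (- (\<mu> * t)))"
    by (intro continuous_intros bohr_ap_continuous assms)
  ultimately show ?thesis using bohr_ap_has_umean bohr_ap_dominated[OF assms] d by blast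
next
  case False
  have "has_umean (\<lambda>t. F t * cis (- (\<mu> * t))) 0" unfolding has_umean_def
  proof (intro allI impI)
    fix \<epsilon> :: real assume "\<epsilon> > 0"
    then obtain T0 where T0: "\<And>T a. T \<ge> T0 \<Longrightarrow> norm (integral {a..a + T} (\<lambda>t. F t * cis (- (\<mu> * t)))) < \<epsilon> * T"
      using False by (meson not_le)
    show "\<exists>T0>0. \<forall>T\<ge>T0. \<forall>a. norm (integral {a..a + T} (\<lambda>t. F t * cis (- (\<mu> * t))) - of_real T * 0) \<le> \<epsilon> * T"
      using T0 by (intro exI[of _ "max T0 1"]) (auto intro: less_imp_le)
  qed
  then show ?thesis by blast
qed

text \<open>Long windows on which \<open>h\<close> correlates with some bounded frequencies yield a limit frequency \<open>\<mu>\<close>; the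
  frequency of a window of length \<open>T\<close> differs from \<open>\<mu>\<close> by \<open>O(1/T)\<close>, so a fixed fraction of the window
  correlates with \<open>\<mu>\<close> itself.\<close>
theorem bohr_ap_exists_frequency:
  assumes h: "bohr_ap h" "h t0 \<noteq> 0"
  shows "\<exists>\<mu>. \<not> has_umean (\<lambda>t. h t * cis (- (\<mu> * t))) 0"
proof -
  obtain c \<Omega> where c: "c > 0" and I:
    "\<And>T0. \<exists>T\<ge>T0. \<exists>a \<nu>. \<bar>\<nu>\<bar> \<le> \<Omega> \<and> c * T \<le> norm (integral {a..a + T} (\<lambda>t. h t * cis (- (\<nu> * t))))"
    using large_exponential_integral[OF h] by blast
  have ch: "continuous_on UNIV h" using h(1) by (rule bohr_ap_continuous)
  obtain M where M: "M > 0" "\<And>t. norm (h t) \<le> M" using bohr_ap_bounded[OF h(1)] by blast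
  have "\<exists>T a \<nu>. real n \<le> T \<and> \<bar>\<nu>\<bar> \<le> \<Omega> \<and> c * T \<le> norm (integral {a..a + T} (\<lambda>t. h t * cis (- (\<nu> * t))))" for n
    using I by blast
  then obtain T a \<nu> where T: "\<And>n. T n \<ge> real n" and \<nu>: "\<And>n. \<bar>\<nu> n\<bar> \<le> \<Omega>"
    and I: "\<And>n. c * T n \<le> norm (integral {a n..a n + T n} (\<lambda>t. h t * cis (- (\<nu> n * t))))" by metis
  have "seq_compact {-\<Omega>..\<Omega>}" by (intro compact_imp_seq_compact compact_Icc)
  moreover have "\<forall>n. \<nu> n \<in> {-\<Omega>..\<Omega>}" using \<nu> by (auto simp: abs_le_iff) (metis minus_le_iff)
  ultimately obtain r \<mu> where r: "strict_mono r" "(\<nu> \<circ> r) \<longlonglongrightarrow> \<mu>" unfolding seq_compact_def by metis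
  have rn: "real n \<le> real (r n)" for n using seq_suble[OF r(1)] by simp
  \<comment> \<open>Constants of the closeness argument: the phase at \<mu> is off by at most 1/8,
    and \<kappa> lets a shift of at most \<open>\<kappa> * T n\<close> cost no more than
    \<open>\<epsilon> * T n\<close>, so the phase at \<open>\<nu> n\<close> is off by at most 1/4. A
    phase gap between pi/2 and pi forces a distance above their sum 3/8.\<close>
  define \<epsilon> where "\<epsilon> = c / 8"
  have \<epsilon>: "\<epsilon> > 0" using c by (simp add: \<epsilon>_def)
  have Tr: "(T \<circ> r) n \<ge> real n" for n using order_trans[OF rn T] by simp
  have phase: "norm (cis (- (\<mu> * \<tau>)) - 1) \<le> 1 / 8" if "almost_period h \<epsilon> \<tau>" for \<tau>
    using almost_period_phase_limit[OF h(1) c r(2), of "T \<circ> r" "a \<circ> r" \<epsilon> \<tau>] that I Tr c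
    by (auto simp: \<epsilon>_def)
  obtain l where l: "l > 0" "\<And>a. \<exists>\<tau>\<in>{a..a + l}. almost_period h \<epsilon> \<tau>" using bohr_apE[OF h(1) \<epsilon>] by blast
  define \<kappa> where "\<kappa> = \<epsilon> / (2 * M)"
  have \<kappa>: "\<kappa> > 0" using \<epsilon> M by (simp add: \<kappa>_def)
  \<comment> \<open>A short window \<open>T n\<close> cannot tell \<open>\<nu> n\<close> from \<open>\<mu>\<close>: otherwise some almost period of length at most
    \<open>\<kappa> * T n\<close> would have visibly different phases for the two frequencies.\<close>
  have close: "\<bar>\<nu> n - \<mu>\<bar> * (\<kappa> * T n) < pi" if small: "\<bar>\<nu> n - \<mu>\<bar> * l \<le> pi / 2" and n: "n > 0" for n
  proof (rule ccontr)
    assume "\<not> ?thesis"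
    then have ge: "\<bar>\<nu> n - \<mu>\<bar> * (\<kappa> * T n) \<ge> pi" by simp
    define \<delta> where "\<delta> = \<bar>\<nu> n - \<mu>\<bar>"
    have \<delta>: "\<delta> > 0" using ge pi_gt_zero by (cases "\<nu> n = \<mu>") (auto simp: \<delta>_def)
    have Tp: "T n > 0" using T[of n] n by linarith
    \<comment> \<open>An almost period of this size separates the two phases by between a quarter
      and a half turn; \<open>small\<close> ensures that the search interval does not
      overshoot.\<close>
    obtain \<tau> where \<tau>: "\<tau> \<in> {pi / 2 / \<delta>..pi / 2 / \<delta> + l}" "almost_period h \<epsilon> \<tau>" using l by blast
    have "l \<le> pi / 2 / \<delta>" using small \<delta> by (simp add: \<delta>_def field_simps)
    then have "\<tau> \<le> pi / \<delta>" using \<tau>(1) by simp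
    also have "pi / \<delta> \<le> \<kappa> * T n" using ge \<delta> by (simp add: \<delta>_def field_simps)
    finally have \<tau>T: "\<tau> \<le> \<kappa> * T n" .
    have "0 < pi / 2 / \<delta>" "pi / 2 / \<delta> \<le> \<tau>" using \<tau>(1) \<delta> by auto
    then have \<tau>0: "\<tau> > 0" by linarith
    have "norm (cis (- (\<nu> n * \<tau>)) - 1) * (c * T n) \<le> \<epsilon> * T n + 2 * M * \<bar>\<tau>\<bar>"
      using almost_period_phase[OF ch M(2) \<tau>(2), of "T n" "\<nu> n" "a n"] Tp
        mult_left_mono[OF I[of n], of "norm (cis (- (\<nu> n * \<tau>)) - 1)"] by simp
    also have "2 * M * \<bar>\<tau>\<bar> \<le> 2 * M * (\<kappa> * T n)" using \<tau>T \<tau>0 M by (intro mult_left_mono) auto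
    also have "\<epsilon> * T n + 2 * M * (\<kappa> * T n) = 1 / 4 * (c * T n)" using M by (simp add: \<kappa>_def \<epsilon>_def)
    finally have "norm (cis (- (\<nu> n * \<tau>)) - 1) \<le> 1 / 4" using c Tp by (simp add: mult_le_cancel_right)
    then have "norm (cis (- (\<nu> n * \<tau>)) - cis (- (\<mu> * \<tau>))) \<le> 3 / 8"
      using phase[OF \<tau>(2)] norm_triangle_ineq4[of "cis (- (\<nu> n * \<tau>)) - 1" "cis (- (\<mu> * \<tau>)) - 1"] by simp
    moreover have "\<bar>(- (\<nu> n * \<tau>) - - (\<mu> * \<tau>)) / 2\<bar> = \<delta> * \<tau> / 2"
    proof -
      have "(- (\<nu> n * \<tau>) - - (\<mu> * \<tau>)) / 2 = - ((\<nu> n - \<mu>) * \<tau> / 2)" by (simp add: field_simps)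
      then show ?thesis using \<tau>0 by (simp add: \<delta>_def abs_mult)
    qed
    moreover have "\<delta> * \<tau> \<ge> pi / 2" "\<delta> * \<tau> \<le> pi" using \<tau>(1) \<open>\<tau> \<le> pi / \<delta>\<close> \<delta> by (simp_all add: field_simps)
    ultimately show False
      using abs_sin_ge_third[of "(- (\<nu> n * \<tau>) - - (\<mu> * \<tau>)) / 2"] pi_gt3 unfolding norm_cis_diff by linarith
  qed
  have "\<not> has_umean (\<lambda>t. h t * cis (- (\<mu> * t))) 0"
  proof
    assume "has_umean (\<lambda>t. h t * cis (- (\<mu> * t))) 0"
    moreover have c4: "c / 4 > 0" using c by simp
    ultimately obtain T0 where T0: "T0 > 0"
      "\<And>T a. T \<ge> T0 \<Longrightarrow> norm (integral {a..a + T} (\<lambda>t. h t * cis (- (\<mu> * t)))) \<le> c / 4 * T"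
      unfolding has_umean_def mult_zero_right diff_zero by blast
    \<comment> \<open>Cutting the window into \<open>K\<close> pieces bounds the phase drift over
      one piece by \<open>pi / (\<kappa> * K)\<close>, chosen to cost at most half of the
      correlation \<open>c\<close>. The remaining half beats the \<open>c / 4\<close> allowed by the
      assumed zero mean.\<close>
    obtain K :: nat where K: "real K > max 1 (2 * M * pi / (\<kappa> * c))" using reals_Archimedean2 by blast
    have Kp: "real K > 0" using K by linarith
    have "2 * M * pi / (\<kappa> * c) < real K" using K by simp
    then have K': "M * pi / (\<kappa> * real K) \<le> c / 2" using \<kappa> c Kp by (simp add: field_simps)
    have "(\<lambda>n. \<bar>(\<nu> \<circ> r) n - \<mu>\<bar> * l) \<longlonglongrightarrow> \<bar>\<mu> - \<mu>\<bar> * l" by (intro tendsto_intros r)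
    then have "eventually (\<lambda>n. \<bar>(\<nu> \<circ> r) n - \<mu>\<bar> * l < pi / 2) sequentially" by (intro order_tendstoD(2)) auto
    then obtain n0 where n0: "\<And>n. n \<ge> n0 \<Longrightarrow> \<bar>\<nu> (r n) - \<mu>\<bar> * l < pi / 2"
      unfolding eventually_sequentially by auto
    obtain n1 :: nat where n1: "real n1 > T0 * real K" using reals_Archimedean2 by blast
    define n where "n = r (max 1 (max n0 n1))"
    have nn: "n \<ge> max 1 (max n0 n1)" unfolding n_def by (rule seq_suble[OF r(1)])
    have Tn: "T n \<ge> real n1" using T[of n] nn by linarith
    have small: "\<bar>\<nu> n - \<mu>\<bar> * (\<kappa> * T n) < pi" using nn n0 by (intro close) (auto simp: n_def intro: less_imp_le)
    define S where "S = T n / real K"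
    have TS: "T n = real K * S" using Kp by (simp add: S_def)
    have S: "S \<ge> T0" using n1 Tn Kp by (simp add: S_def field_simps)
    have Sp: "S > 0" using S T0 by linarith
    define g where "g = (\<lambda>\<nu> t. h t * cis (- (\<nu> * t)))"
    have cg: "continuous_on UNIV (g \<nu>)" for \<nu> unfolding g_def by (intro continuous_intros ch)
    have "\<exists>i<K. c * S \<le> norm (integral {a n + real i * S..a n + real i * S + S} (g (\<nu> n)))"
    proof (rule ccontr)
      assume "\<not> ?thesis"
      then have lt: "\<And>i. i < K \<Longrightarrow> norm (integral {a n + real i * S..a n + real i * S + S} (g (\<nu> n))) < c * S"
        by (meson not_le)
      have "norm (integral {a n..a n + real K * S} (g (\<nu> n)))
          \<le> (\<Sum>i<K. norm (integral {a n + real i * S..a n + real i * S + S} (g (\<nu> n))))"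
        using integral_blocks[OF cg, of S "a n" K] Sp by (simp add: norm_sum)
      also have "\<dots> < (\<Sum>i<K. c * S)" using lt Kp by (intro sum_strict_mono) (auto simp: lessThan_empty_iff)
      finally show False using I[of n] TS by (simp add: g_def mult_ac)
    qed
    then obtain b where b: "c * S \<le> norm (integral {b..b + S} (g (\<nu> n)))" by blast
    \<comment> \<open>Measuring the phase from the left end \<open>b\<close> leaves the norm
      unchanged but makes the phase difference proportional to \<open>t - b\<close> instead of
      \<open>t\<close>.\<close>
    have rot: "norm (integral {b..b + S} (\<lambda>t. h t * cis (- (\<nu> * (t - b))))) = norm (integral {b..b + S} (g \<nu>))" for \<nu>
    proof -
      have "cis (- (\<nu> * (t - b))) = cis (\<nu> * b) * cis (- (\<nu> * t))" for t
        by (simp add: cis_mult algebra_simps)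
      then have "h t * cis (- (\<nu> * (t - b))) = cis (\<nu> * b) * g \<nu> t" for t
        by (simp add: g_def)
      then show ?thesis by (simp add: norm_mult)
    qed
    have "norm (integral {b..b + S} (\<lambda>t. h t * cis (- (\<nu> n * (t - b)))) - integral {b..b + S} (\<lambda>t. h t * cis (- (\<mu> * (t - b)))))
        \<le> (M * (\<bar>\<nu> n - \<mu>\<bar> * S)) * S"
    proof (rule norm_integral_diff_le)
      fix t assume t: "t \<in> {b..b + S}"
      have "norm (h t * cis (- (\<nu> n * (t - b))) - h t * cis (- (\<mu> * (t - b))))
          = norm (h t) * norm (cis (- (\<nu> n * (t - b))) - cis (- (\<mu> * (t - b))))"
        by (simp add: norm_mult flip: right_diff_distrib)
      also have "\<dots> \<le> M * \<bar>- (\<nu> n * (t - b)) - - (\<mu> * (t - b))\<bar>"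
        using M by (intro mult_mono norm_cis_diff_le) auto
      also have "\<bar>- (\<nu> n * (t - b)) - - (\<mu> * (t - b))\<bar> = \<bar>\<nu> n - \<mu>\<bar> * (t - b)"
      proof -
        have "- (\<nu> n * (t - b)) - - (\<mu> * (t - b)) = - ((\<nu> n - \<mu>) * (t - b))" by (simp add: algebra_simps)
        then show ?thesis using t by (simp add: abs_mult)
      qed
      also have "M * (\<bar>\<nu> n - \<mu>\<bar> * (t - b)) \<le> M * (\<bar>\<nu> n - \<mu>\<bar> * S)"
        using t M by (intro mult_left_mono) auto
      finally show "norm (h t * cis (- (\<nu> n * (t - b))) - h t * cis (- (\<mu> * (t - b)))) \<le> M * (\<bar>\<nu> n - \<mu>\<bar> * S)" .
    qed (use Sp in \<open>auto intro!: continuous_intros ch\<close>)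
    also have "(M * (\<bar>\<nu> n - \<mu>\<bar> * S)) * S \<le> (c / 2) * S"
    proof -
      have "\<bar>\<nu> n - \<mu>\<bar> * S \<le> pi / (\<kappa> * real K)"
        using small \<kappa> Kp by (simp add: TS field_simps)
      then have "M * (\<bar>\<nu> n - \<mu>\<bar> * S) \<le> M * (pi / (\<kappa> * real K))" using M by (intro mult_left_mono) auto
      also have "\<dots> \<le> c / 2" using K' by simp
      finally show ?thesis using Sp by (intro mult_right_mono) auto
    qed
    finally have "norm (integral {b..b + S} (g (\<nu> n))) \<le> norm (integral {b..b + S} (g \<mu>)) + c / 2 * S"
      using norm_triangle_ineq2[of "integral {b..b + S} (\<lambda>t. h t * cis (- (\<nu> n * (t - b))))" "integral {b..b + S} (\<lambda>t. h t * cis (- (\<mu> * (t - b))))"]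
      unfolding rot by linarith
    moreover have "norm (integral {b..b + S} (g \<mu>)) \<le> c / 4 * S" unfolding g_def by (rule T0(2)[OF S])
    moreover have "c * S > 0" using c Sp by simp
    ultimately show False using b by linarith
  qed
  then show ?thesis by blast
qed

section \<open>Riesz products and absolutely convergent series\<close>

lemma has_umean_unique:
  assumes "has_umean u c" "has_umean u c'"
  shows "c = c'"
proof (rule ccontr)
  assume "c \<noteq> c'"
  then have e: "norm (c - c') / 3 > 0" by simp
  obtain T1 where T1: "T1 > 0" "\<And>T a. T \<ge> T1 \<Longrightarrow> norm (integral {a..a + T} u - of_real T * c) \<le> norm (c - c') / 3 * T"
    using assms(1) e unfolding has_umean_def by metis
  obtain T2 where T2: "T2 > 0" "\<And>T a. T \<ge> T2 \<Longrightarrow> norm (integral {a..a + T} u - of_real T * c') \<le> norm (c - c') / 3 * T"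
    using assms(2) e unfolding has_umean_def by metis
  define T where "T = max T1 T2"
  have T: "T > 0" "T \<ge> T1" "T \<ge> T2" using T1 by (auto simp: T_def)
  have "T * norm (c - c') = norm (of_real T * c - of_real T * c')"
    using T by (simp add: norm_mult flip: right_diff_distrib)
  also have "\<dots> \<le> norm (c - c') / 3 * T + norm (c - c') / 3 * T"
  proof -
    have "of_real T * c - of_real T * c' = (integral {0..0 + T} u - of_real T * c') - (integral {0..0 + T} u - of_real T * c)"
      by simp
    also have "norm \<dots> \<le> norm (integral {0..0 + T} u - of_real T * c') + norm (integral {0..0 + T} u - of_real T * c)"
      by (rule norm_triangle_ineq4)
    finally show ?thesis using T1(2)[OF T(2), of 0] T2(2)[OF T(3), of 0] by linarith
  qed
  finally show False using T e by (simp add: field_simps)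
qed

lemma has_umean_cmult:
  assumes "has_umean u c"
  shows "has_umean (\<lambda>t. k * u t) (k * c)"
  unfolding has_umean_def
proof (intro allI impI)
  fix \<epsilon> :: real assume e: "\<epsilon> > 0"
  define e' where "e' = \<epsilon> / (norm k + 1)"
  have e': "e' > 0" using e by (simp add: e'_def add_nonneg_pos)
  then obtain T0 where T0: "T0 > 0" "\<And>T a. T \<ge> T0 \<Longrightarrow> norm (integral {a..a + T} u - of_real T * c) \<le> e' * T"
    using assms unfolding has_umean_def by metis
  have "norm (integral {a..a + T} (\<lambda>t. k * u t) - of_real T * (k * c)) \<le> \<epsilon> * T" if "T \<ge> T0" for T a
  proof -
    have "integral {a..a + T} (\<lambda>t. k * u t) - of_real T * (k * c) = k * (integral {a..a + T} u - of_real T * c)"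
      by (simp add: algebra_simps)
    then have "norm (integral {a..a + T} (\<lambda>t. k * u t) - of_real T * (k * c)) \<le> (norm k + 1) * (e' * T)"
      using T0(2)[OF that, of a] by (simp only: norm_mult) (intro mult_mono, auto)
    also have "(norm k + 1) * (e' * T) = ((norm k + 1) * e') * T" by simp
    also have "(norm k + 1) * e' = \<epsilon>" by (simp add: e'_def add_nonneg_eq_0_iff)
    finally show ?thesis .
  qed
  then show "\<exists>T0>0. \<forall>T\<ge>T0. \<forall>a. norm (integral {a..a + T} (\<lambda>t. k * u t) - of_real T * (k * c)) \<le> \<epsilon> * T"
    using T0(1) by blast
qed

lemma has_umean_uniform_limit:
  assumes cu: "continuous_on UNIV u"
    and ap: "\<And>\<epsilon>. \<epsilon> > 0 \<Longrightarrow> \<exists>v m. continuous_on UNIV v \<and> has_umean v m \<and> (\<forall>t. norm (u t - v t) \<le> \<epsilon>) \<and> norm (m - c) \<le> \<epsilon>"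
  shows "has_umean u c"
  unfolding has_umean_def
proof (intro allI impI)
  fix \<epsilon> :: real assume "\<epsilon> > 0"
  then have e: "\<epsilon> / 3 > 0" by simp
  obtain v m where v: "continuous_on UNIV v" "has_umean v m" "\<And>t. norm (u t - v t) \<le> \<epsilon>/3" "norm (m - c) \<le> \<epsilon>/3"
    using ap[OF e] by blast
  obtain T0 where T0: "T0 > 0" "\<And>T a. T \<ge> T0 \<Longrightarrow> norm (integral {a..a + T} v - of_real T * m) \<le> \<epsilon>/3 * T"
    using v(2) e unfolding has_umean_def by metis
  have "norm (integral {a..a + T} u - of_real T * c) \<le> \<epsilon> * T" if T: "T \<ge> T0" for T a
  proof -
    have Tp: "T > 0" using T T0 by linarith
    have 1: "norm (integral {a..a + T} u - integral {a..a + T} v) \<le> \<epsilon>/3 * T"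
      using Tp by (intro norm_integral_diff_le cu v) auto
    have "norm (of_real T * m - of_real T * c) = T * norm (m - c)"
      using Tp by (simp add: norm_mult flip: right_diff_distrib)
    also have "\<dots> \<le> T * (\<epsilon>/3)" using Tp v(4) by (intro mult_left_mono) auto
    finally have 2: "norm (of_real T * m - of_real T * c) \<le> T * (\<epsilon>/3)" .
    have "norm (integral {a..a + T} u - of_real T * c) \<le>
      norm (integral {a..a + T} u - integral {a..a + T} v) + norm (integral {a..a + T} v - of_real T * m)
       + norm (of_real T * m - of_real T * c)"
      using norm_triangle_ineq[of "integral {a..a + T} u - integral {a..a + T} v" "integral {a..a + T} v - of_real T * c"]
        norm_triangle_ineq[of "integral {a..a + T} v - of_real T * m" "of_real T * m - of_real T * c"] by simp
    also have "\<dots> \<le> \<epsilon>/3 * T + \<epsilon>/3 * T + T * (\<epsilon>/3)" using 1 2 T0(2)[OF T, of a] by (intro add_mono)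
    also have "\<dots> = \<epsilon> * T" by simp
    finally show ?thesis .
  qed
  then show "\<exists>T0>0. \<forall>T\<ge>T0. \<forall>a. norm (integral {a..a + T} u - of_real T * c) \<le> \<epsilon> * T" using T0(1) by blast
qed

lemma has_umean_add:
  assumes "has_umean u c" "has_umean v d" "continuous_on UNIV u" "continuous_on UNIV v"
  shows "has_umean (\<lambda>t. u t + v t) (c + d)"
  unfolding has_umean_def
proof (intro allI impI)
  fix \<epsilon> :: real assume "\<epsilon> > 0"
  then have e: "\<epsilon> / 2 > 0" by simp
  obtain T1 where T1: "T1 > 0" "\<And>T a. T \<ge> T1 \<Longrightarrow> norm (integral {a..a + T} u - of_real T * c) \<le> \<epsilon>/2 * T"
    using assms(1) e unfolding has_umean_def by metis
  obtain T2 where T2: "T2 > 0" "\<And>T a. T \<ge> T2 \<Longrightarrow> norm (integral {a..a + T} v - of_real T * d) \<le> \<epsilon>/2 * T"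
    using assms(2) e unfolding has_umean_def by metis
  have "norm (integral {a..a + T} (\<lambda>t. u t + v t) - of_real T * (c + d)) \<le> \<epsilon> * T" if "T \<ge> max T1 T2" for T a
  proof -
    have "integral {a..a + T} (\<lambda>t. u t + v t) = integral {a..a + T} u + integral {a..a + T} v"
      by (intro Henstock_Kurzweil_Integration.integral_add integrable_on_Icc_continuous assms)
    then have "integral {a..a + T} (\<lambda>t. u t + v t) - of_real T * (c + d)
      = (integral {a..a + T} u - of_real T * c) + (integral {a..a + T} v - of_real T * d)" by (simp add: algebra_simps)
    also have "norm \<dots> \<le> \<epsilon>/2 * T + \<epsilon>/2 * T"
      using that by (intro order_trans[OF norm_triangle_ineq] add_mono T1 T2) auto
    also have "\<dots> = \<epsilon> * T" by simp
    finally show ?thesis .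
  qed
  then show "\<exists>T0>0. \<forall>T\<ge>T0. \<forall>a. norm (integral {a..a + T} (\<lambda>t. u t + v t) - of_real T * (c + d)) \<le> \<epsilon> * T"
    using T1(1) by (intro exI[of _ "max T1 T2"]) auto
qed

lemma has_umean_const: "has_umean (\<lambda>_. c) c"
  unfolding has_umean_def
  by (intro allI impI exI[of _ 1]) (auto simp: scaleR_conv_of_real)

lemma has_umean_sum:
  assumes "\<And>j. j \<in> J \<Longrightarrow> has_umean (u j) (c j)" "\<And>j. j \<in> J \<Longrightarrow> continuous_on UNIV (u j)"
  shows "has_umean (\<lambda>t. \<Sum>j\<in>J. u j t) (\<Sum>j\<in>J. c j)"
proof (cases "finite J")
  case True
  then show ?thesis using assms
  proof (induction J)
    case empty
    show ?case using has_umean_const[of 0] by simp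
  next
    case (insert j J)
    then show ?case by (simp add: has_umean_add continuous_on_sum)
  qed
qed (use has_umean_const[of 0] in simp)

lemma has_umean_cis:
  "has_umean (\<lambda>t. cis (\<nu> * t)) (if \<nu> = 0 then 1 else 0)"
proof (cases "\<nu> = 0")
  case True then show ?thesis using has_umean_const[of 1] by simp
next
  case False
  have "has_umean (\<lambda>t. cis (\<nu> * t)) 0" unfolding has_umean_def
  proof (intro allI impI exI conjI)
    fix \<epsilon> :: real assume e: "\<epsilon> > 0"
    show "2 / (\<bar>\<nu>\<bar> * \<epsilon>) > 0" using e False by simp
    fix T a assume T: "2 / (\<bar>\<nu>\<bar> * \<epsilon>) \<le> T"
    have Tp: "T > 0" using T \<open>2 / (\<bar>\<nu>\<bar> * \<epsilon>) > 0\<close> by linarith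
    have "norm (integral {a..a + T} (\<lambda>t. cis (\<nu> * t))) = norm (cis (\<nu> * (a + T)) - cis (\<nu> * a)) / \<bar>\<nu>\<bar>"
      using False Tp by (subst integral_cis) (auto simp: norm_divide norm_mult)
    also have "\<dots> \<le> (1 + 1) / \<bar>\<nu>\<bar>"
      by (intro divide_right_mono order_trans[OF norm_triangle_ineq4]) auto
    also have "\<dots> \<le> \<epsilon> * T" using T e False by (simp add: field_simps)
    finally show "norm (integral {a..a + T} (\<lambda>t. cis (\<nu> * t)) - of_real T * 0) \<le> \<epsilon> * T" by simp
  qed
  then show ?thesis using False by simp
qed

text \<open>A bound in mean rather than in supremum: the majorant may be huge at places. This is how
  a Riesz product, which grows with the number of factors but keeps mean 1, yields a bound that does
  not grow with \<open>J\<close>.\<close>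

lemma norm_umean_le:
  fixes v :: "real \<Rightarrow> real"
  assumes u: "has_umean u c" "continuous_on UNIV u"
    and v: "has_umean (\<lambda>t. of_real (v t)) (of_real m)" "continuous_on UNIV v"
    and le: "\<And>t. norm (u t) \<le> K * v t" and K: "K \<ge> 0"
  shows "norm c \<le> K * m"
proof (rule field_le_epsilon)
  fix e :: real assume e: "e > 0"
  define \<epsilon> where "\<epsilon> = e / (K + 1)"
  have \<epsilon>: "\<epsilon> > 0" using e K by (simp add: \<epsilon>_def)
  obtain T1 where T1: "T1 > 0" "\<And>T a. T \<ge> T1 \<Longrightarrow> norm (integral {a..a + T} u - of_real T * c) \<le> \<epsilon> * T"
    using u(1) \<epsilon> unfolding has_umean_def by metis
  obtain T2 where T2: "T2 > 0"
    "\<And>T a. T \<ge> T2 \<Longrightarrow> norm (integral {a..a + T} (\<lambda>t. of_real (v t)) - of_real T * (of_real m :: complex)) \<le> \<epsilon> * T"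
    using v(1) \<epsilon> unfolding has_umean_def by metis
  define T where "T = max T1 T2"
  have T: "T > 0" "T \<ge> T1" "T \<ge> T2" using T1 by (auto simp: T_def)
  have iv: "v integrable_on {0..0 + T}"
    by (intro integrable_continuous_real continuous_on_subset[OF v(2)]) auto
  have "integral {0..0 + T} (\<lambda>t. of_real (v t)) = (of_real (integral {0..0 + T} v) :: complex)"
    by (intro integral_unique has_integral_of_real integrable_integral iv)
  then have "norm (complex_of_real (integral {0..0 + T} v - T * m)) \<le> \<epsilon> * T"
    using T2(2)[OF T(3), of 0] by simp
  then have iv': "integral {0..0 + T} v \<le> T * m + \<epsilon> * T" unfolding norm_of_real by linarith
  have "norm (integral {0..0 + T} u) \<le> integral {0..0 + T} (\<lambda>t. K * v t)"
    using le by (intro integral_norm_bound_integral integrable_on_Icc_continuous u integrable_on_mult_right iv)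
  also have "\<dots> = K * integral {0..0 + T} v" by simp
  also have "\<dots> \<le> K * (T * m + \<epsilon> * T)" using iv' K by (intro mult_left_mono)
  finally have "norm (of_real T * c) \<le> K * (T * m + \<epsilon> * T) + \<epsilon> * T"
    using T1(2)[OF T(2), of 0] norm_triangle_ineq4[of "integral {0..0 + T} u" "integral {0..0 + T} u - of_real T * c"]
    by simp
  then have "T * norm c \<le> T * (K * m + (K + 1) * \<epsilon>)" using T by (simp add: norm_mult algebra_simps)
  then have "norm c \<le> K * m + (K + 1) * \<epsilon>" using T by (simp add: mult_le_cancel_left)
  also have "(K + 1) * \<epsilon> = e" using K by (simp add: \<epsilon>_def)
  finally show "norm c \<le> K * m + e" .
qed

section \<open>Integer independence and Riesz products\<close>

definition int_independent :: "real set \<Rightarrow> bool" where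
  "int_independent \<Lambda> \<longleftrightarrow> (\<forall>J k. finite J \<longrightarrow> J \<subseteq> \<Lambda> \<longrightarrow> (\<Sum>j\<in>J. of_int (k j) * j) = 0 \<longrightarrow> (\<forall>j\<in>J. k j = 0))"

text \<open>Nonnegative factors make the mean of the product equal to the mean of its absolute
  value, and multiplied out it has only frequencies with coefficients -1, 0, 1 over
  \<open>J\<close>. The phases \<phi> allow each coefficient of \<open>h\<close> to be rotated
  separately.\<close>

definition riesz :: "(real \<Rightarrow> real) \<Rightarrow> real set \<Rightarrow> real \<Rightarrow> real" where
  "riesz \<phi> J t = (\<Prod>j\<in>J. 1 + cos (j * t + \<phi> j))"

lemma continuous_riesz [continuous_intros]: "continuous_on A (riesz \<phi> J)"
  unfolding riesz_def by (intro continuous_intros)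

lemma riesz_nonneg: "riesz \<phi> J t \<ge> 0"
proof -
  have "0 \<le> 1 + cos x" for x :: real using cos_ge_minus_one[of x] by linarith
  then show ?thesis unfolding riesz_def by (intro prod_nonneg) blast
qed

text \<open>Euler's formula turns the new cosine into two shifted frequencies; the product over
  \<open>J\<close> reappears in all three terms, which drives the inductions below.\<close>

lemma riesz_insert:
  assumes "finite J" "\<kappa> \<notin> J"
  shows "of_real (riesz \<phi> (insert \<kappa> J) t) * cis (- (\<nu> * t)) =
     of_real (riesz \<phi> J t) * cis (- (\<nu> * t))
     + (cis (\<phi> \<kappa>) / 2 * (of_real (riesz \<phi> J t) * cis (- ((\<nu> - \<kappa>) * t)))
     + cis (- \<phi> \<kappa>) / 2 * (of_real (riesz \<phi> J t) * cis (- ((\<nu> + \<kappa>) * t))))"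
proof -
  have "complex_of_real (cos x) = (cis x + cis (- x)) / 2" for x
    by (simp add: complex_eq_iff)
  then have "complex_of_real (cos (\<kappa> * t + \<phi> \<kappa>)) = (cis (\<kappa> * t + \<phi> \<kappa>) + cis (- (\<kappa> * t + \<phi> \<kappa>))) / 2" .
  moreover have "cis (\<kappa> * t + \<phi> \<kappa>) * cis (- (\<nu> * t)) = cis (\<phi> \<kappa>) * cis (- ((\<nu> - \<kappa>) * t))"
    "cis (- (\<kappa> * t + \<phi> \<kappa>)) * cis (- (\<nu> * t)) = cis (- \<phi> \<kappa>) * cis (- ((\<nu> + \<kappa>) * t))"
    by (simp_all add: cis_mult algebra_simps)
  ultimately have "complex_of_real (cos (\<kappa> * t + \<phi> \<kappa>)) * cis (- (\<nu> * t)) =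
    cis (\<phi> \<kappa>) / 2 * cis (- ((\<nu> - \<kappa>) * t)) + cis (- \<phi> \<kappa>) / 2 * cis (- ((\<nu> + \<kappa>) * t))"
    by (simp add: add_divide_distrib distrib_right)
  moreover have "riesz \<phi> (insert \<kappa> J) t = (1 + cos (\<kappa> * t + \<phi> \<kappa>)) * riesz \<phi> J t"
    using assms by (simp add: riesz_def)
  then have "of_real (riesz \<phi> (insert \<kappa> J) t) * cis (- (\<nu> * t)) = of_real (riesz \<phi> J t) * cis (- (\<nu> * t))
      + of_real (riesz \<phi> J t) * (complex_of_real (cos (\<kappa> * t + \<phi> \<kappa>)) * cis (- (\<nu> * t)))"
    by (simp add: algebra_simps)
  moreover have "r * (A * B + C * D) = A * (r * B) + C * (r * D)" for r A B C D :: complex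
    by (simp add: algebra_simps)
  ultimately show ?thesis by (simp only:)
qed

lemma umean_riesz_insert:
  assumes J: "finite J" "\<kappa> \<notin> J" and ch: "continuous_on UNIV h"
    and "has_umean (\<lambda>t. h t * (of_real (riesz \<phi> J t) * cis (- (\<nu> * t)))) b"
    and "has_umean (\<lambda>t. h t * (of_real (riesz \<phi> J t) * cis (- ((\<nu> - \<kappa>) * t)))) b1"
    and "has_umean (\<lambda>t. h t * (of_real (riesz \<phi> J t) * cis (- ((\<nu> + \<kappa>) * t)))) b2"
  shows "has_umean (\<lambda>t. h t * (of_real (riesz \<phi> (insert \<kappa> J) t) * cis (- (\<nu> * t))))
    (b + (cis (\<phi> \<kappa>) / 2 * b1 + cis (- \<phi> \<kappa>) / 2 * b2))"
proof -
  have c: "continuous_on UNIV (\<lambda>t. h t * (of_real (riesz \<phi> J t) * cis (- (\<nu> * t))))" for \<nu>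
    by (intro continuous_intros ch)
  have "has_umean (\<lambda>t. h t * (of_real (riesz \<phi> J t) * cis (- (\<nu> * t)))
      + (cis (\<phi> \<kappa>) / 2 * (h t * (of_real (riesz \<phi> J t) * cis (- ((\<nu> - \<kappa>) * t))))
       + cis (- \<phi> \<kappa>) / 2 * (h t * (of_real (riesz \<phi> J t) * cis (- ((\<nu> + \<kappa>) * t))))))
      (b + (cis (\<phi> \<kappa>) / 2 * b1 + cis (- \<phi> \<kappa>) / 2 * b2))"
    by (intro has_umean_add has_umean_cmult assms c continuous_on_mult continuous_on_const continuous_on_add)
  moreover have "h t * (of_real (riesz \<phi> J t) * cis (- (\<nu> * t)))
      + (cis (\<phi> \<kappa>) / 2 * (h t * (of_real (riesz \<phi> J t) * cis (- ((\<nu> - \<kappa>) * t))))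
       + cis (- \<phi> \<kappa>) / 2 * (h t * (of_real (riesz \<phi> J t) * cis (- ((\<nu> + \<kappa>) * t)))))
     = h t * (of_real (riesz \<phi> (insert \<kappa> J) t) * cis (- (\<nu> * t)))" for t
    unfolding riesz_insert[OF J] by (simp add: algebra_simps)
  ultimately show ?thesis by (simp only:)
qed

text \<open>Multiplied out, the product tests \<open>h\<close> at \<nu> and at frequencies that
  differ from it by integer combinations of \<open>J\<close>; the last assumption removes all
  nontrivial ones. The induction generalises \<nu> because each factor shifts it.\<close>

lemma umean_riesz:
  assumes ch: "continuous_on UNIV h" and a: "\<And>\<nu>. has_umean (\<lambda>t. h t * cis (- (\<nu> * t))) (a \<nu>)"
    and "finite J"
    and "\<And>k. (\<exists>j\<in>J. k j \<noteq> 0) \<Longrightarrow> a (\<nu> + (\<Sum>j\<in>J. of_int (k j) * j)) = 0"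
  shows "has_umean (\<lambda>t. h t * (of_real (riesz \<phi> J t) * cis (- (\<nu> * t)))) (a \<nu>)"
  using assms(3,4)
proof (induction J arbitrary: \<nu>)
  case empty
  then show ?case using a by (simp add: riesz_def)
next
  case (insert \<kappa> J)
  have ex: "a (\<nu> + (of_int m * \<kappa> + (\<Sum>j\<in>J. of_int (k j) * j))) = 0" if "m \<noteq> 0 \<or> (\<exists>j\<in>J. k j \<noteq> 0)" for k m
  proof -
    have "(\<Sum>j\<in>insert \<kappa> J. of_int ((k(\<kappa> := m)) j) * j) = of_int m * \<kappa> + (\<Sum>j\<in>J. of_int (k j) * j)"
      using insert.hyps by (simp, intro sum.cong) auto
    moreover have "\<exists>j\<in>insert \<kappa> J. (k(\<kappa> := m)) j \<noteq> 0" using that insert.hyps by auto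
    ultimately show ?thesis using insert.prems[of "k(\<kappa> := m)"] by simp
  qed
  have m0: "has_umean (\<lambda>t. h t * (of_real (riesz \<phi> J t) * cis (- (\<nu> * t)))) (a \<nu>)"
    using ex[of 0] by (intro insert.IH) auto
  have m1: "has_umean (\<lambda>t. h t * (of_real (riesz \<phi> J t) * cis (- ((\<nu> - \<kappa>) * t)))) (a (\<nu> - \<kappa>))"
    using ex[of "-1"] by (intro insert.IH) (auto simp: algebra_simps)
  have m2: "has_umean (\<lambda>t. h t * (of_real (riesz \<phi> J t) * cis (- ((\<nu> + \<kappa>) * t)))) (a (\<nu> + \<kappa>))"
    using ex[of 1] by (intro insert.IH) (auto simp: algebra_simps)
  have "a (\<nu> - \<kappa>) = 0" using ex[of "-1" "\<lambda>_. 0"] by simp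
  moreover have "a (\<nu> + \<kappa>) = 0" using ex[of 1 "\<lambda>_. 0"] by simp
  ultimately show ?case
    using umean_riesz_insert[OF insert.hyps ch m0 m1 m2] by simp
qed

lemma int_independentD:
  assumes "int_independent \<Lambda>" "finite J" "J \<subseteq> \<Lambda>" "(\<Sum>j\<in>J. of_int (k j) * j) = 0" "j \<in> J"
  shows "k j = 0"
  using assms unfolding int_independent_def by blast

text \<open>The Riesz product with phases \<open>\<phi> j = Arg (a j)\<close> has mean 1 and, by independence, picks out
  exactly the coefficients \<open>a j / 2\<close> rotated onto the positive axis.\<close>
lemma sum_coefficients_le:
  assumes ch: "continuous_on UNIV h" and a: "\<And>\<nu>. has_umean (\<lambda>t. h t * cis (- (\<nu> * t))) (a \<nu>)"
    and ind: "int_independent {\<nu>. a \<nu> \<noteq> 0}" and J: "finite J" "J \<subseteq> {\<nu>. a \<nu> \<noteq> 0}"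
    and M: "\<And>t. norm (h t) \<le> M"
  shows "(\<Sum>j\<in>J. norm (a j)) \<le> 2 * M"
proof -
  define \<phi> where "\<phi> = (\<lambda>j. Arg (a j))"
  \<comment> \<open>A nonzero coefficient here would be a relation between elements of the spectrum.
    For \<open>m = 1\<close> the combination over \<open>I\<close> must be nontrivial, since
    \<kappa> alone does lie in the spectrum.\<close>
  have rel: "a (of_int m * \<kappa> + (\<Sum>j\<in>I. of_int (k j) * j)) = 0"
    if I: "finite I" "I \<subseteq> {\<nu>. a \<nu> \<noteq> 0}" "\<kappa> \<notin> I" "a \<kappa> \<noteq> 0" and m: "m < 0 \<or> m = 1 \<and> (\<exists>j\<in>I. k j \<noteq> 0)" for I \<kappa> m k
  proof (rule ccontr)
    define \<mu> where "\<mu> = of_int m * \<kappa> + (\<Sum>j\<in>I. of_int (k j) * j)"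
    assume "a (of_int m * \<kappa> + (\<Sum>j\<in>I. of_int (k j) * j)) \<noteq> 0"
    then have \<mu>: "a \<mu> \<noteq> 0" by (simp add: \<mu>_def)
    define X where "X = insert \<mu> (insert \<kappa> I)"
    \<comment> \<open>The relation \<mu> minus \<open>m * \<kappa>\<close> minus the combination
      over \<open>I\<close>, with coefficients added up pointwise because \<mu> may coincide with
      \<kappa> or lie in \<open>I\<close>.\<close>
    define K where "K = (\<lambda>x. (if x = \<mu> then 1 else 0) - (if x = \<kappa> then m else 0) - (if x \<in> I then k x else 0))"
    have fX: "finite X" using I by (simp add: X_def)
    have "(\<Sum>x\<in>X. of_int (K x) * x) =
        (\<Sum>x\<in>X. if x = \<mu> then x else 0) - (\<Sum>x\<in>X. if x = \<kappa> then of_int m * x else 0) - (\<Sum>x\<in>X. if x \<in> I then of_int (k x) * x else 0)"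
      unfolding sum_subtractf[symmetric] by (intro sum.cong) (auto simp: K_def algebra_simps)
    also have "(\<Sum>x\<in>X. if x = \<mu> then x else 0) = \<mu>" using fX by (simp add: X_def)
    also have "(\<Sum>x\<in>X. if x = \<kappa> then of_int m * x else 0) = of_int m * \<kappa>" using fX by (simp add: X_def)
    also have "(\<Sum>x\<in>X. if x \<in> I then of_int (k x) * x else 0) = (\<Sum>x\<in>I. of_int (k x) * x)"
      using fX by (intro sum.mono_neutral_cong_right) (auto simp: X_def)
    finally have "(\<Sum>x\<in>X. of_int (K x) * x) = 0" by (simp add: \<mu>_def)
    then have K0: "K x = 0" if "x \<in> X" for x
      using int_independentD[OF ind fX _ _ that] I \<mu> by (auto simp: X_def)
    \<comment> \<open>As \<kappa> is not in \<open>I\<close>, this coefficient is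
      \<open>1 - m\<close> if \<open>\<mu> = \<kappa>\<close> and \<open>- m\<close> otherwise; for
      \<open>m\<close> negative or 1 it vanishes only if \<open>\<mu> = \<kappa>\<close> and
      \<open>m = 1\<close>.\<close>
    have "K \<kappa> = 0" by (rule K0) (simp add: X_def)
    then have "\<mu> = \<kappa>" "m = 1" using I(3) m by (auto simp: K_def split: if_splits)
    then obtain j where j: "j \<in> I" "k j \<noteq> 0" using m by auto
    have "K j = 0" using j by (intro K0) (simp add: X_def)
    moreover have "j \<noteq> \<kappa>" using j I(3) by auto
    ultimately show False using j \<open>\<mu> = \<kappa>\<close> by (simp add: K_def)
  qed
  have a0: "a 0 = 0"
  proof (rule ccontr)
    assume "a 0 \<noteq> 0"
    then have "(1::int) = 0" by (intro int_independentD[OF ind, of "{0}" "\<lambda>_. 1" 0]) auto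
    then show False by simp
  qed
  \<comment> \<open>At frequency 0 the new factor adds only the coefficient at \<kappa>, since the
    one at \<open>- \<kappa>\<close> vanishes by independence; the phase turns the addition into
    \<open>norm (a \<kappa>) / 2\<close>.\<close>
  have mu: "has_umean (\<lambda>t. h t * (of_real (riesz \<phi> J t) * cis (- (0 * t)))) (\<Sum>j\<in>J. of_real (norm (a j)) / 2)"
    using J
  proof (induction J)
    case empty
    show ?case using a[of 0] by (simp add: riesz_def a0)
  next
    case (insert \<kappa> J)
    have I: "finite J" "J \<subseteq> {\<nu>. a \<nu> \<noteq> 0}" "\<kappa> \<notin> J" "a \<kappa> \<noteq> 0" using insert by auto
    have m1: "has_umean (\<lambda>t. h t * (of_real (riesz \<phi> J t) * cis (- ((0 - \<kappa>) * t)))) (a (0 - \<kappa>))"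
      using rel[OF I, of "-1"] by (intro umean_riesz[OF ch a I(1)]) auto
    have m2: "has_umean (\<lambda>t. h t * (of_real (riesz \<phi> J t) * cis (- ((0 + \<kappa>) * t)))) (a (0 + \<kappa>))"
      using rel[OF I, of 1] by (intro umean_riesz[OF ch a I(1)]) auto
    have m0: "has_umean (\<lambda>t. h t * (of_real (riesz \<phi> J t) * cis (- (0 * t)))) (\<Sum>j\<in>J. of_real (norm (a j)) / 2)"
      using insert by auto
    have "a (0 - \<kappa>) = 0" using rel[OF I, of "-1" "\<lambda>_. 0"] by simp
    moreover have "cis (- \<phi> \<kappa>) * a \<kappa> = of_real (norm (a \<kappa>))"
    proof -
      have "a \<kappa> = of_real (norm (a \<kappa>)) * cis (\<phi> \<kappa>)" unfolding \<phi>_def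
        by (metis rcis_cmod_Arg rcis_def)
      then have "cis (- \<phi> \<kappa>) * a \<kappa> = of_real (norm (a \<kappa>)) * (cis (- \<phi> \<kappa>) * cis (\<phi> \<kappa>))" by (metis mult.left_commute)
      then show ?thesis by (simp add: cis_mult)
    qed
    ultimately show ?case
      using umean_riesz_insert[OF insert.hyps ch m0 m1 m2] insert.hyps by (simp add: add.commute)
  qed
  \<comment> \<open>The constant function 1, whose only nonzero coefficient sits at 0, takes the
    place of \<open>h\<close>: this gives the mean of the Riesz product itself.\<close>
  have "has_umean (\<lambda>t. 1 * (of_real (riesz \<phi> J t) * cis (- (0 * t)))) (if (0::real) = 0 then 1 else 0)"
  proof (rule umean_riesz[where a = "\<lambda>\<nu>::real. if \<nu> = 0 then 1 else 0"])
    fix \<nu> show "has_umean (\<lambda>t. 1 * cis (- (\<nu> * t))) (if \<nu> = 0 then 1 else 0)"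
      using has_umean_cis[of "-\<nu>"] by simp
  next
    fix k :: "real \<Rightarrow> int" assume "\<exists>j\<in>J. k j \<noteq> 0"
    then have "(\<Sum>j\<in>J. of_int (k j) * j) \<noteq> 0" using int_independentD[OF ind J] by blast
    then show "(if 0 + (\<Sum>j\<in>J. real_of_int (k j) * j) = 0 then 1 else 0 :: complex) = 0" by simp
  qed (use J in auto)
  then have mP: "has_umean (\<lambda>t. of_real (riesz \<phi> J t)) (of_real 1)" by simp
  have le: "norm (h t * (of_real (riesz \<phi> J t) * cis (- (0 * t)))) \<le> M * riesz \<phi> J t" for t
    using M[of t] riesz_nonneg[of \<phi> J t] by (simp add: norm_mult mult_right_mono)
  have M0: "M \<ge> 0" using M[of 0] norm_ge_zero order_trans by blast
  have "norm (\<Sum>j\<in>J. complex_of_real (norm (a j)) / 2) \<le> M * 1"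
    by (rule norm_umean_le[OF mu _ mP _ le M0]) (intro continuous_intros ch)+
  moreover have "(\<Sum>j\<in>J. complex_of_real (norm (a j)) / 2) = of_real ((\<Sum>j\<in>J. norm (a j)) / 2)"
    by (simp add: sum_divide_distrib)
  moreover have "(\<Sum>j\<in>J. norm (a j)) \<ge> 0" by (intro sum_nonneg) auto
  ultimately show ?thesis by (simp only: norm_of_real)
qed

section \<open>Absolutely convergent trigonometric series\<close>

lemma abs_summable_tail:
  fixes a :: "'a \<Rightarrow> real"
  assumes "a summable_on \<Lambda>" "\<And>x. x \<in> \<Lambda> \<Longrightarrow> a x \<ge> 0" "e > 0"
  obtains J where "finite J" "J \<subseteq> \<Lambda>" "infsum a (\<Lambda> - J) \<le> e"
proof -
  obtain J where J: "finite J" "J \<subseteq> \<Lambda>" "dist (sum a J) (infsum a \<Lambda>) \<le> e"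
    using infsum_finite_approximation[OF assms(1,3)] by blast
  have "infsum a \<Lambda> = infsum a (J \<union> (\<Lambda> - J))" using J(2) by (simp add: Un_absorb1)
  also have "\<dots> = infsum a J + infsum a (\<Lambda> - J)"
    using J by (intro infsum_Un_disjoint summable_on_subset[OF assms(1)]) auto
  finally show ?thesis using J that[of J] by (simp add: dist_real_def)
qed

lemma norm_infsum_diff_sum_le:
  fixes f :: "'a \<Rightarrow> complex"
  assumes "g summable_on \<Lambda>" "\<And>x. x \<in> \<Lambda> \<Longrightarrow> norm (f x) \<le> g x" "finite J" "J \<subseteq> \<Lambda>"
  shows "norm (infsum f \<Lambda> - sum f J) \<le> infsum g (\<Lambda> - J)"
proof -
  have abs: "(\<lambda>x. norm (f x)) summable_on A" if "A \<subseteq> \<Lambda>" for A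
    by (rule Infinite_Sum.abs_summable_on_comparison_test'[OF summable_on_subset[OF assms(1) that]])
      (use that assms(2) in blast)
  have JD: "J \<subseteq> \<Lambda>" "\<Lambda> - J \<subseteq> \<Lambda>" using assms(4) by auto
  note sm = Infinite_Sum.abs_summable_summable[OF abs[OF JD(1)]] Infinite_Sum.abs_summable_summable[OF abs[OF JD(2)]]
  have "infsum f \<Lambda> = infsum f (J \<union> (\<Lambda> - J))" using JD by (simp add: Un_absorb1)
  also have "\<dots> = infsum f J + infsum f (\<Lambda> - J)"
    by (rule infsum_Un_disjoint[OF sm]) auto
  finally have "infsum f \<Lambda> - sum f J = infsum f (\<Lambda> - J)" using assms(3) by simp
  also have "norm \<dots> \<le> infsum (\<lambda>x. norm (f x)) (\<Lambda> - J)" by (rule norm_infsum_bound[OF abs[OF JD(2)]])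
  also have "\<dots> \<le> infsum g (\<Lambda> - J)"
    by (rule infsum_mono[OF abs[OF JD(2)] summable_on_subset[OF assms(1) JD(2)]]) (use assms(2) in blast)
  finally show ?thesis .
qed

lemma trig_series_approx:
  fixes a :: "real \<Rightarrow> complex"
  assumes "(\<lambda>\<nu>. norm (a \<nu>)) summable_on \<Lambda>" "\<epsilon> > 0"
  shows "\<exists>J. finite J \<and> J \<subseteq> \<Lambda> \<and> infsum (\<lambda>\<nu>. norm (a \<nu>)) (\<Lambda> - J) \<le> \<epsilon> \<and>
    (\<forall>t. norm (infsum (\<lambda>\<nu>. a \<nu> * cis (\<nu> * t)) \<Lambda> - (\<Sum>\<nu>\<in>J. a \<nu> * cis (\<nu> * t))) \<le> \<epsilon>)"
proof -
  obtain J where J: "finite J" "J \<subseteq> \<Lambda>" "infsum (\<lambda>\<nu>. norm (a \<nu>)) (\<Lambda> - J) \<le> \<epsilon>"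
    using abs_summable_tail[OF assms(1) _ assms(2)] by auto
  moreover have "norm (infsum (\<lambda>\<nu>. a \<nu> * cis (\<nu> * t)) \<Lambda> - (\<Sum>\<nu>\<in>J. a \<nu> * cis (\<nu> * t))) \<le> \<epsilon>" for t
    by (rule order_trans[OF norm_infsum_diff_sum_le[OF assms(1) _ J(1,2)] J(3)]) (simp add: norm_mult)
  ultimately show ?thesis by (intro exI conjI allI)
qed

lemma continuous_trig_series:
  assumes "(\<lambda>\<nu>. norm (a \<nu>)) summable_on \<Lambda>"
  shows "continuous_on UNIV (\<lambda>t. infsum (\<lambda>\<nu>. a \<nu> * cis (\<nu> * t)) \<Lambda>)"
proof -
  have ex: "\<forall>n. \<exists>J. \<forall>t. norm (infsum (\<lambda>\<nu>. a \<nu> * cis (\<nu> * t)) \<Lambda> - (\<Sum>\<nu>\<in>J. a \<nu> * cis (\<nu> * t))) \<le> inverse (real (Suc n))"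
  proof
    fix n
    have "inverse (real (Suc n)) > 0" by simp
    from trig_series_approx[OF assms this]
    show "\<exists>J. \<forall>t. norm (infsum (\<lambda>\<nu>. a \<nu> * cis (\<nu> * t)) \<Lambda> - (\<Sum>\<nu>\<in>J. a \<nu> * cis (\<nu> * t))) \<le> inverse (real (Suc n))"
      by (elim exE conjE) (rule exI)
  qed
  from choice[OF ex] obtain J where J:
    "\<forall>n t. norm (infsum (\<lambda>\<nu>. a \<nu> * cis (\<nu> * t)) \<Lambda> - (\<Sum>\<nu>\<in>J n. a \<nu> * cis (\<nu> * t))) \<le> inverse (real (Suc n))"
    by (rule exE)
  show ?thesis
  proof (rule uniform_limit_theorem[where F = sequentially and f = "\<lambda>n t. \<Sum>\<nu>\<in>J n. a \<nu> * cis (\<nu> * t)"])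
    show "uniform_limit UNIV (\<lambda>n t. \<Sum>\<nu>\<in>J n. a \<nu> * cis (\<nu> * t)) (\<lambda>t. infsum (\<lambda>\<nu>. a \<nu> * cis (\<nu> * t)) \<Lambda>) sequentially"
    proof (rule uniform_limitI)
      fix e :: real assume "e > 0"
      then have "eventually (\<lambda>n. inverse (real (Suc n)) < e) sequentially"
        using LIMSEQ_inverse_real_of_nat by (rule order_tendstoD(2)[rotated])
      then show "\<forall>\<^sub>F n in sequentially. \<forall>t\<in>UNIV. dist (\<Sum>\<nu>\<in>J n. a \<nu> * cis (\<nu> * t)) (infsum (\<lambda>\<nu>. a \<nu> * cis (\<nu> * t)) \<Lambda>) < e"
      proof (rule eventually_mono)
        fix n assume n: "inverse (real (Suc n)) < e"
        show "\<forall>t\<in>UNIV. dist (\<Sum>\<nu>\<in>J n. a \<nu> * cis (\<nu> * t)) (infsum (\<lambda>\<nu>. a \<nu> * cis (\<nu> * t)) \<Lambda>) < e"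
        proof
          fix t
          show "dist (\<Sum>\<nu>\<in>J n. a \<nu> * cis (\<nu> * t)) (infsum (\<lambda>\<nu>. a \<nu> * cis (\<nu> * t)) \<Lambda>) < e"
            using le_less_trans[OF J[rule_format, of t n] n] unfolding dist_norm by (subst norm_minus_commute)
        qed
      qed
    qed
  next
    show "\<forall>\<^sub>F n in sequentially. continuous_on UNIV (\<lambda>t. \<Sum>\<nu>\<in>J n. a \<nu> * cis (\<nu> * t))"
      by (intro always_eventually allI continuous_intros)
  qed simp
qed

lemma umean_trig_series:
  assumes "(\<lambda>\<nu>. norm (a \<nu>)) summable_on \<Lambda>"
  shows "has_umean (\<lambda>t. infsum (\<lambda>\<nu>. a \<nu> * cis (\<nu> * t)) \<Lambda> * cis (- (\<mu> * t))) (if \<mu> \<in> \<Lambda> then a \<mu> else 0)"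
proof (rule has_umean_uniform_limit)
  show "continuous_on UNIV (\<lambda>t. infsum (\<lambda>\<nu>. a \<nu> * cis (\<nu> * t)) \<Lambda> * cis (- (\<mu> * t)))"
    by (intro continuous_intros continuous_trig_series assms)
  fix \<epsilon> :: real assume \<epsilon>: "\<epsilon> > 0"
  from trig_series_approx[OF assms \<epsilon>] obtain J where J: "finite J" "J \<subseteq> \<Lambda>"
    "infsum (\<lambda>\<nu>. norm (a \<nu>)) (\<Lambda> - J) \<le> \<epsilon>"
    and ap: "\<forall>t. norm (infsum (\<lambda>\<nu>. a \<nu> * cis (\<nu> * t)) \<Lambda> - (\<Sum>\<nu>\<in>J. a \<nu> * cis (\<nu> * t))) \<le> \<epsilon>"
    by (elim exE conjE)
  have m: "has_umean (\<lambda>t. \<Sum>\<nu>\<in>J. a \<nu> * cis ((\<nu> - \<mu>) * t)) (\<Sum>\<nu>\<in>J. a \<nu> * (if \<nu> - \<mu> = 0 then 1 else 0))"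
    by (intro has_umean_sum has_umean_cmult has_umean_cis continuous_intros)
  have me: "(\<Sum>\<nu>\<in>J. a \<nu> * (if \<nu> - \<mu> = 0 then 1 else 0)) = (if \<mu> \<in> J then a \<mu> else 0)"
    using J(1) by (simp add: if_distrib cong: if_cong)
  have ne: "norm ((if \<mu> \<in> J then a \<mu> else 0) - (if \<mu> \<in> \<Lambda> then a \<mu> else 0)) \<le> \<epsilon>"
  proof (cases "\<mu> \<in> \<Lambda> - J")
    case True
    then have "(\<Sum>\<nu>\<in>{\<mu>}. norm (a \<nu>)) \<le> infsum (\<lambda>\<nu>. norm (a \<nu>)) (\<Lambda> - J)"
      by (intro finite_sum_le_infsum summable_on_subset[OF assms]) auto
    then show ?thesis using True J(3) by simp
  next
    case False then show ?thesis using J(2) \<epsilon> by auto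
  qed
  have app: "norm (infsum (\<lambda>\<nu>. a \<nu> * cis (\<nu> * t)) \<Lambda> * cis (- (\<mu> * t)) - (\<Sum>\<nu>\<in>J. a \<nu> * cis ((\<nu> - \<mu>) * t))) \<le> \<epsilon>" for t
  proof -
    have "(\<Sum>\<nu>\<in>J. a \<nu> * cis ((\<nu> - \<mu>) * t)) = (\<Sum>\<nu>\<in>J. a \<nu> * cis (\<nu> * t)) * cis (- (\<mu> * t))"
      unfolding sum_distrib_right by (intro sum.cong) (auto simp: cis_mult algebra_simps)
    then show ?thesis using ap[rule_format, of t] by (simp add: norm_mult flip: left_diff_distrib)
  qed
  have cv: "continuous_on UNIV (\<lambda>t. \<Sum>\<nu>\<in>J. a \<nu> * cis ((\<nu> - \<mu>) * t))" by (intro continuous_intros)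
  show "\<exists>v m. continuous_on UNIV v \<and> has_umean v m \<and>
      (\<forall>t. norm (infsum (\<lambda>\<nu>. a \<nu> * cis (\<nu> * t)) \<Lambda> * cis (- (\<mu> * t)) - v t) \<le> \<epsilon>) \<and>
      norm (m - (if \<mu> \<in> \<Lambda> then a \<mu> else 0)) \<le> \<epsilon>" using cv m[unfolded me] app ne by (intro exI conjI allI)
qed

text \<open>By the dichotomy every oscillation with nonzero coefficient is dominated by
  \<open>F\<close>, hence so is the sum of the series, and \<open>F\<close> minus the series is
  again almost periodic. All its means against oscillations vanish, so
  \<open>bohr_ap_exists_frequency\<close> makes it zero.\<close>

theorem bohr_ap_series:
  assumes F: "bohr_ap F" and a: "\<And>\<nu>. has_umean (\<lambda>t. F t * cis (- (\<nu> * t))) (a \<nu>)"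
    and ind: "int_independent {\<nu>. a \<nu> \<noteq> 0}"
  shows "(\<lambda>\<nu>. norm (a \<nu>)) summable_on {\<nu>. a \<nu> \<noteq> 0}"
    and "F t = infsum (\<lambda>\<nu>. a \<nu> * cis (\<nu> * t)) {\<nu>. a \<nu> \<noteq> 0}"
proof -
  define \<Lambda> where "\<Lambda> = {\<nu>. a \<nu> \<noteq> 0}"
  have cF: "continuous_on UNIV F" using F by (rule bohr_ap_continuous)
  obtain M where M: "\<And>t. norm (F t) \<le> M" using bohr_ap_bounded[OF F] by blast
  have "bdd_above (sum (\<lambda>\<nu>. norm (a \<nu>)) ` {J. J \<subseteq> \<Lambda> \<and> finite J})"
    using sum_coefficients_le[OF cF a ind _ _ M] by (intro bdd_aboveI2[of _ _ "2 * M"]) (auto simp: \<Lambda>_def)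
  then have sm: "(\<lambda>\<nu>. norm (a \<nu>)) summable_on \<Lambda>" by (intro nonneg_bdd_above_summable_on) auto
  then show "(\<lambda>\<nu>. norm (a \<nu>)) summable_on {\<nu>. a \<nu> \<noteq> 0}" by (simp add: \<Lambda>_def)
  define g where "g = (\<lambda>t. infsum (\<lambda>\<nu>. a \<nu> * cis (\<nu> * t)) \<Lambda>)"
  have cg: "continuous_on UNIV g" unfolding g_def by (rule continuous_trig_series[OF sm])
  have dg: "dominated F g"
  proof (rule dominated_uniform_limit)
    fix \<epsilon> :: real assume "\<epsilon> > 0"
    from trig_series_approx[OF sm this] obtain J where "finite J" and J: "J \<subseteq> \<Lambda>"
      and "infsum (\<lambda>\<nu>. norm (a \<nu>)) (\<Lambda> - J) \<le> \<epsilon>"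
      and ap: "\<forall>t. norm (g t - (\<Sum>\<nu>\<in>J. a \<nu> * cis (\<nu> * t))) \<le> \<epsilon>"
      unfolding g_def by (elim exE conjE)
    have "dominated F (\<lambda>t. cis (\<nu> * t))" if "\<nu> \<in> J" for \<nu>
    proof -
      have "a \<nu> \<noteq> 0" using that J by (auto simp: \<Lambda>_def)
      then have "\<not> has_umean (\<lambda>t. F t * cis (- (\<nu> * t))) 0" using has_umean_unique[OF a] by blast
      then show ?thesis using umean_cis_dichotomy[OF F, of \<nu>] by blast
    qed
    then have "dominated F (\<lambda>t. \<Sum>\<nu>\<in>J. a \<nu> * cis (\<nu> * t))" by (intro dominated_sum dominated_cmult)
    then show "\<exists>v. dominated F v \<and> (\<forall>t. norm (g t - v t) \<le> \<epsilon>)" using ap by (intro exI conjI)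
  qed
  define h where "h = (\<lambda>t. F t + (-1) * g t)"
  have h: "bohr_ap h" unfolding h_def
    by (rule bohr_ap_dominated[OF F dominated_add[OF dominated_refl dominated_cmult[OF dg]]])
      (intro continuous_intros cF cg)
  have "has_umean (\<lambda>t. h t * cis (- (\<nu> * t))) 0" for \<nu>
  proof -
    have "has_umean (\<lambda>t. F t * cis (- (\<nu> * t)) + (-1) * (g t * cis (- (\<nu> * t)))) (a \<nu> + (-1) * (if \<nu> \<in> \<Lambda> then a \<nu> else 0))"
      unfolding g_def
      by (intro has_umean_add has_umean_cmult a umean_trig_series[OF sm] continuous_intros cF continuous_trig_series[OF sm])
    moreover have "F t * cis (- (\<nu> * t)) + (-1) * (g t * cis (- (\<nu> * t))) = h t * cis (- (\<nu> * t))" for t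
      by (simp add: h_def algebra_simps)
    moreover have "a \<nu> + (-1) * (if \<nu> \<in> \<Lambda> then a \<nu> else 0) = 0" by (simp add: \<Lambda>_def)
    ultimately show ?thesis by (simp only:)
  qed
  then have "h t = 0" using bohr_ap_exists_frequency[OF h] by blast
  then show "F t = infsum (\<lambda>\<nu>. a \<nu> * cis (\<nu> * t)) {\<nu>. a \<nu> \<noteq> 0}" by (simp add: h_def g_def \<Lambda>_def)
qed

section \<open>Almost periodic functions in a strip\<close>

lemma vertical_strip_open: "open (vertical_strip \<alpha> \<beta>)"
proof -
  have "vertical_strip \<alpha> \<beta> = (\<lambda>s. ereal (Re s)) -` {\<alpha><..<\<beta>}" by (auto simp: vertical_strip_def)
  moreover have "open ((\<lambda>s. ereal (Re s)) -` {\<alpha><..<\<beta>})"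
    by (intro continuous_open_vimage) (auto intro!: continuous_intros)
  ultimately show ?thesis by simp
qed

lemma ereal_between_convex:
  fixes x y :: real
  assumes "\<alpha> < ereal x" "ereal x < \<beta>" "\<alpha> < ereal y" "ereal y < \<beta>" "min x y \<le> z" "z \<le> max x y"
  shows "\<alpha> < ereal z" "ereal z < \<beta>"
proof -
  have "\<alpha> < ereal (min x y)" using assms by (simp add: min_def)
  also have "\<dots> \<le> ereal z" using assms(5) by (simp only: ereal_less_eq)
  finally show "\<alpha> < ereal z" .
  have "ereal z \<le> ereal (max x y)" using assms(6) by (simp only: ereal_less_eq)
  also have "\<dots> < \<beta>" using assms by (simp add: max_def)
  finally show "ereal z < \<beta>" .
qed

lemma vertical_strip_convex: "convex (vertical_strip \<alpha> \<beta>)"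
proof (rule convexI)
  fix x y and u v :: real
  assume xy: "x \<in> vertical_strip \<alpha> \<beta>" "y \<in> vertical_strip \<alpha> \<beta>" and uv: "0 \<le> u" "0 \<le> v" "u + v = 1"
  have "u * min (Re x) (Re y) + v * min (Re x) (Re y) \<le> u * Re x + v * Re y"
    using uv by (intro add_mono mult_left_mono) auto
  then have 1: "min (Re x) (Re y) \<le> u * Re x + v * Re y" using uv by (simp flip: distrib_right)
  have "u * Re x + v * Re y \<le> u * max (Re x) (Re y) + v * max (Re x) (Re y)"
    using uv by (intro add_mono mult_left_mono) auto
  then have 2: "u * Re x + v * Re y \<le> max (Re x) (Re y)" using uv by (simp flip: distrib_right)
  show "u *\<^sub>R x + v *\<^sub>R y \<in> vertical_strip \<alpha> \<beta>"
    using ereal_between_convex[of \<alpha> "Re x" \<beta> "Re y", OF _ _ _ _ 1 2] xy by (simp add: vertical_strip_def)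
qed

text \<open>Vertical almost periods carry the strip into a compact rectangle of height
  \<open>l\<close>.\<close>

lemma ap_strip_bounded:
  assumes ap: "almost_periodic_on_strip f \<alpha> \<beta>" and st: "\<alpha> < ereal p" "p < q" "ereal q < \<beta>"
  obtains B where "\<And>s. p \<le> Re s \<Longrightarrow> Re s \<le> q \<Longrightarrow> norm (f s) \<le> B"
proof -
  have hol: "f holomorphic_on vertical_strip \<alpha> \<beta>"
    using ap analytic_imp_holomorphic unfolding almost_periodic_on_strip_def by blast
  obtain l where l: "l > 0" "\<And>a. \<exists>\<tau>\<in>{a..a + l}. \<forall>s. p \<le> Re s \<and> Re s \<le> q \<longrightarrow> norm (f (s + \<i> * of_real \<tau>) - f s) \<le> 1"
    using ap st unfolding almost_periodic_on_strip_def by (metis zero_less_one)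
  define R where "R = cbox (Complex p 0) (Complex q l)"
  have sub: "R \<subseteq> vertical_strip \<alpha> \<beta>"
  proof
    fix s assume "s \<in> R"
    then have s: "p \<le> Re s" "Re s \<le> q" by (auto simp: R_def in_cbox_complex_iff)
    have "\<alpha> < ereal (Re s)" using st(1) s(1) by (meson ereal_less_eq(3) less_le_trans)
    moreover have "ereal (Re s) < \<beta>" using st(3) s(2) by (meson ereal_less_eq(3) le_less_trans)
    ultimately show "s \<in> vertical_strip \<alpha> \<beta>" by (simp add: vertical_strip_def)
  qed
  have "bounded (f ` R)" unfolding R_def
    by (intro compact_imp_bounded compact_continuous_image compact_cbox holomorphic_on_imp_continuous_on
        holomorphic_on_subset[OF hol sub[unfolded R_def]])
  then obtain B where B: "\<And>s. s \<in> R \<Longrightarrow> norm (f s) \<le> B" by (meson bounded_iff image_eqI)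
  have "norm (f s) \<le> B + 1" if s: "p \<le> Re s" "Re s \<le> q" for s
  proof -
    obtain \<tau> where \<tau>: "\<tau> \<in> {- Im s..- Im s + l}" "norm (f (s + \<i> * of_real \<tau>) - f s) \<le> 1"
      using l(2)[of "- Im s"] s by blast
    have "norm (f (s + \<i> * of_real \<tau>)) \<le> B"
      using \<tau>(1) s by (intro B) (auto simp: R_def in_cbox_complex_iff)
    then show ?thesis using \<tau>(2) norm_triangle_ineq3[of "f (s + \<i> * of_real \<tau>)" "f s"] by linarith
  qed
  then show ?thesis by (rule that)
qed

text \<open>Almost periodicity is given only on reduced strips of positive width, so a single line
  is first thickened. Density of the reals below and above \<open>x\<close> also covers infinite
  ends.\<close>

lemma strip_enlarge:
  assumes "\<alpha> < ereal x" "ereal x < \<beta>"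
  obtains e where "e > 0" "\<alpha> < ereal (x - e)" "ereal (x + e) < \<beta>"
proof -
  obtain y where y: "\<alpha> < ereal y" "ereal y < ereal x" using ereal_dense2[OF assms(1)] by auto
  obtain z where z: "ereal x < ereal z" "ereal z < \<beta>" using ereal_dense2[OF assms(2)] by auto
  define e where "e = min (x - y) (z - x)"
  have e: "e > 0" "y \<le> x - e" "x + e \<le> z" using y z by (auto simp: e_def)
  have "\<alpha> < ereal (x - e)" by (rule less_le_trans[OF y(1)]) (use e in simp)
  moreover have "ereal (x + e) < \<beta>" by (rule le_less_trans[OF _ z(2)]) (use e in simp)
  ultimately show ?thesis using e(1) by (intro that)
qed

lemma ap_strip_line_bohr_ap:
  assumes ap: "almost_periodic_on_strip f \<alpha> \<beta>" and st: "\<alpha> < ereal \<sigma>" "ereal \<sigma> < \<beta>"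
  shows "bohr_ap (\<lambda>t. f (Complex \<sigma> t))"
  unfolding bohr_ap_def
proof (intro conjI allI impI)
  have hol: "f holomorphic_on vertical_strip \<alpha> \<beta>"
    using ap analytic_imp_holomorphic unfolding almost_periodic_on_strip_def by blast
  show "continuous_on UNIV (\<lambda>t. f (Complex \<sigma> t))"
    by (rule continuous_on_compose2[OF holomorphic_on_imp_continuous_on[OF hol]])
      (use st in \<open>auto simp: vertical_strip_def Complex_eq intro!: continuous_intros\<close>)
  fix \<epsilon> :: real assume \<epsilon>: "\<epsilon> > 0"
  obtain e where e: "e > 0" "\<alpha> < ereal (\<sigma> - e)" "ereal (\<sigma> + e) < \<beta>" using strip_enlarge[OF st] by blast
  have "\<sigma> - e < \<sigma> + e" using e by simp
  with ap e \<epsilon> obtain l where l: "l > 0"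
    "\<And>a. \<exists>\<tau>\<in>{a..a + l}. \<forall>s. \<sigma> - e \<le> Re s \<and> Re s \<le> \<sigma> + e \<longrightarrow> norm (f (s + \<i> * of_real \<tau>) - f s) \<le> \<epsilon>"
    unfolding almost_periodic_on_strip_def by metis
  have "almost_period (\<lambda>t. f (Complex \<sigma> t)) \<epsilon> \<tau>"
    if "\<forall>s. \<sigma> - e \<le> Re s \<and> Re s \<le> \<sigma> + e \<longrightarrow> norm (f (s + \<i> * of_real \<tau>) - f s) \<le> \<epsilon>" for \<tau>
    unfolding almost_period_def
  proof
    fix t
    have "Complex \<sigma> (t + \<tau>) = Complex \<sigma> t + \<i> * of_real \<tau>" by (simp add: complex_eq_iff)
    then show "norm (f (Complex \<sigma> (t + \<tau>)) - f (Complex \<sigma> t)) \<le> \<epsilon>"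
      using that[rule_format, of "Complex \<sigma> t"] e by simp
  qed
  then show "\<exists>l>0. \<forall>a. \<exists>\<tau>\<in>{a..a + l}. almost_period (\<lambda>t. f (Complex \<sigma> t)) \<epsilon> \<tau>" using l by meson
qed

lemma has_umean_close:
  assumes "has_umean u c" "\<And>a T. T \<ge> 0 \<Longrightarrow> norm (integral {a..a + T} u - integral {a..a + T} v) \<le> C"
  shows "has_umean v c"
  unfolding has_umean_def
proof (intro allI impI)
  fix \<epsilon> :: real assume \<epsilon>: "\<epsilon> > 0"
  then have "\<epsilon> / 2 > 0" by simp
  then obtain T0 where T0: "T0 > 0" "\<And>T a. T \<ge> T0 \<Longrightarrow> norm (integral {a..a + T} u - of_real T * c) \<le> \<epsilon> / 2 * T"
    using assms(1) unfolding has_umean_def by metis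
  have "norm (integral {a..a + T} v - of_real T * c) \<le> \<epsilon> * T" if T: "T \<ge> max T0 (2 * C / \<epsilon>)" for T a
  proof -
    have "norm (integral {a..a + T} u - integral {a..a + T} v) \<le> C" using T T0(1) by (intro assms) auto
    moreover have "C \<le> \<epsilon> / 2 * T" using T \<epsilon> by (simp add: field_simps)
    moreover have "norm (integral {a..a + T} u - of_real T * c) \<le> \<epsilon> / 2 * T" using T by (intro T0) auto
    moreover have "norm (integral {a..a + T} v - of_real T * c) \<le>
        norm (integral {a..a + T} u - of_real T * c) + norm (integral {a..a + T} u - integral {a..a + T} v)"
      using norm_triangle_ineq4[of "integral {a..a + T} u - of_real T * c" "integral {a..a + T} u - integral {a..a + T} v"] by simp
    ultimately have "norm (integral {a..a + T} v - of_real T * c) \<le> \<epsilon> / 2 * T + \<epsilon> / 2 * T" by linarith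
    also have "\<dots> = \<epsilon> * T" by simp
    finally show ?thesis .
  qed
  then show "\<exists>T0>0. \<forall>T\<ge>T0. \<forall>a. norm (integral {a..a + T} v - of_real T * c) \<le> \<epsilon> * T"
    using T0(1) by (intro exI[of _ "max T0 (2 * C / \<epsilon>)"]) auto
qed

lemma fourier_integrand_eq:
  "f (Complex \<sigma> t) * exp (- (of_real \<mu> * Complex \<sigma> t)) =
    of_real (exp (- (\<mu> * \<sigma>))) * (f (Complex \<sigma> t) * cis (- (\<mu> * t)))"
proof -
  have "- (complex_of_real \<mu> * Complex \<sigma> t) = of_real (- (\<mu> * \<sigma>)) + \<i> * of_real (- (\<mu> * t))"
    by (simp add: complex_eq_iff)
  then have "exp (- (complex_of_real \<mu> * Complex \<sigma> t)) = of_real (exp (- (\<mu> * \<sigma>))) * cis (- (\<mu> * t))"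
    by (simp only: exp_add cis_conv_exp exp_of_real)
  then show ?thesis by simp
qed

text \<open>With a primitive \<open>G\<close> of \<open>f(s) exp(-\<mu> s)\<close>, the window integrals on two vertical lines differ by
  increments of \<open>G\<close> along two horizontal segments, which stay bounded.\<close>
lemma umean_strip_independent:
  assumes ap: "almost_periodic_on_strip f \<alpha> \<beta>"
    and p: "\<alpha> < ereal p" "ereal p < \<beta>" and q: "\<alpha> < ereal q" "ereal q < \<beta>"
    and m: "has_umean (\<lambda>t. f (Complex p t) * exp (- (of_real \<mu> * Complex p t))) c"
  shows "has_umean (\<lambda>t. f (Complex q t) * exp (- (of_real \<mu> * Complex q t))) c"
proof (cases "p = q")
  case True then show ?thesis using m by simp
next
  case False
  define p' q' where "p' = min p q" "q' = max p q"
  have pq: "p' < q'" "\<alpha> < ereal p'" "ereal q' < \<beta>" using False p q by (auto simp: p'_q'_def min_def max_def)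
  have mem: "p \<in> {p'..q'}" "q \<in> {p'..q'}" by (auto simp: p'_q'_def)
  have sub: "s \<in> vertical_strip \<alpha> \<beta>" if "p' \<le> Re s" "Re s \<le> q'" for s
    using ereal_between_convex[OF p q] that by (simp add: vertical_strip_def p'_q'_def)
  have hol: "f holomorphic_on vertical_strip \<alpha> \<beta>"
    using ap analytic_imp_holomorphic unfolding almost_periodic_on_strip_def by blast
  define F where "F = (\<lambda>s. f s * exp (- (of_real \<mu> * s)))"
  have "F holomorphic_on vertical_strip \<alpha> \<beta>" unfolding F_def by (intro holomorphic_intros hol)
  then obtain G where G: "\<And>s. s \<in> vertical_strip \<alpha> \<beta> \<Longrightarrow> (G has_field_derivative F s) (at s within vertical_strip \<alpha> \<beta>)"
    using holomorphic_convex_primitive'[OF vertical_strip_convex vertical_strip_open] by blast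
  have G: "(G has_field_derivative F s) (at s)" if "s \<in> vertical_strip \<alpha> \<beta>" for s
    using G[OF that] at_within_open[OF that vertical_strip_open] by simp
  obtain B where B: "\<And>s. p' \<le> Re s \<Longrightarrow> Re s \<le> q' \<Longrightarrow> norm (f s) \<le> B"
    using ap_strip_bounded[OF ap pq(2,1,3)] by blast
  define B' where "B' = max B 0 * exp (\<bar>\<mu>\<bar> * max \<bar>p'\<bar> \<bar>q'\<bar>)"
  have B'0: "B' \<ge> 0" by (simp add: B'_def)
  have B': "norm (F s) \<le> B'" if s: "p' \<le> Re s" "Re s \<le> q'" for s
  proof -
    have "- (\<mu> * Re s) \<le> \<bar>\<mu>\<bar> * \<bar>Re s\<bar>" by (metis abs_ge_minus_self abs_mult)
    also have "\<dots> \<le> \<bar>\<mu>\<bar> * max \<bar>p'\<bar> \<bar>q'\<bar>" using s by (intro mult_left_mono) auto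
    finally have "exp (- (\<mu> * Re s)) \<le> exp (\<bar>\<mu>\<bar> * max \<bar>p'\<bar> \<bar>q'\<bar>)" by simp
    then have "norm (f s) * exp (- (\<mu> * Re s)) \<le> B'" unfolding B'_def
      using B[OF s] by (intro mult_mono) auto
    then show ?thesis by (simp add: F_def norm_mult)
  qed
  have int: "integral {a..a + T} (\<lambda>t. F (Complex x t)) = (G (Complex x (a + T)) - G (Complex x a)) / \<i>"
    if x: "x \<in> {p'..q'}" and T: "T \<ge> 0" for x a T
  proof -
    have "((\<lambda>t. G (Complex x t) / \<i>) has_vector_derivative F (Complex x t)) (at t within A)" for t A
    proof -
      have s: "of_real x + \<i> * of_real t \<in> vertical_strip \<alpha> \<beta>" using x by (intro sub) auto
      have "((\<lambda>z. G (of_real x + \<i> * z)) has_field_derivative F (of_real x + \<i> * of_real t) * \<i>) (at (of_real t))"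
        by (rule DERIV_chain2[where f = G and g = "\<lambda>z. of_real x + \<i> * z", OF G[OF s]]) (auto intro!: derivative_eq_intros)
      then have "((\<lambda>z. G (of_real x + \<i> * z) / \<i>) has_field_derivative F (of_real x + \<i> * of_real t) * \<i> / \<i>) (at (of_real t))"
        by (rule DERIV_cdivide)
      moreover have "F (of_real x + \<i> * of_real t) * \<i> / \<i> = F (of_real x + \<i> * of_real t)"
        by (rule nonzero_mult_div_cancel_right) simp
      ultimately have "((\<lambda>z. G (of_real x + \<i> * z) / \<i>) has_field_derivative F (of_real x + \<i> * of_real t)) (at (of_real t))"
        by (simp only:)
      from has_vector_derivative_real_field[OF this, of A] show ?thesis
        unfolding Complex_eq .
    qed
    then have "((\<lambda>t. F (Complex x t)) has_integral G (Complex x (a + T)) / \<i> - G (Complex x a) / \<i>) {a..a + T}"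
      using T by (intro fundamental_theorem_of_calculus) auto
    then show ?thesis unfolding diff_divide_distrib by (rule integral_unique)
  qed
  have hor: "norm (G (Complex p t) - G (Complex q t)) \<le> B' * \<bar>p - q\<bar>" for t
  proof -
    define S where "S = {s. p' \<le> Re s \<and> Re s \<le> q'}"
    have "convex S" unfolding S_def
      using convex_Int[OF convex_halfspace_Re_ge[of p'] convex_halfspace_Re_le[of q']] by (simp add: Collect_conj_eq)
    then have "norm (G (Complex p t) - G (Complex q t)) \<le> B' * norm (Complex p t - Complex q t)"
    proof (rule field_differentiable_bound)
      fix z assume "z \<in> S"
      then show "(G has_field_derivative F z) (at z within S)" "norm (F z) \<le> B'"
        using has_field_derivative_at_within[OF G[OF sub], of z S] B'[of z] by (simp_all add: S_def)
    qed (use mem in \<open>auto simp: S_def\<close>)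
    also have "norm (Complex p t - Complex q t) = \<bar>p - q\<bar>" by (simp add: cmod_def)
    finally show ?thesis .
  qed
  show ?thesis
  proof (rule has_umean_close[OF m])
    fix a T :: real assume T: "T \<ge> 0"
    have "integral {a..a + T} (\<lambda>t. F (Complex p t)) - integral {a..a + T} (\<lambda>t. F (Complex q t)) =
      ((G (Complex p (a + T)) - G (Complex q (a + T))) - (G (Complex p a) - G (Complex q a))) / \<i>"
      by (simp only: int[OF mem(1) T] int[OF mem(2) T] diff_divide_distrib) simp
    also have "norm \<dots> \<le> B' * \<bar>p - q\<bar> + B' * \<bar>p - q\<bar>"
      unfolding norm_divide norm_ii div_by_1 by (intro order_trans[OF norm_triangle_ineq4] add_mono hor)
    finally show "norm (integral {a..a + T} (\<lambda>t. f (Complex p t) * exp (- (of_real \<mu> * Complex p t)))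
       - integral {a..a + T} (\<lambda>t. f (Complex q t) * exp (- (of_real \<mu> * Complex q t)))) \<le> B' * \<bar>p - q\<bar> + B' * \<bar>p - q\<bar>"
      unfolding F_def .
  qed
qed

lemma has_umean_symmetric_limit:
  assumes "has_umean u c"
  shows "((\<lambda>T. 1 / complex_of_real (2 * T) * integral {-T..T} u) \<longlongrightarrow> c) at_top"
proof (rule tendstoI)
  fix e :: real assume e: "e > 0"
  then have "e / 2 > 0" by simp
  then obtain T0 where T0: "T0 > 0" "\<And>T a. T \<ge> T0 \<Longrightarrow> norm (integral {a..a + T} u - of_real T * c) \<le> e / 2 * T"
    using assms unfolding has_umean_def by metis
  show "eventually (\<lambda>T. dist (1 / complex_of_real (2 * T) * integral {-T..T} u) c < e) at_top"
    using eventually_ge_at_top[of T0]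
  proof eventually_elim
    case (elim T)
    have T: "T > 0" "2 * T \<ge> T0" using elim T0 by auto
    \<comment> \<open>The symmetric interval is the window of length \<open>2 * T\<close> that
      starts at \<open>-T\<close>.\<close>
    have "1 / complex_of_real (2 * T) * integral {-T..T} u - c = (integral {-T..- T + 2 * T} u - of_real (2 * T) * c) / of_real (2 * T)"
      using T by (simp add: field_simps)
    then have "dist (1 / complex_of_real (2 * T) * integral {-T..T} u) c = norm (integral {-T..- T + 2 * T} u - of_real (2 * T) * c) / (2 * T)"
      using T by (simp only: dist_norm norm_divide norm_of_real abs_of_pos zero_less_mult_iff zero_less_numeral simp_thms)
    also have "\<dots> \<le> e / 2 * (2 * T) / (2 * T)" using T by (intro divide_right_mono T0) auto
    also have "\<dots> < e" using T e by simp
    finally show ?case .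
  qed
qed

text \<open>The coefficients are computed on one line and serve on all, because the weighted means
  do not depend on the abscissa. On the line \<sigma> the coefficient of
  \<open>cis (\<nu> * t)\<close> is \<open>exp (\<nu> * \<sigma>) * c \<nu>\<close>, so all lines
  share one spectrum and the series theorem applies to each.\<close>

theorem strip_dirichlet_series:
  assumes "\<alpha> < \<beta>" and ap: "almost_periodic_on_strip f \<alpha> \<beta>"
    and ind: "int_independent (fourier_exponents f \<alpha> \<beta>)"
  shows "\<exists>c. (\<forall>\<nu>\<in>fourier_exponents f \<alpha> \<beta>. c \<nu> \<noteq> 0) \<and>
    (\<forall>\<sigma>. \<alpha> < ereal \<sigma> \<and> ereal \<sigma> < \<beta> \<longrightarrow>
        (\<lambda>\<nu>. norm (c \<nu>) * exp (\<nu> * \<sigma>)) summable_on fourier_exponents f \<alpha> \<beta>) \<and>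
    (\<forall>s\<in>vertical_strip \<alpha> \<beta>. f s = infsum (\<lambda>\<nu>. c \<nu> * exp (of_real \<nu> * s)) (fourier_exponents f \<alpha> \<beta>))"
proof -
  obtain x where x: "\<alpha> < ereal x" "ereal x < \<beta>" using \<open>\<alpha> < \<beta>\<close> ereal_dense2 by blast
  have "\<exists>c. has_umean (\<lambda>t. f (Complex x t) * exp (- (of_real \<mu> * Complex x t))) c" for \<mu>
  proof -
    obtain m where "has_umean (\<lambda>t. f (Complex x t) * cis (- (\<mu> * t))) m"
      using umean_cis_dichotomy[OF ap_strip_line_bohr_ap[OF ap x], of \<mu>] by blast
    from has_umean_cmult[OF this] show ?thesis unfolding fourier_integrand_eq by blast
  qed
  then obtain c where cx: "\<And>\<mu>. has_umean (\<lambda>t. f (Complex x t) * exp (- (of_real \<mu> * Complex x t))) (c \<mu>)"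
    using choice by metis
  have c: "has_umean (\<lambda>t. f (Complex \<sigma> t) * exp (- (of_real \<mu> * Complex \<sigma> t))) (c \<mu>)"
    if "\<alpha> < ereal \<sigma>" "ereal \<sigma> < \<beta>" for \<sigma> \<mu>
    by (rule umean_strip_independent[OF ap x that cx])
  have \<Lambda>: "fourier_exponents f \<alpha> \<beta> = {\<mu>. c \<mu> \<noteq> 0}"
  proof -
    have "has_fourier_coeff f \<alpha> \<beta> \<mu> (c \<mu>)" for \<mu>
      unfolding has_fourier_coeff_def using has_umean_symmetric_limit[OF c] by blast
    \<comment> \<open>The line \<open>x\<close> makes the relational definition non-vacuous, and
      uniqueness of limits there leaves \<open>c \<mu>\<close> as the only value.\<close>
    moreover have "c' = c \<mu>" if "has_fourier_coeff f \<alpha> \<beta> \<mu> c'" for c' \<mu>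
      using that x has_umean_symmetric_limit[OF c[OF x], of \<mu>] tendsto_unique[OF trivial_limit_at_top_linorder]
      unfolding has_fourier_coeff_def by blast
    ultimately show ?thesis unfolding fourier_exponents_def by blast
  qed
  have line: "(\<lambda>\<nu>. norm (c \<nu>) * exp (\<nu> * \<sigma>)) summable_on {\<mu>. c \<mu> \<noteq> 0} \<and>
      f (Complex \<sigma> t) = infsum (\<lambda>\<nu>. c \<nu> * exp (of_real \<nu> * Complex \<sigma> t)) {\<mu>. c \<mu> \<noteq> 0}"
    if \<sigma>: "\<alpha> < ereal \<sigma>" "ereal \<sigma> < \<beta>" for \<sigma> t
  proof -
    define a where "a = (\<lambda>\<nu>. of_real (exp (\<nu> * \<sigma>)) * c \<nu>)"
    have "has_umean (\<lambda>t. f (Complex \<sigma> t) * cis (- (\<nu> * t))) (a \<nu>)" for \<nu>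
    proof -
      have "has_umean (\<lambda>t. of_real (exp (\<nu> * \<sigma>)) * (f (Complex \<sigma> t) * exp (- (of_real \<nu> * Complex \<sigma> t)))) (a \<nu>)"
        unfolding a_def by (rule has_umean_cmult[OF c[OF \<sigma>]])
      moreover have "of_real (exp (\<nu> * \<sigma>)) * (f (Complex \<sigma> t) * exp (- (of_real \<nu> * Complex \<sigma> t))) = f (Complex \<sigma> t) * cis (- (\<nu> * t))" for t
      proof -
        have "complex_of_real (exp (\<nu> * \<sigma>)) * of_real (exp (- (\<nu> * \<sigma>))) = 1"
          by (simp only: of_real_mult[symmetric] exp_add[symmetric]) simp
        then show ?thesis unfolding fourier_integrand_eq by (simp only: mult.assoc[symmetric]) simp
      qed
      ultimately show ?thesis by (simp only:)
    qed
    moreover have eq: "{\<nu>. a \<nu> \<noteq> 0} = {\<mu>. c \<mu> \<noteq> 0}" by (simp add: a_def)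
    moreover have "int_independent {\<mu>. c \<mu> \<noteq> 0}" using ind \<Lambda> by simp
    ultimately have *: "(\<lambda>\<nu>. norm (a \<nu>)) summable_on {\<mu>. c \<mu> \<noteq> 0}"
      "f (Complex \<sigma> t) = infsum (\<lambda>\<nu>. a \<nu> * cis (\<nu> * t)) {\<mu>. c \<mu> \<noteq> 0}"
      using bohr_ap_series[OF ap_strip_line_bohr_ap[OF ap \<sigma>], of a] by metis+
    have "norm (a \<nu>) = norm (c \<nu>) * exp (\<nu> * \<sigma>)" for \<nu> by (simp add: a_def norm_mult)
    moreover have "a \<nu> * cis (\<nu> * t) = c \<nu> * exp (of_real \<nu> * Complex \<sigma> t)" for \<nu>
    proof -
      have "complex_of_real \<nu> * Complex \<sigma> t = of_real (\<nu> * \<sigma>) + \<i> * of_real (\<nu> * t)" by (simp add: complex_eq_iff)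
      then have "exp (complex_of_real \<nu> * Complex \<sigma> t) = of_real (exp (\<nu> * \<sigma>)) * cis (\<nu> * t)"
        by (simp only: exp_add cis_conv_exp exp_of_real)
      then show ?thesis by (simp add: a_def)
    qed
    ultimately show ?thesis using * by (simp only: simp_thms)
  qed
  show ?thesis
  proof (intro exI[of _ c] conjI ballI allI impI)
    show "c \<nu> \<noteq> 0" if "\<nu> \<in> fourier_exponents f \<alpha> \<beta>" for \<nu> using that \<Lambda> by simp
    show "(\<lambda>\<nu>. norm (c \<nu>) * exp (\<nu> * \<sigma>)) summable_on fourier_exponents f \<alpha> \<beta>"
      if "\<alpha> < ereal \<sigma> \<and> ereal \<sigma> < \<beta>" for \<sigma> using line[of \<sigma>] that \<Lambda> by simp
    show "f s = infsum (\<lambda>\<nu>. c \<nu> * exp (of_real \<nu> * s)) (fourier_exponents f \<alpha> \<beta>)" if "s \<in> vertical_strip \<alpha> \<beta>" for s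
      using line[of "Re s" "Im s"] that \<Lambda> by (simp add: vertical_strip_def)
  qed
qed

section \<open>Zeros of Dirichlet series with independent exponents\<close>

text \<open>Riesz products and Kronecker's theorem meet only integer relations, so the rational
  scalars are replaced at the outset.\<close>

lemma int_independent_of_rat:
  assumes "rat_lin_independent S"
  shows "int_independent S"
proof -
  interpret M: Modules.module "\<lambda>(q::rat) (x::real). of_rat q * x"
    by unfold_locales (simp_all add: of_rat_add of_rat_mult algebra_simps)
  show ?thesis unfolding int_independent_def
  proof (intro allI impI ballI)
    fix J and k :: "real \<Rightarrow> int" and j
    assume J: "finite J" "J \<subseteq> S" "(\<Sum>j\<in>J. of_int (k j) * j) = 0" "j \<in> J"
    have "rat_of_int (k j) = 0"
      by (rule M.independentD[OF assms[unfolded rat_lin_independent_def] J(1,2) _ J(4)]) (use J(3) in simp)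
    then show "k j = 0" by simp
  qed
qed

text \<open>\<open>Kronecker_thm_1\<close> approximates targets modulo 1, whereas phases live modulo
  \<open>2 * pi\<close>; hence the scaling of exponents and targets.\<close>

lemma kronecker_cis:
  assumes ind: "int_independent \<Lambda>" and J: "finite J" "J \<subseteq> \<Lambda>" and e: "e > 0"
  shows "\<exists>t. \<forall>\<nu>\<in>J. norm (cis (\<nu> * t) - cis (\<phi> \<nu>)) \<le> e"
proof -
  interpret M: Modules.module "\<lambda>r. (*) (real_of_int r)"
    by (simp add: Modules.module.intro distrib_left mult.commute)
  obtain h where h: "bij_betw h {0..<card J} J" using ex_bij_betw_nat_finite[OF J(1)] by blast
  define \<theta> where "\<theta> = (\<lambda>i. h i / (2 * pi))"
  define n where "n = card J"
  have hJ: "h i \<in> J" if "i < n" for i using h that by (auto simp: bij_betw_def n_def)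
  have indp: "M.independent (\<theta> ` {..<n})" unfolding M.independent_explicit_module
  proof (intro allI impI)
    fix t v and u :: "real \<Rightarrow> int"
    assume t: "finite t" "t \<subseteq> \<theta> ` {..<n}" "(\<Sum>v\<in>t. real_of_int (u v) * v) = 0" "v \<in> t"
    define I where "I = (\<lambda>v. 2 * pi * v) ` t"
    have inj: "inj_on (\<lambda>v. 2 * pi * v) t" by (auto simp: inj_on_def)
    have I\<Lambda>: "I \<subseteq> \<Lambda>"
    proof
      fix x assume "x \<in> I"
      then obtain i where "i < n" "x = 2 * pi * \<theta> i" using t(2) by (auto simp: I_def)
      then show "x \<in> \<Lambda>" using hJ J(2) by (auto simp: \<theta>_def)
    qed
    have "(\<Sum>j\<in>I. of_int (u (j / (2 * pi))) * j) = (\<Sum>v\<in>t. 2 * pi * (of_int (u v) * v))"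
      unfolding I_def sum.reindex[OF inj] by (intro sum.cong) auto
    then have I0: "(\<Sum>j\<in>I. of_int (u (j / (2 * pi))) * j) = 0"
      unfolding sum_distrib_left[symmetric] t(3) by simp
    have I: "finite I" "2 * pi * v \<in> I" using t by (auto simp: I_def)
    have "u (2 * pi * v / (2 * pi)) = 0"
      by (rule int_independentD[OF ind I(1) I\<Lambda> I0 I(2)])
    then show "u v = 0" by simp
  qed
  have "inj_on \<theta> {..<n}" using h by (auto simp: bij_betw_def inj_on_def \<theta>_def n_def)
  moreover have "e / (2 * pi) > 0" using e by simp
  ultimately obtain t k where tk: "\<And>i. i < n \<Longrightarrow> \<bar>t * \<theta> i - of_int (k i) - \<phi> (h i) / (2 * pi)\<bar> < e / (2 * pi)"
    using Kronecker_thm_1[OF indp, of "e / (2 * pi)" "\<lambda>i. \<phi> (h i) / (2 * pi)"] by blast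
  have "norm (cis (\<nu> * t) - cis (\<phi> \<nu>)) \<le> e" if \<nu>: "\<nu> \<in> J" for \<nu>
  proof -
    obtain i where i: "i < n" "\<nu> = h i" using h \<nu> unfolding bij_betw_def n_def by force
    have "cis (\<nu> * t) = cis (\<nu> * t - 2 * pi * of_int (k i)) * cis (2 * pi * of_int (k i))"
      unfolding cis_mult by simp
    also have "\<dots> = cis (\<nu> * t - 2 * pi * of_int (k i))" by simp
    finally have "norm (cis (\<nu> * t) - cis (\<phi> \<nu>)) \<le> \<bar>\<nu> * t - 2 * pi * of_int (k i) - \<phi> \<nu>\<bar>"
      using norm_cis_diff_le by simp
    also have "\<nu> * t - 2 * pi * of_int (k i) - \<phi> \<nu> = 2 * pi * (t * \<theta> i - of_int (k i) - \<phi> (h i) / (2 * pi))"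
      by (simp add: i(2) \<theta>_def field_simps)
    also have "\<bar>\<dots>\<bar> = 2 * pi * \<bar>t * \<theta> i - of_int (k i) - \<phi> (h i) / (2 * pi)\<bar>" by (simp add: abs_mult)
    also have "\<dots> \<le> 2 * pi * (e / (2 * pi))" using tk[OF i(1)] by (intro mult_left_mono) auto
    finally show ?thesis by simp
  qed
  then show ?thesis by blast
qed

section \<open>Closed polygons with prescribed side lengths\<close>

lemma balanced_partition_finite:
  fixes w :: "'a \<Rightarrow> real"
  assumes "finite J" "\<And>j. j \<in> J \<Longrightarrow> 0 \<le> w j \<and> w j \<le> W" "W \<ge> 0"
  shows "\<exists>A\<subseteq>J. \<bar>sum w A - sum w (J - A)\<bar> \<le> W"
  using assms
proof (induction J)
  case (insert x J)
  then obtain A where A: "A \<subseteq> J" "\<bar>sum w A - sum w (J - A)\<bar> \<le> W" by auto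
  have fA: "finite A" "x \<notin> A" using A(1) insert.hyps finite_subset by auto
  have wx: "0 \<le> w x" "w x \<le> W" using insert.prems by auto
  show ?case
  \<comment> \<open>Greedy choice: the new element joins the lighter group, so the difference cannot
    leave the interval from \<open>-W\<close> to \<open>W\<close>.\<close>
  proof (cases "sum w A - sum w (J - A) \<ge> 0")
    case True
    have "insert x J - A = insert x (J - A)" using fA by auto
    then have "sum w (insert x J - A) = w x + sum w (J - A)" using insert.hyps by simp
    then show ?thesis using A True wx by (intro exI[of _ A]) auto
  next
    case False
    have "insert x J - insert x A = J - A" using insert.hyps by auto
    then have "sum w (insert x A) - sum w (insert x J - insert x A) = w x + sum w A - sum w (J - A)"
      using fA by simp
    then show ?thesis using A False wx by (intro exI[of _ "insert x A"]) auto
  qed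
qed auto

lemma infsum_split:
  fixes w :: "'a \<Rightarrow> real"
  assumes "w summable_on A \<union> B" "A \<inter> B = {}"
  shows "infsum w (A \<union> B) = infsum w A + infsum w B"
  using assms by (intro infsum_Un_disjoint) (auto intro: summable_on_subset[OF assms(1)])

text \<open>A finite part is balanced greedily, and the whole tail, of size at most
  \<open>W\<close>, goes to the lighter group.\<close>

lemma balanced_partition:
  fixes w :: "'a \<Rightarrow> real"
  assumes sm: "w summable_on \<Lambda>" and w: "\<And>j. j \<in> \<Lambda> \<Longrightarrow> 0 \<le> w j \<and> w j \<le> W" and W: "W > 0"
  shows "\<exists>A\<subseteq>\<Lambda>. \<bar>infsum w A - infsum w (\<Lambda> - A)\<bar> \<le> W"
proof -
  obtain J where J: "finite J" "J \<subseteq> \<Lambda>" "infsum w (\<Lambda> - J) \<le> W"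
    using abs_summable_tail[OF sm _ W] w by blast
  have tail: "infsum w (\<Lambda> - J) \<ge> 0" using w by (intro infsum_nonneg) auto
  obtain A where A: "A \<subseteq> J" "\<bar>sum w A - sum w (J - A)\<bar> \<le> W"
    using balanced_partition_finite[OF J(1), of w W] w J(2) W by (meson less_imp_le subsetD)
  have fA: "finite A" using A(1) J(1) finite_subset by blast
  show ?thesis
  proof (cases "sum w A - sum w (J - A) \<ge> 0")
    case True
    have eq: "\<Lambda> - A = (J - A) \<union> (\<Lambda> - J)" using A J by auto
    have "infsum w (\<Lambda> - A) = infsum w (J - A) + infsum w (\<Lambda> - J)" unfolding eq
      by (rule infsum_split) (use J(2) in \<open>auto intro: summable_on_subset[OF sm]\<close>)
    then have "\<bar>infsum w A - infsum w (\<Lambda> - A)\<bar> \<le> W" using A True J tail fA by simp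
    then show ?thesis using A(1) J(2) by blast
  next
    case False
    have eq: "\<Lambda> - (A \<union> (\<Lambda> - J)) = J - A" using A J by auto
    have "infsum w (A \<union> (\<Lambda> - J)) = infsum w A + infsum w (\<Lambda> - J)"
      by (rule infsum_split) (use A(1) J(2) in \<open>auto intro: summable_on_subset[OF sm]\<close>)
    then have "\<bar>infsum w (A \<union> (\<Lambda> - J)) - infsum w (\<Lambda> - (A \<union> (\<Lambda> - J)))\<bar> \<le> W"
      unfolding eq using A False J tail fA by simp
    then show ?thesis using A(1) J(2) by (intro exI[of _ "A \<union> (\<Lambda> - J)"]) auto
  qed
qed

text \<open>All but finitely many terms lie below any fixed positive term, so the maximum is found
  in a finite set.\<close>

lemma summable_has_max:
  fixes w :: "'a \<Rightarrow> real"
  assumes sm: "w summable_on \<Lambda>" and w: "\<And>j. j \<in> \<Lambda> \<Longrightarrow> w j > 0" and ne: "\<Lambda> \<noteq> {}"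
  shows "\<exists>m\<in>\<Lambda>. \<forall>j\<in>\<Lambda>. w j \<le> w m"
proof -
  obtain x where x: "x \<in> \<Lambda>" using ne by blast
  have w0: "\<And>j. j \<in> \<Lambda> \<Longrightarrow> w j \<ge> 0" using w less_imp_le by blast
  obtain J where J: "finite J" "J \<subseteq> \<Lambda>" "infsum w (\<Lambda> - J) \<le> w x"
    using abs_summable_tail[OF sm w0 w[OF x]] by blast
  have small: "w j \<le> w x" if "j \<in> \<Lambda> - J" for j
  proof -
    have "sum w {j} \<le> infsum w (\<Lambda> - J)"
      using that w0 by (intro finite_sum_le_infsum summable_on_subset[OF sm]) auto
    then show ?thesis using J(3) by simp
  qed
  define K where "K = insert x J"
  have "finite (w ` K)" "w ` K \<noteq> {}" using J by (auto simp: K_def)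
  then have "Max (w ` K) \<in> w ` K" by (rule Max_in)
  then obtain m where m: "m \<in> K" "w m = Max (w ` K)" by auto
  have "w j \<le> w m" if "j \<in> \<Lambda>" for j
  proof (cases "j \<in> K")
    case True then show ?thesis using \<open>finite (w ` K)\<close> m by (simp add: Max_ge)
  next
    case False
    then have "w j \<le> w x" using small that by (auto simp: K_def)
    also have "w x \<le> w m" using \<open>finite (w ` K)\<close> m by (simp add: K_def)
    finally show ?thesis .
  qed
  then show ?thesis using m(1) x J(2) by (auto simp: K_def)
qed

text \<open>A closed polygon with side lengths \<open>w\<close>: the sides other than the longest one are split into two
  nearly balanced groups, and the angle between the groups is opened until they match the longest side.\<close>
lemma closed_polygon:
  fixes w :: "'a \<Rightarrow> real"
  assumes sm: "w summable_on \<Lambda>" and w: "\<And>j. j \<in> \<Lambda> \<Longrightarrow> w j > 0" and ne: "\<Lambda> \<noteq> {}"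
    and le: "\<And>j. j \<in> \<Lambda> \<Longrightarrow> 2 * w j \<le> infsum w \<Lambda>"
  shows "\<exists>\<theta>. ((\<lambda>j. of_real (w j) * cis (\<theta> j)) has_sum 0) \<Lambda>"
proof -
  obtain m where m: "m \<in> \<Lambda>" "\<And>j. j \<in> \<Lambda> \<Longrightarrow> w j \<le> w m" using summable_has_max[OF sm w ne] by blast
  define \<Lambda>' where "\<Lambda>' = \<Lambda> - {m}"
  have sub: "\<Lambda>' \<subseteq> \<Lambda>" by (auto simp: \<Lambda>'_def)
  have sm': "w summable_on \<Lambda>'" by (rule summable_on_subset[OF sm sub])
  have wm: "w m > 0" using w m by blast
  obtain A where A: "A \<subseteq> \<Lambda>'" "\<bar>infsum w A - infsum w (\<Lambda>' - A)\<bar> \<le> w m"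
    using balanced_partition[OF sm' _ wm] m(2) w sub by (meson less_imp_le subsetD)
  define P Q where "P = infsum w A" "Q = infsum w (\<Lambda>' - A)"
  have hP: "(w has_sum P) A" unfolding P_Q_def by (intro has_sum_infsum summable_on_subset[OF sm' A(1)])
  have hQ: "(w has_sum Q) (\<Lambda>' - A)" unfolding P_Q_def by (intro has_sum_infsum summable_on_subset[OF sm']) auto
  have PQ: "infsum w \<Lambda>' = P + Q"
    using infsum_split[of w A "\<Lambda>' - A"] A(1) sm' by (simp add: P_Q_def Un_absorb1)
  have "infsum w \<Lambda> = infsum w ({m} \<union> \<Lambda>')" using m(1) by (simp add: \<Lambda>'_def insert_absorb)
  also have "\<dots> = w m + infsum w \<Lambda>'"
    using infsum_split[of w "{m}" \<Lambda>'] sm m(1) by (simp add: \<Lambda>'_def insert_absorb)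
  finally have sum: "w m \<le> P + Q" using le[OF m(1)] PQ by simp
  \<comment> \<open>Length of the resultant of the two groups at angle \<open>x\<close>; it is
    \<open>P + Q\<close> at 0 and \<open>\<bar>P - Q\<bar>\<close> at pi, which brackets
    \<open>w m\<close>.\<close>
  define g where "g = (\<lambda>x. norm (of_real P + cis x * of_real Q))"
  have "\<exists>x. 0 \<le> x \<and> x \<le> pi \<and> g x = w m"
  proof (rule IVT2')
    have "g pi = \<bar>P - Q\<bar>" by (simp add: g_def flip: of_real_diff)
    then show "g pi \<le> w m" using A(2) by (simp add: P_Q_def)
    have "g 0 = \<bar>P + Q\<bar>" by (simp add: g_def flip: of_real_add)
    then show "w m \<le> g 0" using sum by simp
    show "continuous_on {0..pi} g" unfolding g_def by (intro continuous_intros)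
  qed simp
  then obtain x where x: "norm (of_real P + cis x * of_real Q) = w m" unfolding g_def by blast
  define z where "z = of_real P + cis x * of_real Q"
  have z: "norm z = w m" "z \<noteq> 0" using x wm by (auto simp: z_def)
  \<comment> \<open>A common rotation of both groups turns their resultant opposite to the side
    \<open>m\<close>, which has angle 0.\<close>
  define y where "y = Arg (- of_real (w m) / z)"
  have "norm (- of_real (w m) / z) = 1" using z wm by (simp add: norm_divide)
  then have "cis y = - of_real (w m) / z" unfolding y_def by (metis rcis_cmod_Arg rcis_def mult_1 of_real_1)
  then have zy: "z * cis y = - of_real (w m)" using z by simp
  define \<theta> where "\<theta> = (\<lambda>j. if j = m then 0 else if j \<in> A then y else x + y)"
  have "((\<lambda>j. of_real (w j) * cis y) has_sum (of_real P * cis y)) A"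
    by (intro has_sum_cmult_left has_sum_of_real hP)
  then have 1: "((\<lambda>j. of_real (w j) * cis (\<theta> j)) has_sum (of_real P * cis y)) A"
    using A(1) by (subst has_sum_cong[where g = "\<lambda>j. of_real (w j) * cis y"]) (auto simp: \<theta>_def \<Lambda>'_def)
  have "((\<lambda>j. of_real (w j) * cis (x + y)) has_sum (of_real Q * cis (x + y))) (\<Lambda>' - A)"
    by (intro has_sum_cmult_left has_sum_of_real hQ)
  then have 2: "((\<lambda>j. of_real (w j) * cis (\<theta> j)) has_sum (of_real Q * cis (x + y))) (\<Lambda>' - A)"
    by (subst has_sum_cong[where g = "\<lambda>j. of_real (w j) * cis (x + y)"]) (auto simp: \<theta>_def \<Lambda>'_def)
  have "((\<lambda>j. of_real (w j) * cis (\<theta> j)) has_sum (of_real P * cis y + of_real Q * cis (x + y))) (A \<union> (\<Lambda>' - A))"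
    by (rule has_sum_Un_disjoint[OF 1 2]) auto
  then have "((\<lambda>j. of_real (w j) * cis (\<theta> j)) has_sum (of_real (w m) * cis (\<theta> m) + (of_real P * cis y + of_real Q * cis (x + y)))) (insert m (A \<union> (\<Lambda>' - A)))"
    by (intro has_sum_insert) (use A(1) in \<open>auto simp: \<Lambda>'_def\<close>)
  moreover have "insert m (A \<union> (\<Lambda>' - A)) = \<Lambda>" using A(1) m(1) by (auto simp: \<Lambda>'_def)
  moreover have "of_real P * cis y + of_real Q * cis (x + y) = z * cis y"
    by (simp add: z_def distrib_right flip: cis_mult)
  then have "of_real (w m) * cis (\<theta> m) + (of_real P * cis y + of_real Q * cis (x + y)) = 0" by (simp add: zy \<theta>_def)
  ultimately show ?thesis by auto
qed

text \<open>The real bounds are parameters so that they can be shrunk: the final argument uses one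
  instance around the abscissa in question and another on one side of it, with the same
  series.\<close>

locale dirichlet_strip =
  fixes \<Lambda> :: "real set" and c :: "real \<Rightarrow> complex" and p q :: real and f :: "complex \<Rightarrow> complex"
  assumes independent: "int_independent \<Lambda>"
    and nonempty: "\<Lambda> \<noteq> {}"
    and coeff_nz: "\<nu> \<in> \<Lambda> \<Longrightarrow> c \<nu> \<noteq> 0"
    and summable: "p < \<sigma> \<Longrightarrow> \<sigma> < q \<Longrightarrow> (\<lambda>\<nu>. norm (c \<nu>) * exp (\<nu> * \<sigma>)) summable_on \<Lambda>"
    and series: "p < Re s \<Longrightarrow> Re s < q \<Longrightarrow> f s = infsum (\<lambda>\<nu>. c \<nu> * exp (of_real \<nu> * s)) \<Lambda>"
    and holomorphic: "f holomorphic_on {s. p < Re s \<and> Re s < q}"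
begin

definition w :: "real \<Rightarrow> real \<Rightarrow> real" where
  "w \<nu> \<sigma> = norm (c \<nu>) * exp (\<nu> * \<sigma>)"

definition total :: "real \<Rightarrow> real" where
  "total \<sigma> = infsum (\<lambda>\<nu>. w \<nu> \<sigma>) \<Lambda>"

lemma w_pos: "\<nu> \<in> \<Lambda> \<Longrightarrow> w \<nu> \<sigma> > 0"
  by (simp add: w_def coeff_nz)

lemma w_nonneg: "w \<nu> \<sigma> \<ge> 0"
  by (simp add: w_def)

lemma w_summable: "p < \<sigma> \<Longrightarrow> \<sigma> < q \<Longrightarrow> (\<lambda>\<nu>. w \<nu> \<sigma>) summable_on \<Lambda>"
  unfolding w_def by (rule summable)

lemma norm_term: "norm (c \<nu> * exp (of_real \<nu> * s)) = w \<nu> (Re s)"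
  by (simp add: w_def norm_mult)

text \<open>Kronecker's theorem adjusts the finitely many phases that matter on a closed substrip.
  Vertical shifts and rotations do not change the norms of the terms, so the tails of both series
  are small together.\<close>

lemma rotated_series_approx:
  assumes pq: "p < p'" "p' \<le> q'" "q' < q" and e: "e > 0"
  shows "\<exists>t. \<forall>s. p' \<le> Re s \<longrightarrow> Re s \<le> q' \<longrightarrow>
    norm (f (s + \<i> * of_real t) - infsum (\<lambda>\<nu>. c \<nu> * cis (\<phi> \<nu>) * exp (of_real \<nu> * s)) \<Lambda>) \<le> e"
proof -
  \<comment> \<open>A majorant on the whole substrip: each \<open>w \<nu>\<close> is monotone in the
    abscissa, so one of the two ends dominates.\<close>
  define W where "W = (\<lambda>\<nu>. w \<nu> p' + w \<nu> q')"
  have smW: "W summable_on \<Lambda>" unfolding W_def using pq by (intro summable_on_add w_summable) auto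
  have W0: "W \<nu> \<ge> 0" for \<nu> by (simp add: W_def w_nonneg)
  have wW: "w \<nu> x \<le> W \<nu>" if "p' \<le> x" "x \<le> q'" for \<nu> x
  proof (cases "\<nu> \<ge> 0")
    case True
    then have "w \<nu> x \<le> w \<nu> q'" unfolding w_def using that by (intro mult_left_mono) (auto intro: mult_left_mono)
    then show ?thesis using w_nonneg[of \<nu> p'] by (simp add: W_def)
  next
    case False
    then have "w \<nu> x \<le> w \<nu> p'" unfolding w_def using that by (intro mult_left_mono) (auto intro: mult_left_mono_neg)
    then show ?thesis using w_nonneg[of \<nu> q'] by (simp add: W_def)
  qed
  have "e / 3 > 0" using e by simp
  then obtain J where J: "finite J" "J \<subseteq> \<Lambda>" "infsum W (\<Lambda> - J) \<le> e / 3"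
    using abs_summable_tail[OF smW W0] by blast
  define K where "K = 1 + sum W J"
  define d where "d = e / (3 * K)"
  have "sum W J \<ge> 0" by (intro sum_nonneg W0)
  then have K: "K > 0" by (simp add: K_def)
  have "d > 0" using e K by (simp add: d_def)
  then obtain t where t: "\<And>\<nu>. \<nu> \<in> J \<Longrightarrow> norm (cis (\<nu> * t) - cis (\<phi> \<nu>)) \<le> d"
    using kronecker_cis[OF independent J(1,2)] by blast
  have "norm (f (s + \<i> * of_real t) - infsum (\<lambda>\<nu>. c \<nu> * cis (\<phi> \<nu>) * exp (of_real \<nu> * s)) \<Lambda>) \<le> e"
    if s: "p' \<le> Re s" "Re s \<le> q'" for s
  proof -
    define F where "F = (\<lambda>\<nu>. c \<nu> * exp (of_real \<nu> * (s + \<i> * of_real t)))"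
    define G where "G = (\<lambda>\<nu>. c \<nu> * cis (\<phi> \<nu>) * exp (of_real \<nu> * s))"
    have nF: "norm (F \<nu>) \<le> W \<nu>" for \<nu> unfolding F_def norm_term using wW[OF s] by simp
    have nG: "norm (G \<nu>) \<le> W \<nu>" for \<nu> using wW[OF s, of \<nu>] by (simp add: G_def norm_mult w_def)
    have fF: "f (s + \<i> * of_real t) = infsum F \<Lambda>" unfolding F_def using s pq by (intro series) auto
    have FG: "norm (F \<nu> - G \<nu>) \<le> W \<nu> * d" if "\<nu> \<in> J" for \<nu>
    proof -
      have "exp (of_real \<nu> * (s + \<i> * of_real t)) = exp (of_real \<nu> * s) * cis (\<nu> * t)"
        by (simp add: cis_conv_exp algebra_simps flip: exp_add)
      then have "F \<nu> - G \<nu> = c \<nu> * exp (of_real \<nu> * s) * (cis (\<nu> * t) - cis (\<phi> \<nu>))"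
        by (simp add: F_def G_def algebra_simps)
      also have "norm \<dots> \<le> W \<nu> * d"
        unfolding norm_mult[of "c \<nu> * exp (of_real \<nu> * s)"] norm_term
        using t[OF that] wW[OF s] W0 by (intro mult_mono) auto
      finally show ?thesis .
    qed
    have "norm (sum F J - sum G J) \<le> (\<Sum>\<nu>\<in>J. W \<nu> * d)"
      unfolding sum_subtractf[symmetric] by (rule sum_norm_le) (rule FG)
    also have "\<dots> = sum W J * d" by (simp add: sum_distrib_right)
    also have "\<dots> \<le> K * d" using \<open>d > 0\<close> by (simp add: K_def)
    also have "\<dots> = e / 3" using K by (simp add: d_def)
    finally have 1: "norm (sum F J - sum G J) \<le> e / 3" .
    have 2: "norm (infsum F \<Lambda> - sum F J) \<le> e / 3"
      by (rule order_trans[OF norm_infsum_diff_sum_le[OF smW nF J(1,2)] J(3)])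
    have 3: "norm (infsum G \<Lambda> - sum G J) \<le> e / 3"
      by (rule order_trans[OF norm_infsum_diff_sum_le[OF smW nG J(1,2)] J(3)])
    have "infsum F \<Lambda> - infsum G \<Lambda> = (infsum F \<Lambda> - sum F J) + ((sum F J - sum G J) - (infsum G \<Lambda> - sum G J))"
      by simp
    also have "norm \<dots> \<le> norm (infsum F \<Lambda> - sum F J) + norm ((sum F J - sum G J) - (infsum G \<Lambda> - sum G J))"
      by (rule norm_triangle_ineq)
    also have "norm ((sum F J - sum G J) - (infsum G \<Lambda> - sum G J)) \<le> norm (sum F J - sum G J) + norm (infsum G \<Lambda> - sum G J)"
      by (rule norm_triangle_ineq4)
    finally have "norm (infsum F \<Lambda> - infsum G \<Lambda>) \<le> e" using 1 2 3 by linarith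
    then show ?thesis unfolding fF G_def .
  qed
  then show ?thesis by blast
qed

text \<open>Rules out the degenerate limit in Hurwitz's theorem: a series that vanishes on a whole
  line has vanishing means, but these are its nonzero coefficients.\<close>

lemma rotated_series_nonconstant:
  assumes \<sigma>: "p < \<sigma>" "\<sigma> < q"
  shows "\<exists>t. infsum (\<lambda>\<nu>. c \<nu> * cis (\<phi> \<nu>) * exp (of_real \<nu> * Complex \<sigma> t)) \<Lambda> \<noteq> 0"
proof (rule ccontr)
  assume "\<not> ?thesis"
  then have z: "infsum (\<lambda>\<nu>. c \<nu> * cis (\<phi> \<nu>) * exp (of_real \<nu> * Complex \<sigma> t)) \<Lambda> = 0" for t by simp
  define a where "a = (\<lambda>\<nu>. c \<nu> * cis (\<phi> \<nu>) * of_real (exp (\<nu> * \<sigma>)))"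
  have "norm (a \<nu>) = w \<nu> \<sigma>" for \<nu> by (simp add: a_def w_def norm_mult)
  then have sm: "(\<lambda>\<nu>. norm (a \<nu>)) summable_on \<Lambda>" using w_summable[OF \<sigma>] by simp
  have "c \<nu> * cis (\<phi> \<nu>) * exp (of_real \<nu> * Complex \<sigma> t) = a \<nu> * cis (\<nu> * t)" for \<nu> t
  proof -
    have "complex_of_real \<nu> * Complex \<sigma> t = of_real (\<nu> * \<sigma>) + \<i> * of_real (\<nu> * t)" by (simp add: complex_eq_iff)
    then have "exp (complex_of_real \<nu> * Complex \<sigma> t) = of_real (exp (\<nu> * \<sigma>)) * cis (\<nu> * t)"
      by (simp only: exp_add cis_conv_exp exp_of_real)
    then show ?thesis by (simp add: a_def)
  qed
  then have z': "infsum (\<lambda>\<nu>. a \<nu> * cis (\<nu> * t)) \<Lambda> = 0" for t using z[of t] by simp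
  obtain \<mu> where \<mu>: "\<mu> \<in> \<Lambda>" using nonempty by blast
  have "has_umean (\<lambda>t. 0) (a \<mu>)" using umean_trig_series[OF sm, of \<mu>] \<mu> by (simp add: z')
  then have "a \<mu> = 0" by (rule has_umean_unique[OF _ has_umean_const])
  then show False using coeff_nz[OF \<mu>] by (simp add: a_def)
qed

text \<open>Where the terms can be arranged in a closed polygon, some limit of vertical translates of \<open>f\<close>
  vanishes by Kronecker's theorem, so Hurwitz's theorem gives zeros of \<open>f\<close> nearby.\<close>
lemma zero_of_polygon:
  assumes \<sigma>: "p < \<sigma>" "\<sigma> < q" and le: "\<And>\<nu>. \<nu> \<in> \<Lambda> \<Longrightarrow> 2 * w \<nu> \<sigma> \<le> total \<sigma>"
  shows "\<exists>s. p < Re s \<and> Re s < q \<and> f s = 0"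
proof (rule ccontr)
  assume "\<not> ?thesis"
  then have nz: "f s \<noteq> 0" if "p < Re s" "Re s < q" for s using that by blast
  obtain p' q' where pq: "p < p'" "p' < \<sigma>" "\<sigma> < q'" "q' < q" using \<sigma> dense by meson
  obtain \<theta> where \<theta>: "((\<lambda>\<nu>. of_real (w \<nu> \<sigma>) * cis (\<theta> \<nu>)) has_sum 0) \<Lambda>"
    using closed_polygon[OF w_summable[OF \<sigma>] w_pos nonempty] le unfolding total_def by blast
  \<comment> \<open>Compensates the argument of \<open>c \<nu>\<close>, so that at \<sigma> the
    rotated terms are exactly the sides of the polygon.\<close>
  define \<phi> where "\<phi> = (\<lambda>\<nu>. \<theta> \<nu> - Arg (c \<nu>))"
  define g where "g = (\<lambda>s. infsum (\<lambda>\<nu>. c \<nu> * cis (\<phi> \<nu>) * exp (of_real \<nu> * s)) \<Lambda>)"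
  define U where "U = {s. p' < Re s \<and> Re s < q'}"
  have "open U" unfolding U_def Collect_conj_eq by (intro open_Int open_halfspace_Re_gt open_halfspace_Re_lt)
  have "connected U" unfolding U_def Collect_conj_eq
    by (intro convex_connected convex_Int convex_halfspace_Re_gt convex_halfspace_Re_lt)
  have g0: "g (of_real \<sigma>) = 0"
  proof -
    have "c \<nu> * cis (\<phi> \<nu>) * exp (of_real \<nu> * of_real \<sigma>) = of_real (w \<nu> \<sigma>) * cis (\<theta> \<nu>)" for \<nu>
    proof -
      have "c \<nu> = of_real (norm (c \<nu>)) * cis (Arg (c \<nu>))" by (metis rcis_cmod_Arg rcis_def)
      moreover have "cis (Arg (c \<nu>)) * cis (\<phi> \<nu>) = cis (\<theta> \<nu>)" by (simp add: cis_mult \<phi>_def)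
      ultimately have "c \<nu> * cis (\<phi> \<nu>) = of_real (norm (c \<nu>)) * cis (\<theta> \<nu>)" by (metis mult.assoc)
      moreover have "exp (of_real \<nu> * of_real \<sigma>) = complex_of_real (exp (\<nu> * \<sigma>))"
        by (simp only: of_real_mult[symmetric] exp_of_real)
      ultimately show ?thesis by (simp add: w_def)
    qed
    then show ?thesis unfolding g_def using infsumI[OF \<theta>] by (simp only:)
  qed
  have "\<exists>t. \<forall>s. p' \<le> Re s \<longrightarrow> Re s \<le> q' \<longrightarrow> norm (f (s + \<i> * of_real t) - g s) \<le> inverse (real (Suc n))" for n
    unfolding g_def using pq by (intro rotated_series_approx) auto
  then have "\<forall>n. \<exists>t. \<forall>s. p' \<le> Re s \<longrightarrow> Re s \<le> q' \<longrightarrow> norm (f (s + \<i> * of_real t) - g s) \<le> inverse (real (Suc n))" ..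
  from choice[OF this] obtain t where t:
    "\<forall>n s. p' \<le> Re s \<longrightarrow> Re s \<le> q' \<longrightarrow> norm (f (s + \<i> * of_real (t n)) - g s) \<le> inverse (real (Suc n))" ..
  define \<F> where "\<F> = (\<lambda>n s. f (s + \<i> * of_real (t n)))"
  have ul: "uniform_limit U \<F> g sequentially"
  proof (rule uniform_limitI)
    fix e :: real assume "e > 0"
    then have "eventually (\<lambda>n. inverse (real (Suc n)) < e) sequentially"
      using LIMSEQ_inverse_real_of_nat by (rule order_tendstoD(2)[rotated])
    then show "eventually (\<lambda>n. \<forall>s\<in>U. dist (\<F> n s) (g s) < e) sequentially"
    proof (rule eventually_mono)
      fix n assume n: "inverse (real (Suc n)) < e"
      show "\<forall>s\<in>U. dist (\<F> n s) (g s) < e"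
      proof
        fix s assume "s \<in> U"
        then have "norm (\<F> n s - g s) \<le> inverse (real (Suc n))" using t by (simp add: U_def \<F>_def)
        then show "dist (\<F> n s) (g s) < e" using n by (simp add: dist_norm)
      qed
    qed
  qed
  have holF: "\<F> n holomorphic_on U" for n
  proof -
    have "f \<circ> (\<lambda>s. s + \<i> * of_real (t n)) holomorphic_on U"
      by (rule holomorphic_on_compose_gen[OF _ holomorphic]) (use pq in \<open>auto simp: U_def intro!: holomorphic_intros\<close>)
    then show ?thesis by (simp add: \<F>_def o_def)
  qed
  have holg: "g holomorphic_on U"
  proof (rule holomorphic_uniform_sequence[OF \<open>open U\<close> holF])
    fix x assume "x \<in> U"
    then obtain d where "d > 0" "cball x d \<subseteq> U" using \<open>open U\<close> open_contains_cball by blast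
    then show "\<exists>d>0. cball x d \<subseteq> U \<and> uniform_limit (cball x d) \<F> g sequentially"
      using uniform_limit_on_subset[OF ul] by blast
  qed
  have "g (of_real \<sigma>) \<noteq> 0"
  proof (rule Hurwitz_no_zeros[OF \<open>open U\<close> \<open>connected U\<close> holF holg])
    show "uniform_limit K \<F> g sequentially" if "K \<subseteq> U" for K by (rule uniform_limit_on_subset[OF ul that])
    show "\<F> n z \<noteq> 0" if "z \<in> U" for n z using that pq unfolding \<F>_def U_def by (intro nz) auto
    show "of_real \<sigma> \<in> U" using pq by (simp add: U_def)
    show "\<not> g constant_on U"
    proof
      assume "g constant_on U"
      then obtain k where k: "\<And>z. z \<in> U \<Longrightarrow> g z = k" unfolding constant_on_def by blast
      have "k = 0" using k[of "of_real \<sigma>"] g0 pq by (simp add: U_def)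
      obtain t where "g (Complex \<sigma> t) \<noteq> 0" using rotated_series_nonconstant[OF \<sigma>] unfolding g_def by blast
      then show False using k[of "Complex \<sigma> t"] \<open>k = 0\<close> pq by (simp add: U_def)
    qed
  qed
  then show False using g0 by simp
qed

section \<open>Terms that exceed the sum of the others\<close>

lemma polygon_of_zero:
  assumes s: "p < Re s" "Re s < q" "f s = 0" and \<nu>: "\<nu> \<in> \<Lambda>"
  shows "2 * w \<nu> (Re s) \<le> total (Re s)"
proof -
  define h where "h = (\<lambda>\<nu>. c \<nu> * exp (of_real \<nu> * s))"
  have nh: "norm (h \<nu>) = w \<nu> (Re s)" for \<nu> unfolding h_def by (rule norm_term)
  have sm: "(\<lambda>\<nu>. w \<nu> (Re s)) summable_on \<Lambda>" by (rule w_summable[OF s(1,2)])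
  have "infsum h \<Lambda> = 0" using series[OF s(1,2)] s(3) by (simp add: h_def)
  \<comment> \<open>At a zero the term \<nu> is cancelled by all the others, so its norm is at most
    the sum of theirs.\<close>
  moreover have "norm (infsum h \<Lambda> - sum h {\<nu>}) \<le> infsum (\<lambda>\<nu>. w \<nu> (Re s)) (\<Lambda> - {\<nu>})"
    by (rule norm_infsum_diff_sum_le[OF sm]) (use nh \<nu> in auto)
  moreover have "total (Re s) = w \<nu> (Re s) + infsum (\<lambda>\<nu>. w \<nu> (Re s)) (\<Lambda> - {\<nu>})"
    unfolding total_def using infsum_split[of "\<lambda>\<nu>. w \<nu> (Re s)" "{\<nu>}" "\<Lambda> - {\<nu>}"] sm \<nu> by (simp add: insert_absorb)
  ultimately show ?thesis using nh by simp
qed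

lemma sum_w_le_total:
  assumes "p < \<sigma>" "\<sigma> < q" "finite J" "J \<subseteq> \<Lambda>"
  shows "(\<Sum>\<nu>\<in>J. w \<nu> \<sigma>) \<le> total \<sigma>"
  unfolding total_def using assms by (intro finite_sum_le_infsum w_summable w_nonneg)

lemma w_convex:
  assumes "0 < t" "t < 1"
  shows "w \<nu> ((1 - t) * x + t * y) \<le> (1 - t) * w \<nu> x + t * w \<nu> y"
proof -
  have "exp ((1 - t) *\<^sub>R (\<nu> * x) + t *\<^sub>R (\<nu> * y)) \<le> (1 - t) * exp (\<nu> * x) + t * exp (\<nu> * y)"
    using assms by (intro convex_onD[OF exp_convex]) auto
  then have "norm (c \<nu>) * exp (\<nu> * ((1 - t) * x + t * y)) \<le> norm (c \<nu>) * ((1 - t) * exp (\<nu> * x) + t * exp (\<nu> * y))"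
    by (intro mult_left_mono) (auto simp: algebra_simps)
  then show ?thesis by (simp add: w_def algebra_simps)
qed

text \<open>A convergent sum of convex exponentials is convex, and a convex function on an open
  interval is continuous; this replaces an argument by uniform convergence.\<close>

lemma continuous_total: "continuous_on {p<..<q} total"
proof (rule convex_on_continuous)
  show "convex_on {p<..<q} total"
  proof (rule convex_onI)
    fix t x y :: real assume t: "0 < t" "t < 1" and xy: "x \<in> {p<..<q}" "y \<in> {p<..<q}"
    have sx: "(\<lambda>\<nu>. w \<nu> x) summable_on \<Lambda>" and sy: "(\<lambda>\<nu>. w \<nu> y) summable_on \<Lambda>" using xy by (auto intro: w_summable)
    have "(1 - t) *\<^sub>R x + t *\<^sub>R y \<in> {p<..<q}"
      using t xy by (intro convexD[OF convex_real_interval(8)]) auto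
    then have "total ((1 - t) * x + t * y) \<le> infsum (\<lambda>\<nu>. (1 - t) * w \<nu> x + t * w \<nu> y) \<Lambda>"
      unfolding total_def using w_convex[OF t]
      by (intro infsum_mono w_summable summable_on_add summable_on_cmult_right sx sy) auto
    also have "\<dots> = (1 - t) * total x + t * total y"
      unfolding total_def by (simp only: infsum_add[OF summable_on_cmult_right[OF sx] summable_on_cmult_right[OF sy]] infsum_cmult_right')
    finally show "total ((1 - t) *\<^sub>R x + t *\<^sub>R y) \<le> (1 - t) * total x + t * total y" by simp
  qed simp
qed simp

lemma continuous_w: "continuous_on A (w \<nu>)"
  unfolding w_def by (intro continuous_intros)

lemma dominant_unique:
  assumes \<sigma>: "p < \<sigma>" "\<sigma> < q" and "\<nu> \<in> \<Lambda>" "\<nu>' \<in> \<Lambda>" "total \<sigma> < 2 * w \<nu> \<sigma>" "total \<sigma> < 2 * w \<nu>' \<sigma>"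
  shows "\<nu> = \<nu>'"
  using sum_w_le_total[OF \<sigma>, of "{\<nu>, \<nu>'}"] assms by (cases "\<nu> = \<nu>'") auto

text \<open>The sets of abscissas at which a given term dominates are open by continuity and
  disjoint by \<open>dominant_unique\<close>; a connected interval covered by them lies in
  one.\<close>

lemma dominant_constant:
  assumes ab: "p \<le> a" "a < b" "b \<le> q"
    and dom: "\<And>\<sigma>. a < \<sigma> \<Longrightarrow> \<sigma> < b \<Longrightarrow> \<exists>\<nu>\<in>\<Lambda>. total \<sigma> < 2 * w \<nu> \<sigma>"
  shows "\<exists>\<nu>\<in>\<Lambda>. \<forall>\<sigma>. a < \<sigma> \<longrightarrow> \<sigma> < b \<longrightarrow> total \<sigma> < 2 * w \<nu> \<sigma>"
proof -
  define D where "D = (\<lambda>\<nu>. {\<sigma> \<in> {a<..<b}. total \<sigma> < 2 * w \<nu> \<sigma>})"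
  have opD: "open (D \<nu>)" for \<nu>
  proof -
    have "continuous_on {a<..<b} (\<lambda>\<sigma>. 2 * w \<nu> \<sigma> - total \<sigma>)"
      by (intro continuous_intros continuous_w continuous_on_subset[OF continuous_total]) (use ab in auto)
    then have "open ((\<lambda>\<sigma>. 2 * w \<nu> \<sigma> - total \<sigma>) -` {0<..} \<inter> {a<..<b})"
      by (subst (asm) continuous_on_open_vimage) auto
    moreover have "D \<nu> = (\<lambda>\<sigma>. 2 * w \<nu> \<sigma> - total \<sigma>) -` {0<..} \<inter> {a<..<b}" by (auto simp: D_def)
    ultimately show ?thesis by simp
  qed
  obtain m where m: "a < m" "m < b" using ab dense by blast
  then obtain \<nu> where \<nu>: "\<nu> \<in> \<Lambda>" "total m < 2 * w \<nu> m" using dom by blast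
  define E where "E = \<Union> (D ` (\<Lambda> - {\<nu>}))"
  have "open E" unfolding E_def using opD by blast
  have cover: "{a<..<b} \<subseteq> D \<nu> \<union> E"
  proof
    fix \<sigma> assume \<sigma>: "\<sigma> \<in> {a<..<b}"
    then obtain \<nu>' where "\<nu>' \<in> \<Lambda>" "total \<sigma> < 2 * w \<nu>' \<sigma>" using dom by auto
    then have "\<nu>' \<in> \<Lambda>" "\<sigma> \<in> D \<nu>'" using \<sigma> by (auto simp: D_def)
    then show "\<sigma> \<in> D \<nu> \<union> E" by (cases "\<nu>' = \<nu>") (auto simp: E_def)
  qed
  have disj: "D \<nu> \<inter> E = {}"
  proof (rule ccontr)
    assume "D \<nu> \<inter> E \<noteq> {}"
    then obtain \<sigma> where \<sigma>: "\<sigma> \<in> D \<nu>" "\<sigma> \<in> E" by blast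
    from \<sigma>(2) obtain \<nu>' where \<nu>': "\<nu>' \<in> \<Lambda>" "\<nu>' \<noteq> \<nu>" "\<sigma> \<in> D \<nu>'" unfolding E_def by blast
    have "p < \<sigma>" "\<sigma> < q" "total \<sigma> < 2 * w \<nu> \<sigma>" "total \<sigma> < 2 * w \<nu>' \<sigma>"
      using \<sigma>(1) \<nu>'(3) ab by (auto simp: D_def)
    from dominant_unique[OF this(1,2) \<nu>(1) \<nu>'(1) this(3,4)] show False using \<nu>'(2) by simp
  qed
  have "D \<nu> \<inter> {a<..<b} = {} \<or> E \<inter> {a<..<b} = {}"
    by (rule connectedD[OF connected_Ioo opD \<open>open E\<close> _ cover]) (use disj in simp)
  moreover have "m \<in> D \<nu> \<inter> {a<..<b}" using m \<nu> by (auto simp: D_def)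
  ultimately have "{a<..<b} \<subseteq> D \<nu>" using cover by blast
  then have "total \<sigma> < 2 * w \<nu> \<sigma>" if "a < \<sigma>" "\<sigma> < b" for \<sigma>
    using that unfolding D_def by auto
  then show ?thesis using \<nu>(1) by blast
qed

text \<open>The filter is kept general so that both one-sided limits at \<open>x\<close> are
  instances.\<close>

lemma dominant_limit:
  assumes x: "p < x" "x < q" and F: "F \<le> at x" "F \<noteq> bot"
    and ev: "eventually (\<lambda>\<sigma>. total \<sigma> < 2 * w \<nu> \<sigma>) F"
  shows "total x \<le> 2 * w \<nu> x"
proof -
  have "continuous_on {p<..<q} (\<lambda>\<sigma>. 2 * w \<nu> \<sigma> - total \<sigma>)"
    by (intro continuous_intros continuous_w continuous_total)
  then have "isCont (\<lambda>\<sigma>. 2 * w \<nu> \<sigma> - total \<sigma>) x"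
    using x by (simp add: continuous_on_eq_continuous_at)
  then have "((\<lambda>\<sigma>. 2 * w \<nu> \<sigma> - total \<sigma>) \<longlongrightarrow> 2 * w \<nu> x - total x) F"
    unfolding isCont_def using F(1) tendsto_mono by blast
  then have "0 \<le> 2 * w \<nu> x - total x"
    by (rule tendsto_lowerbound) (use ev F(2) in \<open>auto elim: eventually_mono\<close>)
  then show ?thesis by simp
qed

text \<open>Dividing by the dominant term turns the total into a sum of exponentials, which is convex:
  it cannot be less than 2 on both sides of a point where it equals 2.\<close>
lemma dominant_both_sides:
  assumes x: "p < x - h" "x + h < q" "h > 0" and \<nu>: "\<nu> \<in> \<Lambda>"
    and l: "total (x - h) < 2 * w \<nu> (x - h)" and r: "total (x + h) < 2 * w \<nu> (x + h)"
  shows "total x < 2 * w \<nu> x"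
proof -
  have wp: "w \<nu> \<sigma> > 0" for \<sigma> by (rule w_pos[OF \<nu>])
  have sm: "(\<lambda>\<mu>. w \<mu> \<sigma> / w \<nu> \<sigma>) summable_on \<Lambda>" if "p < \<sigma>" "\<sigma> < q" for \<sigma>
    using summable_on_cmult_left[OF w_summable[OF that], of "1 / w \<nu> \<sigma>"] by simp
  have tot: "infsum (\<lambda>\<mu>. w \<mu> \<sigma> / w \<nu> \<sigma>) \<Lambda> = total \<sigma> / w \<nu> \<sigma>" for \<sigma>
    unfolding total_def using infsum_cmult_left'[of "\<lambda>\<mu>. w \<mu> \<sigma>" "1 / w \<nu> \<sigma>" \<Lambda>] by simp
  have ratio: "w \<mu> \<sigma> / w \<nu> \<sigma> = norm (c \<mu>) / norm (c \<nu>) * exp ((\<mu> - \<nu>) * \<sigma>)" for \<mu> \<sigma>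
    by (simp add: w_def left_diff_distrib exp_diff)
  have mid: "w \<mu> x / w \<nu> x \<le> 1/2 * (w \<mu> (x - h) / w \<nu> (x - h)) + 1/2 * (w \<mu> (x + h) / w \<nu> (x + h))" for \<mu>
  proof -
    have "exp ((1 - 1/2) *\<^sub>R ((\<mu> - \<nu>) * (x - h)) + (1/2) *\<^sub>R ((\<mu> - \<nu>) * (x + h)))
        \<le> (1 - 1/2) * exp ((\<mu> - \<nu>) * (x - h)) + 1/2 * exp ((\<mu> - \<nu>) * (x + h))"
      by (intro convex_onD[OF exp_convex]) auto
    moreover have "(1 - 1/2) *\<^sub>R ((\<mu> - \<nu>) * (x - h)) + (1/2) *\<^sub>R ((\<mu> - \<nu>) * (x + h)) = (\<mu> - \<nu>) * x"
      by (simp add: field_simps)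
    ultimately have e: "exp ((\<mu> - \<nu>) * x) \<le> 1/2 * exp ((\<mu> - \<nu>) * (x - h)) + 1/2 * exp ((\<mu> - \<nu>) * (x + h))"
      by simp
    have "norm (c \<mu>) / norm (c \<nu>) * exp ((\<mu> - \<nu>) * x)
        \<le> norm (c \<mu>) / norm (c \<nu>) * (1/2 * exp ((\<mu> - \<nu>) * (x - h)) + 1/2 * exp ((\<mu> - \<nu>) * (x + h)))"
      by (rule mult_left_mono[OF e]) simp
    then show ?thesis unfolding ratio by (simp only: distrib_left mult_ac)
  qed
  have sl: "(\<lambda>\<mu>. w \<mu> (x - h) / w \<nu> (x - h)) summable_on \<Lambda>" and sr: "(\<lambda>\<mu>. w \<mu> (x + h) / w \<nu> (x + h)) summable_on \<Lambda>"
    and sx: "(\<lambda>\<mu>. w \<mu> x / w \<nu> x) summable_on \<Lambda>"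
    using x by (auto intro!: sm)
  have "total x / w \<nu> x \<le> infsum (\<lambda>\<mu>. 1/2 * (w \<mu> (x - h) / w \<nu> (x - h)) + 1/2 * (w \<mu> (x + h) / w \<nu> (x + h))) \<Lambda>"
    unfolding tot[symmetric]
    by (rule infsum_mono[OF sx summable_on_add[OF summable_on_cmult_right[OF sl] summable_on_cmult_right[OF sr]] mid])
  also have "\<dots> = 1/2 * (total (x - h) / w \<nu> (x - h)) + 1/2 * (total (x + h) / w \<nu> (x + h))"
    by (simp only: infsum_add[OF summable_on_cmult_right[OF sl] summable_on_cmult_right[OF sr]] infsum_cmult_right' tot)
  also have "\<dots> < 1/2 * 2 + 1/2 * 2"
    using l r wp by (intro add_strict_mono mult_strict_left_mono) (auto simp: divide_less_eq)
  finally show ?thesis using wp[of x] by (simp add: divide_less_eq)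
qed

text \<open>The hypothesis \<open>only\<close> is what \<open>zero_of_polygon\<close> gives where no
  zeros are near. The zero over \<open>x\<close> bounds every term by half of the total, while
  one-sided limits give the opposite bound for the terms dominating on the left and on the right, so
  each of these is exactly half.\<close>

lemma no_isolated_zero_abscissa:
  assumes x: "p < x" "x < q" and zero: "Re s0 = x" "f s0 = 0"
    and three: "infinite \<Lambda> \<or> 3 \<le> card \<Lambda>"
    and only: "\<And>\<sigma>. p < \<sigma> \<Longrightarrow> \<sigma> < q \<Longrightarrow> \<sigma> \<noteq> x \<Longrightarrow> \<exists>\<nu>\<in>\<Lambda>. total \<sigma> < 2 * w \<nu> \<sigma>"
  shows False
proof -
  have le: "2 * w \<nu> x \<le> total x" if "\<nu> \<in> \<Lambda>" for \<nu>
    using polygon_of_zero[of s0 \<nu>] zero x that by simp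
  obtain l where l: "l \<in> \<Lambda>" "\<And>\<sigma>. p < \<sigma> \<Longrightarrow> \<sigma> < x \<Longrightarrow> total \<sigma> < 2 * w l \<sigma>"
    using dominant_constant[of p x] only x by force
  obtain r where r: "r \<in> \<Lambda>" "\<And>\<sigma>. x < \<sigma> \<Longrightarrow> \<sigma> < q \<Longrightarrow> total \<sigma> < 2 * w r \<sigma>"
    using dominant_constant[of x q] only x by force
  have "eventually (\<lambda>\<sigma>. total \<sigma> < 2 * w l \<sigma>) (at_left x)"
    using l(2) x by (auto simp: eventually_at_left[OF x(1)])
  then have lx: "total x \<le> 2 * w l x"
    by (rule dominant_limit[OF x, rotated 2]) (auto simp: at_le)
  have "eventually (\<lambda>\<sigma>. total \<sigma> < 2 * w r \<sigma>) (at_right x)"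
    using r(2) x by (auto simp: eventually_at_right[OF x(2)])
  then have rx: "total x \<le> 2 * w r x"
    by (rule dominant_limit[OF x, rotated 2]) (auto simp: at_le)
  show False
  proof (cases "l = r")
    case True
    define h where "h = min (x - p) (q - x) / 2"
    have h: "h > 0" "p < x - h" "x + h < q" using x by (auto simp: h_def min_def field_simps)
    have "total x < 2 * w l x"
      by (rule dominant_both_sides[OF h(2,3,1) l(1)]) (use l r True h in auto)
    then show False using le[OF l(1)] by simp
  next
    case False
    have "\<not> \<Lambda> \<subseteq> {l, r}"
    proof
      assume sub: "\<Lambda> \<subseteq> {l, r}"
      then have "card \<Lambda> \<le> card {l, r}" by (intro card_mono) auto
      then show False using three finite_subset[OF sub] card_2_iff[of "{l, r}"] False by auto
    qed
    then obtain k where k: "k \<in> \<Lambda>" "k \<noteq> l" "k \<noteq> r" by blast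
    have "(\<Sum>\<nu>\<in>{l, r, k}. w \<nu> x) \<le> total x" using l r k by (intro sum_w_le_total x) auto
    then have "w l x + w r x + w k x \<le> total x" using False k by auto
    then show False using lx rx w_pos[OF k(1), of x] by simp
  qed
qed

end

theorem theorem12:
  fixes f :: "complex \<Rightarrow> complex" and \<alpha> \<beta> :: ereal
  assumes "\<alpha> < \<beta>"
    and "almost_periodic_on_strip f \<alpha> \<beta>"
    and "rat_lin_independent (fourier_exponents f \<alpha> \<beta>)"
    and "infinite (fourier_exponents f \<alpha> \<beta>) \<or> 3 \<le> card (fourier_exponents f \<alpha> \<beta>)"
  shows "\<not> (\<exists>x. x isolated_in (Re ` {s \<in> vertical_strip \<alpha> \<beta>. f s = 0}))"
proof
  define \<Lambda> where "\<Lambda> = fourier_exponents f \<alpha> \<beta>"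
  define Z where "Z = Re ` {s \<in> vertical_strip \<alpha> \<beta>. f s = 0}"
  have ind: "int_independent \<Lambda>" unfolding \<Lambda>_def by (rule int_independent_of_rat[OF assms(3)])
  from strip_dirichlet_series[OF assms(1,2) ind[unfolded \<Lambda>_def]] obtain c where
    c0: "\<forall>\<nu>\<in>\<Lambda>. c \<nu> \<noteq> 0" and
    c1: "\<forall>\<sigma>. \<alpha> < ereal \<sigma> \<and> ereal \<sigma> < \<beta> \<longrightarrow> (\<lambda>\<nu>. norm (c \<nu>) * exp (\<nu> * \<sigma>)) summable_on \<Lambda>" and
    c2: "\<forall>s\<in>vertical_strip \<alpha> \<beta>. f s = infsum (\<lambda>\<nu>. c \<nu> * exp (of_real \<nu> * s)) \<Lambda>"
    unfolding \<Lambda>_def by (elim exE conjE)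
  note c = bspec[OF c0] c1[rule_format, OF conjI] bspec[OF c2]
  have ne: "\<Lambda> \<noteq> {}" using assms(4) unfolding \<Lambda>_def[symmetric] by auto
  have hol: "f holomorphic_on vertical_strip \<alpha> \<beta>"
    using assms(2) analytic_imp_holomorphic unfolding almost_periodic_on_strip_def by blast
  assume "\<exists>x. x isolated_in (Re ` {s \<in> vertical_strip \<alpha> \<beta>. f s = 0})"
  then obtain x T where x: "x \<in> Z" "open T" "T \<inter> Z = {x}" unfolding Z_def isolated_in_def by blast
  obtain s0 where s0: "s0 \<in> vertical_strip \<alpha> \<beta>" "f s0 = 0" "Re s0 = x" using x(1) unfolding Z_def by blast
  have "\<alpha> < ereal x" "ereal x < \<beta>" using s0 by (auto simp: vertical_strip_def)
  then obtain e where e: "e > 0" "\<alpha> < ereal (x - e)" "ereal (x + e) < \<beta>" by (rule strip_enlarge)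
  have "x \<in> T" using x(3) by blast
  then obtain d where d: "d > 0" "ball x d \<subseteq> T" using x(2) open_contains_ball by blast
  \<comment> \<open>Within \<open>d\<close> of \<open>x\<close> no other abscissa of a zero occurs,
    and within \<open>e\<close> the strip is not left.\<close>
  define p q where "p = x - min d e" "q = x + min d e"
  have pq: "p < x" "x < q" using d e by (auto simp: p_q_def)
  have st: "s \<in> vertical_strip \<alpha> \<beta>" if "p < Re s" "Re s < q" for s
  proof -
    have "ereal (x - e) \<le> ereal (Re s)" "ereal (Re s) \<le> ereal (x + e)" using that by (auto simp: p_q_def)
    then show ?thesis using e(2,3) less_le_trans le_less_trans unfolding vertical_strip_def by blast
  qed
  have sub: "dirichlet_strip \<Lambda> c p' q' f" if "p \<le> p'" "q' \<le> q" for p' q'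
  proof
    show "(\<lambda>\<nu>. norm (c \<nu>) * exp (\<nu> * \<sigma>)) summable_on \<Lambda>" if "p' < \<sigma>" "\<sigma> < q'" for \<sigma>
      using st[of "of_real \<sigma>"] that \<open>p \<le> p'\<close> \<open>q' \<le> q\<close> by (intro c(2)) (auto simp: vertical_strip_def)
    show "f s = infsum (\<lambda>\<nu>. c \<nu> * exp (of_real \<nu> * s)) \<Lambda>" if "p' < Re s" "Re s < q'" for s
      using that \<open>p \<le> p'\<close> \<open>q' \<le> q\<close> by (intro c(3) st) auto
    show "f holomorphic_on {s. p' < Re s \<and> Re s < q'}"
      using st that by (intro holomorphic_on_subset[OF hol]) auto
  qed (use ind ne c(1) in auto)
  interpret D: dirichlet_strip \<Lambda> c p q f by (rule sub) auto
  show False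
  proof (rule D.no_isolated_zero_abscissa[OF pq s0(3,2)])
    show "infinite \<Lambda> \<or> 3 \<le> card \<Lambda>" using assms(4) by (simp add: \<Lambda>_def)
    fix \<sigma> assume \<sigma>: "p < \<sigma>" "\<sigma> < q" "\<sigma> \<noteq> x"
    show "\<exists>\<nu>\<in>\<Lambda>. D.total \<sigma> < 2 * D.w \<nu> \<sigma>"
    proof (rule ccontr)
      assume "\<not> ?thesis"
      then have le: "2 * D.w \<nu> \<sigma> \<le> D.total \<sigma>" if "\<nu> \<in> \<Lambda>" for \<nu> using that by (simp add: not_less)
      \<comment> \<open>The side of \<open>x\<close> that contains \<sigma>. A closed polygon at
        \<sigma> yields a zero with abscissa on this side, hence in \<open>T\<close> but different
        from \<open>x\<close>.\<close>
      define p' q' where "p' = (if \<sigma> < x then p else x)" "q' = (if \<sigma> < x then x else q)"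
      have p'q': "p \<le> p'" "q' \<le> q" "p' < \<sigma>" "\<sigma> < q'" "x \<le> p' \<or> q' \<le> x" using \<sigma> pq by (auto simp: p'_q'_def)
      interpret D': dirichlet_strip \<Lambda> c p' q' f by (rule sub) (use p'q' in auto)
      \<comment> \<open>Neither \<open>w\<close> nor \<open>total\<close> involves the bounds, so
        the polygon inequalities carry over to the smaller strip.\<close>
      have "D'.w = D.w" by (simp add: D'.w_def D.w_def fun_eq_iff)
      then have "D'.total = D.total" by (simp add: D'.total_def D.total_def fun_eq_iff)
      then obtain s where s: "p' < Re s" "Re s < q'" "f s = 0"
        using D'.zero_of_polygon[OF p'q'(3,4)] le \<open>D'.w = D.w\<close> by auto
      have "Re s \<in> Z" unfolding Z_def using s p'q' st[of s] by auto
      moreover have "Re s \<in> T" using s p'q' d(2) by (auto simp: p_q_def dist_real_def subset_iff)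
      ultimately have "Re s = x" using x(3) by blast
      then show False using s p'q' by auto
    qed
  qed
qed

end
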